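(* Assume that the general assumptions hold. Let $\lambda\neq 1$ be an eigenvalue of $U'$ and $M\subset\mathbb{C}$ an open neighborhood of $\lambda$ such that $\sigma(U')\cap M=\{\lambda\}$. Then: 1. (Convergence of eigenvalues) The eigenvalues in $\sigma(L'_n)\cap M$ converge to $\lambda$ in the sense that every sequence $(\lambda_n)_{n\in\mathbb{N}}$ with $\lambda_n\in\sigma(L'_n)\cap M$ satisfies $\lambda_n\to\lambda$ almost surely. 2. (Convergence of spectral projections) There exists some $N\in\mathbb{N}$ such that, for $n>N$, the sets $\sigma(U'_n)\cap M$ are isolated in $\sigma(U'_n)$. For $n>N$, let $\mathrm{Pr}'_n$ be the spectral projections of $U'_n$ corresponding to $\sigma(U'_n)\cap M$, and $\mathrm{Pr}$ the spectral projection of $U'$ for $\lambda$. Then $\mathrm{Pr}'_n\to\mathrm{Pr}$ pointwise almost surely. 3. (Convergence of eigenvectors) If $\lambda$ is a simple eigenvalue, then the eigenvectors of $L'_n$ converge almost surely up to a change of sign: if $v_n$ is the eigenvector of $L'_n$ with eigenvalue $\lambda_n$, $v_{n,i}$ its $i$th coordinate, and $f$ the eigenfunction of $U'$ with eigenvalue $\lambda$, then there exists a sequence $(a_n)_{n\in\mathbb{N}}$ with $a_n\in\{+1,-1\}$ such that $\sup_{i=1,\dots,n}|a_nv_{n,i}-f(X_i)|\to0$ almost surely. In particular, for all $b\in\mathbb{R}$, the sets $\{a_nf_n>b\}$ and $\{f>b\}$ converge, that is, their symmetric difference satisfies $P(\{f>b\}\,\triangle\,\{a_nf_n>b\})\t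o0$.
   Context: General assumptions: $\mathcal{X}$ is a compact metric space with Borel $\sigma$-algebra, $P$ a probability measure on $\mathcal{X}$ whose support is $\mathcal{X}$; the sample points $X_1,X_2,\dots$ are drawn independently according to $P$, and $P_n=\frac1n\sum_{i=1}^n\delta_{X_i}$; the similarity function $k:\mathcal{X}\times\mathcal{X}\to\mathbb{R}$ is symmetric and continuous, and there is a constant $l>0$ with $k(x,y)>l$ for all $x,y\in\mathcal{X}$. Matrices: $K_n=(k(X_i,X_j))_{i,j\le n}$; $D_n$ is the diagonal matrix with diagonal entries $\sum_{j=1}^nk(X_i,X_j)$; $L_n=D_n-K_n$; $L'_n=D_n^{-1/2}L_nD_n^{-1/2}$. Operators on the Banach space $(C(\mathcal{X}),\|\cdot\|_\infty)$ of continuous functions: with $d_n(x)=\int k(x,y)\,dP_n(y)$, $d(x)=\int k(x,y)\,dP(y)$, $h_n(x,y)=k(x,y)/\sqrt{d_n(x)d_n(y)}$, $h(x,y)=k(x,y)/\sqrt{d(x)d(y)}$, set $\widehat{T_n}g(x)=\int h_n(x,y)g(y)\,dP_n(y)$, $Tg(x)=\int h(x,y)g(y)\,dP(y)$, $U'_n=I-\widehat{T_n}$, $U'=I-T$. In part 3, $\lambda_n\in\sigma(L'_n)\cap M$, and $f_n\in C(\mathcal{X})$ denotes the eigenfunction of $U'_n$ with eigenvalue $\lambda_n$ corresponding to $v_n$, i.e. $(f_n(X_1),\dots,f_n(X_n))^t=v_n$. $\sigma(\cdot)$ denotes the spectrum. A subset $\tau\subset\sigma(A)$ of the spectrum of a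 bounded operator $A$ is isolated if there is an open neighborhood $O\subset\mathbb{C}$ of $\tau$ with $\sigma(A)\cap O=\tau$; the corresponding spectral projection is $\frac{1}{2\pi i}\int_\Gamma(A-\zeta I)^{-1}\,d\zeta$, where $\Gamma$ is a closed Jordan curve separating $\tau$ from the rest of $\sigma(A)$. Operators $S_n$ converge pointwise to $S$ if $\|S_ng-Sg\|_\infty\to0$ for all $g\in C(\mathcal{X})$. An eigenvalue is simple if it has algebraic multiplicity 1.
   Formalization: Added: σ(U') does not meet the boundary of M; 1 ∉ M; the claim on {f>b} is only for b with P(f=b)=0. In part 3, f, f_n, v_n are real and f, f_n have sup norm 1. Without these the claim fails or is ill-defined, e.g. on a one- or two-point X. *)

theory Defs
  imports
    "HOL-Complex_Analysis.Complex_Analysis"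
    "HOL-Probability.Probability"
    "Jordan_Normal_Form.Spectral_Radius"
begin

unbundle no vec_syntax

text \<open>Spectra are subsets of the complex plane, so the Banach space is the type of bounded
  continuous complex-valued functions with the supremum norm; on a compact space these are all
  continuous functions. HOL-Analysis has no complex normed spaces, hence the explicit complex
  scalar multiplication. Operators are real-bounded-linear maps; all operators considered below
  are complex linear, and so are then their inverses.\<close>

definition cscale :: "complex \<Rightarrow> ('a::topological_space \<Rightarrow>\<^sub>C complex) \<Rightarrow> ('a \<Rightarrow>\<^sub>C complex)" where
  "cscale c f = Bcontfun (\<lambda>x. c * apply_bcontfun f x)"

definition complexify :: "('a::topological_space \<Rightarrow>\<^sub>C real) \<Rightarrow> ('a \<Rightarrow>\<^sub>C complex)" where
  "complexify f = Bcontfun (\<lambda>x. complex_of_real (apply_bcontfun f x))"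

definition cscale_op ::
  "complex \<Rightarrow> ('a::topological_space \<Rightarrow>\<^sub>C complex) \<Rightarrow>\<^sub>L ('a \<Rightarrow>\<^sub>C complex)" where
  "cscale_op c = Blinfun (cscale c)"

lemma apply_cscale [simp]: "apply_bcontfun (cscale c f) x = c * apply_bcontfun f x"
proof -
  have "(\<lambda>x. c * apply_bcontfun f x) \<in> bcontfun"
    by (rule bcontfun_normI[where b = "norm c * norm f"])
       (auto intro!: continuous_intros mult_left_mono norm_bounded simp: norm_mult)
  then show ?thesis by (simp add: cscale_def Bcontfun_inverse)
qed

lemma apply_complexify [simp]:
  "apply_bcontfun (complexify f) x = complex_of_real (apply_bcontfun f x)"
proof -
  have "(\<lambda>x. complex_of_real (apply_bcontfun f x)) \<in> bcontfun"
    by (rule bcontfun_normI[where b = "norm f"])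
       (use norm_bounded[of f] in \<open>auto intro!: continuous_intros\<close>)
  then show ?thesis by (simp add: complexify_def Bcontfun_inverse)
qed

lemma apply_cscale_op [simp]: "blinfun_apply (cscale_op c) f = cscale c f"
proof -
  have "bounded_linear (cscale c :: ('a \<Rightarrow>\<^sub>C complex) \<Rightarrow> _)"
    by (rule bounded_linear_intro[where K = "cmod c"])
       (auto intro!: bcontfun_eqI norm_bound mult_left_mono norm_bounded
         simp: plus_bcontfun.rep_eq scaleR_bcontfun.rep_eq norm_mult distrib_left mult.commute[of _ "cmod c"])
  then show ?thesis by (simp add: cscale_op_def bounded_linear_Blinfun_apply)
qed

interpretation cfun: vector_space "cscale :: complex \<Rightarrow> ('a::topological_space \<Rightarrow>\<^sub>C complex) \<Rightarrow> _"
  by unfold_locales (auto intro!: bcontfun_eqI simp: plus_bcontfun.rep_eq algebra_simps)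

type_synonym 'a cop = "('a \<Rightarrow>\<^sub>C complex) \<Rightarrow>\<^sub>L ('a \<Rightarrow>\<^sub>C complex)"

definition is_inverse_op :: "'a::topological_space cop \<Rightarrow> 'a cop \<Rightarrow> bool" where
  "is_inverse_op A B \<longleftrightarrow> A o\<^sub>L B = id_blinfun \<and> B o\<^sub>L A = id_blinfun"

definition op_spectrum :: "'a::topological_space cop \<Rightarrow> complex set" where
  "op_spectrum A = {\<zeta>. \<not> (\<exists>B. is_inverse_op (A - cscale_op \<zeta>) B)}"

definition resolvent :: "'a::topological_space cop \<Rightarrow> complex \<Rightarrow> 'a cop" where
  "resolvent A \<zeta> = (THE B. is_inverse_op (A - cscale_op \<zeta>) B)"

definition eigenfunction :: "'a::topological_space cop \<Rightarrow> ('a \<Rightarrow>\<^sub>C complex) \<Rightarrow> complex \<Rightarrow> bool" where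
  "eigenfunction A g \<mu> \<longleftrightarrow> g \<noteq> 0 \<and> blinfun_apply A g = cscale \<mu> g"

definition op_eigenvalue :: "'a::topological_space cop \<Rightarrow> complex \<Rightarrow> bool" where
  "op_eigenvalue A \<mu> \<longleftrightarrow> (\<exists>g. eigenfunction A g \<mu>)"

definition isolated_part :: "'a::topological_space cop \<Rightarrow> complex set \<Rightarrow> bool" where
  "isolated_part A \<tau> \<longleftrightarrow>
     \<tau> \<subseteq> op_spectrum A \<and> (\<exists>V. open V \<and> \<tau> \<subseteq> V \<and> op_spectrum A \<inter> V = \<tau>)"

text \<open>Since the resolvent is \<open>(A - \<zeta> I)\<inverse>\<close> rather than \<open>(\<zeta> I - A)\<inverse>\<close>, the curve has to run
  clockwise for the integral below to be a projection rather than the negative of one.\<close>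

definition separating_curve ::
  "'a::topological_space cop \<Rightarrow> complex set \<Rightarrow> (real \<Rightarrow> complex) \<Rightarrow> bool" where
  "separating_curve A \<tau> \<Gamma> \<longleftrightarrow>
     valid_path \<Gamma> \<and> simple_path \<Gamma> \<and> pathfinish \<Gamma> = pathstart \<Gamma> \<and>
     \<tau> \<subseteq> inside (path_image \<Gamma>) \<and> op_spectrum A - \<tau> \<subseteq> outside (path_image \<Gamma>) \<and>
     (\<forall>z\<in>inside (path_image \<Gamma>). winding_number \<Gamma> z = -1)"

text \<open>The value does not depend on the separating curve, by Cauchy's theorem. The integral is the
  one in the Banach space of operators.\<close>

definition spectral_projection :: "'a::metric_space cop \<Rightarrow> complex set \<Rightarrow> 'a cop" where
  "spectral_projection A \<tau> =
     (let \<Gamma> = (SOME \<Gamma>. separating_curve A \<tau> \<Gamma>) in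
      cscale_op (1 / (2 * of_real pi * \<i>)) o\<^sub>L
      integral {0..1} (\<lambda>t. cscale_op (vector_derivative \<Gamma> (at t)) o\<^sub>L resolvent A (\<Gamma> t)))"

text \<open>Algebraic multiplicity of an isolated spectral value: the complex dimension of the range of
  its spectral projection. (The library's dimension is 0 for infinite-dimensional spaces.)\<close>

definition algebraic_multiplicity :: "'a::metric_space cop \<Rightarrow> complex \<Rightarrow> nat" where
  "algebraic_multiplicity A \<mu> = cfun.dim (range (blinfun_apply (spectral_projection A {\<mu>})))"

definition simple_eigenvalue :: "'a::metric_space cop \<Rightarrow> complex \<Rightarrow> bool" where
  "simple_eigenvalue A \<mu> \<longleftrightarrow> op_eigenvalue A \<mu> \<and> algebraic_multiplicity A \<mu> = 1"

text \<open>The measure \<open>Q\<close> is either the sampling distribution or an empirical distribution.\<close>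

definition deg :: "('a \<Rightarrow> 'a \<Rightarrow> real) \<Rightarrow> 'a measure \<Rightarrow> 'a \<Rightarrow> real" where
  "deg k Q x = (\<integral>y. k x y \<partial>Q)"

definition nker :: "('a \<Rightarrow> 'a \<Rightarrow> real) \<Rightarrow> 'a measure \<Rightarrow> 'a \<Rightarrow> 'a \<Rightarrow> real" where
  "nker k Q x y = k x y / sqrt (deg k Q x * deg k Q y)"

definition T_op :: "('a::topological_space \<Rightarrow> 'a \<Rightarrow> real) \<Rightarrow> 'a measure \<Rightarrow> 'a cop" where
  "T_op k Q = Blinfun (\<lambda>g. Bcontfun (\<lambda>x. \<integral>y. complex_of_real (nker k Q x y) * apply_bcontfun g y \<partial>Q))"

definition U_op :: "('a::topological_space \<Rightarrow> 'a \<Rightarrow> real) \<Rightarrow> 'a measure \<Rightarrow> 'a cop" where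
  "U_op k Q = id_blinfun - T_op k Q"

text \<open>Samples \<open>x 0, \<dots>, x (n - 1)\<close>, indexed from 0.\<close>

definition empirical :: "(nat \<Rightarrow> 'a::topological_space) \<Rightarrow> nat \<Rightarrow> 'a measure" where
  "empirical x n = distr (uniform_count_measure {..<n}) borel x"

definition support :: "'a::topological_space measure \<Rightarrow> 'a set" where
  "support Q = {x. \<forall>V. open V \<and> x \<in> V \<longrightarrow> emeasure Q V > 0}"

definition sim_mat :: "('a \<Rightarrow> 'a \<Rightarrow> real) \<Rightarrow> (nat \<Rightarrow> 'a) \<Rightarrow> nat \<Rightarrow> real mat" where
  "sim_mat k x n = mat n n (\<lambda>(i, j). k (x i) (x j))"

definition deg_mat :: "('a \<Rightarrow> 'a \<Rightarrow> real) \<Rightarrow> (nat \<Rightarrow> 'a) \<Rightarrow> nat \<Rightarrow> real mat" where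
  "deg_mat k x n = mat_diag n (\<lambda>i. \<Sum>j<n. k (x i) (x j))"

definition deg_mat_inv_sqrt :: "('a \<Rightarrow> 'a \<Rightarrow> real) \<Rightarrow> (nat \<Rightarrow> 'a) \<Rightarrow> nat \<Rightarrow> real mat" where
  "deg_mat_inv_sqrt k x n = mat_diag n (\<lambda>i. 1 / sqrt (\<Sum>j<n. k (x i) (x j)))"

definition lap_mat :: "('a \<Rightarrow> 'a \<Rightarrow> real) \<Rightarrow> (nat \<Rightarrow> 'a) \<Rightarrow> nat \<Rightarrow> real mat" where
  "lap_mat k x n = deg_mat k x n - sim_mat k x n"

definition nlap_mat :: "('a \<Rightarrow> 'a \<Rightarrow> real) \<Rightarrow> (nat \<Rightarrow> 'a) \<Rightarrow> nat \<Rightarrow> real mat" where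
  "nlap_mat k x n = deg_mat_inv_sqrt k x n * lap_mat k x n * deg_mat_inv_sqrt k x n"

definition nlap_cmat :: "('a \<Rightarrow> 'a \<Rightarrow> real) \<Rightarrow> (nat \<Rightarrow> 'a) \<Rightarrow> nat \<Rightarrow> complex mat" where
  "nlap_cmat k x n = map_mat complex_of_real (nlap_mat k x n)"

lemma integral_empirical:
  fixes g :: "'a::metric_space \<Rightarrow> 'b::{banach, second_countable_topology}"
  assumes "g \<in> borel_measurable borel"
  shows "(\<integral>y. g y \<partial>empirical x n) = (\<Sum>i<n. g (x i)) /\<^sub>R real n"
proof -
  have "x \<in> measurable (uniform_count_measure {..<n}) borel"
    by (auto simp: measurable_def space_uniform_count_measure sets_uniform_count_measure)
  then have "(\<integral>y. g y \<partial>empirical x n) = (\<integral>i. g (x i) \<partial>uniform_count_measure {..<n})"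
    unfolding empirical_def using assms by (rule integral_distr)
  also have "\<dots> = (\<Sum>i<n. (1 / real n) *\<^sub>R g (x i))"
    unfolding uniform_count_measure_def by (subst lebesgue_integral_point_measure_finite) simp_all
  finally show ?thesis by (simp add: scaleR_sum_right divide_inverse)
qed

lemma prob_space_empirical:
  assumes "n > 0"
  shows "prob_space (empirical x n)"
  unfolding empirical_def
  by (rule prob_space.prob_space_distr)
     (use assms in \<open>auto intro!: prob_space_uniform_count_measure simp: measurable_def space_uniform_count_measure sets_uniform_count_measure\<close>)

lemma continuous_on_slices:
  assumes F: "continuous_on UNIV (\<lambda>(x, y). F x y)"
  shows "continuous_on UNIV (F x)" and "continuous_on UNIV (\<lambda>x. F x y)"
proof -
  have "continuous_on UNIV (\<lambda>y. (x, y))" "continuous_on UNIV (\<lambda>x. (x, y))"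
    by (intro continuous_intros)+
  from this[THEN continuous_on_compose2[OF F]]
  show "continuous_on UNIV (F x)" and "continuous_on UNIV (\<lambda>x. F x y)" by auto
qed

lemma continuous_on_parametric_integral:
  fixes F :: "'a::metric_space \<Rightarrow> 'a \<Rightarrow> 'b::{banach, second_countable_topology}"
  assumes cpt: "compact (UNIV :: 'a set)" and Q: "finite_measure Q" "sets Q = sets borel"
    and F: "continuous_on UNIV (\<lambda>(x, y). F x y)"
  shows "continuous_on UNIV (\<lambda>x. \<integral>y. F x y \<partial>Q)"
proof -
  interpret finite_measure Q by fact
  have "compact ((\<lambda>(x, y). F x y) ` (UNIV \<times> UNIV))"
    using F cpt by (intro compact_continuous_image compact_Times) auto
  then obtain B where B: "\<And>x y. norm (F x y) \<le> B"
    by (force dest!: compact_imp_bounded simp: bounded_iff)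
  have c1: "continuous_on UNIV (F x)" for x
    by (rule continuous_on_slices(1)[OF F])
  have c2: "continuous_on UNIV (\<lambda>x. F x y)" for y
    by (rule continuous_on_slices(2)[OF F])
  have m: "F x \<in> borel_measurable Q" for x
    using borel_measurable_continuous_onI[OF c1] Q(2) by (simp cong: measurable_cong_sets)
  show ?thesis
    unfolding continuous_on_sequentially
  proof (intro allI ballI impI, unfold o_def, elim conjE)
    fix u and a :: 'a assume u: "u \<longlonglongrightarrow> a"
    show "(\<lambda>n. \<integral>y. F (u n) y \<partial>Q) \<longlonglongrightarrow> (\<integral>y. F a y \<partial>Q)"
    proof (rule integral_dominated_convergence[where w = "\<lambda>_. B"])
      show "AE y in Q. (\<lambda>n. F (u n) y) \<longlonglongrightarrow> F a y"
        using continuous_on_tendsto_compose[OF c2 u] by auto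
    qed (use m B in auto)
  qed
qed

lemma nker_bound_continuous:
  assumes cpt: "compact (UNIV :: 'a::metric_space set)"
    and Q: "prob_space Q" "sets Q = sets borel"
    and k: "continuous_on UNIV (\<lambda>(x :: 'a, y). k x y)" and l: "l > 0" "\<And>x y. k x y > l"
  shows "deg k Q x \<ge> l" "continuous_on UNIV (\<lambda>(x, y). nker k Q x y)"
proof -
  interpret prob_space Q by fact
  have "compact ((\<lambda>(x, y). k x y) ` (UNIV \<times> UNIV))"
    using k cpt by (intro compact_continuous_image compact_Times) auto
  then obtain B where B: "\<And>x y. norm (k x y) \<le> B"
    by (force dest!: compact_imp_bounded simp: bounded_iff)
  have c1: "continuous_on UNIV (k x)" for x
    by (rule continuous_on_slices(1)[OF k])
  have "k x \<in> borel_measurable Q" for x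
    using borel_measurable_continuous_onI[OF c1] Q(2) by (simp cong: measurable_cong_sets)
  then have "integrable Q (k x)" for x
    by (intro integrable_const_bound[where B = B]) (use B in auto)
  then show ge: "deg k Q x \<ge> l" for x
    using integral_mono[of Q "\<lambda>_. l" "k x"] l by (auto simp: deg_def prob_space less_imp_le)
  have "continuous_on UNIV (deg k Q)"
    using continuous_on_parametric_integral[OF cpt finite_measure_axioms Q(2) k]
    by (simp add: deg_def[abs_def])
  then have d: "continuous_on UNIV (\<lambda>z :: 'a \<times> 'a. deg k Q (fst z))"
      "continuous_on UNIV (\<lambda>z :: 'a \<times> 'a. deg k Q (snd z))"
    by (rule continuous_on_compose2; simp add: continuous_on_fst continuous_on_snd continuous_on_id)+
  have "deg k Q x > 0" for x
    using ge[of x] l(1) by simp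
  then have "sqrt (deg k Q (fst z) * deg k Q (snd z)) \<noteq> 0" for z
    by (simp add: less_imp_neq[symmetric])
  then show "continuous_on UNIV (\<lambda>(x, y). nker k Q x y)"
    using k d unfolding nker_def case_prod_beta
    by (intro continuous_on_divide continuous_on_real_sqrt continuous_on_mult) blast+
qed

lemma T_op_apply:
  assumes cpt: "compact (UNIV :: 'a::metric_space set)"
    and Q: "prob_space Q" "sets Q = sets borel"
    and k: "continuous_on UNIV (\<lambda>(x :: 'a, y). k x y)" and l: "l > 0" "\<And>x y. k x y > l"
  shows "apply_bcontfun (blinfun_apply (T_op k Q) g) x =
    (\<integral>y. complex_of_real (nker k Q x y) * apply_bcontfun g y \<partial>Q)"
proof -
  interpret prob_space Q by fact
  define I where "I g x = (\<integral>y. complex_of_real (nker k Q x y) * apply_bcontfun g y \<partial>Q)" for g x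
  note c = nker_bound_continuous(2)[OF cpt Q k l]
  have "compact ((\<lambda>(x, y). nker k Q x y) ` (UNIV \<times> UNIV))"
    using c cpt by (intro compact_continuous_image compact_Times) auto
  then obtain B where B: "\<And>x y. norm (nker k Q x y) \<le> B"
    by (force dest!: compact_imp_bounded simp: bounded_iff)
  have c': "continuous_on UNIV (nker k Q x)" for x
    by (rule continuous_on_slices(1)[OF c])
  have m: "(\<lambda>y. complex_of_real (nker k Q x y) * apply_bcontfun g y) \<in> borel_measurable Q" for x g
  proof -
    have "continuous_on UNIV (\<lambda>y. complex_of_real (nker k Q x y) * apply_bcontfun g y)"
      by (intro continuous_intros c') auto
    from borel_measurable_continuous_onI[OF this] Q(2) show ?thesis
      by (simp cong: measurable_cong_sets)
  qed
  have nb: "norm (complex_of_real (nker k Q x y) * apply_bcontfun g y) \<le> B * norm g" for x y g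
  proof -
    have "\<bar>nker k Q x y\<bar> * norm (apply_bcontfun g y) \<le> B * norm g"
      using B[of x y] norm_bounded[of g y] by (intro mult_mono) (auto intro: order_trans[OF abs_ge_zero])
    then show ?thesis by (simp add: norm_mult)
  qed
  have int: "integrable Q (\<lambda>y. complex_of_real (nker k Q x y) * apply_bcontfun g y)" for x g
    by (intro integrable_const_bound[where B = "B * norm g"]) (use nb m in auto)
  have Ib: "norm (I g x) \<le> B * norm g" for g x
  proof -
    have "norm (I g x) \<le> (\<integral>y. norm (complex_of_real (nker k Q x y) * apply_bcontfun g y) \<partial>Q)"
      unfolding I_def by (rule integral_norm_bound)
    also have "\<dots> \<le> (\<integral>y. B * norm g \<partial>Q)"
      by (intro integral_mono integrable_norm int) (use nb in auto)
    finally show ?thesis by (simp add: prob_space)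
  qed
  have "continuous_on UNIV (I g)" for g
  proof -
    have "continuous_on UNIV (\<lambda>z :: 'a \<times> 'a. apply_bcontfun g (snd z))"
      by (rule continuous_on_compose2[OF continuous_on_apply_bcontfun[of UNIV] continuous_on_snd[OF continuous_on_id]]) simp
    then have "continuous_on UNIV (\<lambda>(x, y). complex_of_real (nker k Q x y) * apply_bcontfun g y)"
      using c unfolding case_prod_beta by (intro continuous_on_mult continuous_on_of_real)
    from continuous_on_parametric_integral[OF cpt finite_measure_axioms Q(2) this]
    show ?thesis by (simp add: I_def[abs_def])
  qed
  then have bc: "I g \<in> bcontfun" for g
    by (rule bcontfun_normI) (rule Ib)
  have "bounded_linear (\<lambda>g. Bcontfun (I g))"
  proof (rule bounded_linear_intro[where K = B])
    show "Bcontfun (I (g + h)) = Bcontfun (I g) + Bcontfun (I h)" for g h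
      by (rule bcontfun_eqI)
         (simp add: Bcontfun_inverse[OF bc] plus_bcontfun.rep_eq, simp add: I_def plus_bcontfun.rep_eq distrib_left int)
    show "Bcontfun (I (r *\<^sub>R g)) = r *\<^sub>R Bcontfun (I g)" for r g
      by (rule bcontfun_eqI)
         (simp add: Bcontfun_inverse[OF bc] scaleR_bcontfun.rep_eq, simp add: I_def scaleR_bcontfun.rep_eq)
    show "norm (Bcontfun (I g)) \<le> norm g * B" for g
      by (rule norm_bound) (use Ib[of g] in \<open>simp add: Bcontfun_inverse[OF bc] mult.commute\<close>)
  qed
  then show ?thesis
    by (simp add: T_op_def bounded_linear_Blinfun_apply Bcontfun_inverse[OF bc] flip: I_def)
qed

end

theory Submission
  imports Defs
begin

text \<open>Almost surely the empirical measures converge weakly; this is the only probabilistic input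
  (Hoeffding and Borel--Cantelli for the cells of finite Borel partitions of small mesh), and everything
  else is deterministic. Weak convergence makes the operators \<open>T\<^sub>n\<close> converge pointwise to \<open>T\<close>, and as their
  kernels are equicontinuous uniformly in the measure, all of them map the unit ball into one compact set.
  Hence approximate eigenfunctions of \<open>U'\<^sub>n\<close> accumulate at eigenfunctions of \<open>U'\<close>, so that \<open>U'\<^sub>n - z\<close> is bounded
  below uniformly for \<open>z\<close> in a compact part of the resolvent set of \<open>U'\<close>. This confines
  \<open>\<sigma>(U'\<^sub>n) \<inter> M\<close> to small discs around \<open>\<lambda>\<close>, makes the resolvents converge on a circle
  around \<open>\<lambda>\<close>, and yields the eigenfunctions as limits. A spectral projection of \<open>U'\<^sub>n\<close> or \<open>U'\<close> is minus a sum of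
  residues of the resolvent, hence may be computed on that circle whichever curve defines it.\<close>

section \<open>Complex scalars, inverses and resolvents\<close>

text \<open>The operators \<open>T_n\<close> need not converge in operator norm: a function of norm
  one can vanish on the sample and still have a large image under the limit. Collective compactness
  stands in for norm convergence: pointwise convergence becomes uniform on compact sets, which is
  enough because the functions \<open>(U' - z)^-1 g\<close>, for \<open>z\<close> on a circle, form
  a compact set. A lower bound on \<open>U'_n - z\<close> gives only injectivity; surjectivity,
  hence the Fredholm alternative away from 1, is read off the matrix, since \<open>T_n g\<close>
  depends only on the values of \<open>g\<close> at the sample points. The value 1 is exceptional
  throughout: the arguments divide by \<open>1 - z\<close>, and every nonzero function vanishing on
  the sample is an eigenfunction of \<open>U'_n\<close> for 1. Complex analysis is carried out on
  the scalar functions \<open>z \<mapsto> ((A - z)^-1 g)(x)\<close>, with bounds uniform in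
  \<open>x\<close>, so that the sup norm is recovered at the end.\<close>

instance bcontfun :: (metric_space, banach) banach ..

lemma norm_cscale: "norm (cscale c f) = cmod c * norm f"
proof (rule antisym)
  have le: "norm (cscale c f) \<le> cmod c * norm f" for c and f :: "'a::topological_space \<Rightarrow>\<^sub>C complex"
    by (rule norm_bound) (simp add: norm_mult mult_left_mono norm_bounded)
  then show "norm (cscale c f) \<le> cmod c * norm f" .
  show "cmod c * norm f \<le> norm (cscale c f)"
  proof (cases "c = 0")
    case False
    then have "f = cscale (1 / c) (cscale c f)" by (intro bcontfun_eqI) simp
    then have "norm f \<le> cmod (1 / c) * norm (cscale c f)" using le by metis
    with False show ?thesis by (simp add: norm_divide field_simps)
  qed simp
qed

interpretation cscale: bounded_bilinear "cscale :: complex \<Rightarrow> ('a::topological_space \<Rightarrow>\<^sub>C complex) \<Rightarrow> _"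
  by unfold_locales
    (auto intro!: bcontfun_eqI exI[of _ 1] simp: norm_cscale plus_bcontfun.rep_eq scaleR_bcontfun.rep_eq algebra_simps)

lemma bounded_linear_cscale_op:
  "bounded_linear (cscale_op :: complex \<Rightarrow> 'a::topological_space cop)"
  by (rule bounded_linear_intro[where K = 1])
    (auto intro!: blinfun_eqI norm_blinfun_bound
      simp: norm_cscale blinfun.add_left blinfun.scaleR_left cscale.add_left cscale.scaleR_left)

lemma bounded_linear_eval:
  "bounded_linear (\<lambda>f :: 'a::topological_space \<Rightarrow>\<^sub>C 'b::real_normed_vector. apply_bcontfun f x)"
  by (rule bounded_linear_intro[where K = 1])
    (auto simp: plus_bcontfun.rep_eq scaleR_bcontfun.rep_eq norm_bounded)

text \<open>These functionals separate operators and commute with limits and integrals; through them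
  every operator-valued statement is reduced to a scalar one.\<close>

lemma bounded_linear_eval_op:
  "bounded_linear (\<lambda>B :: 'a::topological_space cop. apply_bcontfun (blinfun_apply B g) x)"
  by (rule bounded_linear_compose[OF bounded_linear_eval])
    (rule blinfun.bounded_linear_left)

text \<open>The operator type guarantees real linearity only, so complex linearity is carried as a
  predicate. It makes the resolvent commute with complex scalars, on which the resolvent identity
  rests.\<close>

definition clinear_op :: "'a::topological_space cop \<Rightarrow> bool" where
  "clinear_op A \<longleftrightarrow> (\<forall>c g. blinfun_apply A (cscale c g) = cscale c (blinfun_apply A g))"

text \<open>The lower bound gives injectivity and bounds the set-theoretic inverse by
  \<open>1 / c\<close>, so surjectivity is the only thing left to prove wherever a point is to be
  excluded from a spectrum.\<close>

lemma inverse_op_if_bounded_below: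
  fixes A :: "'a::topological_space cop"
  assumes "c > 0" and below: "\<And>f. c * norm f \<le> norm (blinfun_apply A f)"
    and surj: "surj (blinfun_apply A)"
  shows "\<exists>B. is_inverse_op A B"
proof -
  have inj: "inj (blinfun_apply A)"
  proof (rule injI)
    fix f g assume "blinfun_apply A f = blinfun_apply A g"
    then have "c * norm (f - g) \<le> 0" using below[of "f - g"] by (simp add: blinfun.diff_right)
    with \<open>c > 0\<close> show "f = g" by (simp add: mult_le_0_iff)
  qed
  define B where "B = inv_into UNIV (blinfun_apply A)"
  have AB: "blinfun_apply A (B g) = g" for g
    using surj by (simp add: B_def surj_f_inv_f)
  have BA: "B (blinfun_apply A g) = g" for g
    using inj by (simp add: B_def)
  have "bounded_linear B"
  proof (rule bounded_linear_intro[where K = "1 / c"])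
    show "B (f + g) = B f + B g" for f g
      using BA[of "B f + B g"] by (simp add: blinfun.add_right AB)
    show "B (r *\<^sub>R f) = r *\<^sub>R B f" for r f
      using BA[of "r *\<^sub>R B f"] by (simp add: blinfun.scaleR_right AB)
    show "norm (B f) \<le> norm f * (1 / c)" for f
      using below[of "B f"] \<open>c > 0\<close> by (simp add: AB field_simps)
  qed
  then have "is_inverse_op A (Blinfun B)"
    unfolding is_inverse_op_def
    by (auto intro!: blinfun_eqI simp: bounded_linear_Blinfun_apply AB BA)
  then show ?thesis ..
qed

lemma is_inverse_op_resolvent:
  assumes "z \<notin> op_spectrum A"
  shows "is_inverse_op (A - cscale_op z) (resolvent A z)"
proof -
  obtain B where B: "is_inverse_op (A - cscale_op z) B"
    using assms by (auto simp: op_spectrum_def)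
  have "C = B" if "is_inverse_op (A - cscale_op z) C" for C
    using that B unfolding is_inverse_op_def
    by (metis blinfun_apply_blinfun_compose blinfun_apply_id_blinfun blinfun_eqI id_apply)
  with B show ?thesis unfolding resolvent_def by (rule theI)
qed

lemma resolvent_inverse:
  assumes "z \<notin> op_spectrum A"
  shows "blinfun_apply (A - cscale_op z) (blinfun_apply (resolvent A z) g) = g"
    and "blinfun_apply (resolvent A z) (blinfun_apply (A - cscale_op z) g) = g"
  using is_inverse_op_resolvent[OF assms] unfolding is_inverse_op_def
  by (metis blinfun_apply_blinfun_compose blinfun_apply_id_blinfun id_apply)+

lemma norm_resolvent_apply_le:
  assumes "z \<notin> op_spectrum A" "c > 0"
    and "\<And>f. c * norm f \<le> norm (blinfun_apply (A - cscale_op z) f)"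
  shows "norm (blinfun_apply (resolvent A z) g) \<le> norm g / c"
  using assms(3)[of "blinfun_apply (resolvent A z) g"] assms(2)
  by (simp only: resolvent_inverse[OF assms(1)]) (simp add: field_simps)

text \<open>Since \<open>A - w\<close> differs from \<open>A - z\<close> by the scalar
  \<open>w - z\<close>, solving \<open>(A - w) f = g\<close> means finding a fixed point of
  \<open>f \<mapsto> (A - z)^-1 (g + (w - z) f)\<close>, a contraction with factor
  \<open>1 / 2\<close>. The summand \<open>+ 1\<close> makes the bound \<open>N\<close> positive at
  once.\<close>

lemma resolvent_near:
  fixes A :: "'a::metric_space cop"
  assumes z: "z \<notin> op_spectrum A" and near: "cmod (w - z) * (norm (resolvent A z) + 1) \<le> 1 / 2"
  shows "w \<notin> op_spectrum A" and "norm (resolvent A w) \<le> 2 * (norm (resolvent A z) + 1)"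
proof -
  define N where "N = norm (resolvent A z) + 1"
  let ?R = "blinfun_apply (resolvent A z)"
  have "N > 0" unfolding N_def by (simp add: add_nonneg_pos)
  have RN: "norm (?R g) \<le> N * norm g" for g
    using norm_blinfun[of "resolvent A z" g] by (simp add: N_def distrib_right add_increasing2)
  have below: "1 / (2 * N) * norm f \<le> norm (blinfun_apply (A - cscale_op w) f)" for f
  proof -
    have eq: "blinfun_apply (A - cscale_op z) f = blinfun_apply (A - cscale_op w) f + cscale (w - z) f"
      by (simp add: blinfun.diff_left cscale.diff_left)
    have "norm f \<le> N * norm (blinfun_apply (A - cscale_op z) f)"
      using RN[of "blinfun_apply (A - cscale_op z) f"] by (simp only: resolvent_inverse[OF z])
    also have "\<dots> \<le> N * (norm (blinfun_apply (A - cscale_op w) f) + cmod (w - z) * norm f)"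
      unfolding eq using \<open>N > 0\<close> norm_triangle_ineq[of _ "cscale (w - z) f"]
      by (intro mult_left_mono) (auto simp: norm_cscale)
    also have "\<dots> = N * norm (blinfun_apply (A - cscale_op w) f) + cmod (w - z) * N * norm f"
      by (simp add: algebra_simps)
    \<comment> \<open>Half of \<open>norm f\<close> is absorbed into the left-hand side; this is the
      origin of the factor 2 in the lower bound and in the bound on the new resolvent.\<close>
    also have "\<dots> \<le> N * norm (blinfun_apply (A - cscale_op w) f) + 1 / 2 * norm f"
      using near by (intro add_left_mono mult_right_mono) (auto simp: N_def)
    finally show ?thesis using \<open>N > 0\<close> by (simp add: field_simps)
  qed
  have "\<exists>f. g = blinfun_apply (A - cscale_op w) f" for g
  proof -
    define F where "F f = ?R (g + cscale (w - z) f)" for f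
    have "\<exists>!f. F f = f"
    proof (rule banach_fix_type[of "1 / 2"], simp, simp, intro allI)
      fix f h
      have "F f - F h = ?R (cscale (w - z) (f - h))"
        by (simp add: F_def blinfun.add_right blinfun.diff_right cscale.diff_right)
      then have "norm (F f - F h) \<le> N * (cmod (w - z) * norm (f - h))"
        using RN[of "cscale (w - z) (f - h)"] by (simp add: norm_cscale)
      also have "\<dots> = cmod (w - z) * N * norm (f - h)" by simp
      also have "\<dots> \<le> 1 / 2 * norm (f - h)"
        using near by (intro mult_right_mono) (auto simp: N_def)
      finally show "dist (F f) (F h) \<le> 1 / 2 * dist f h" by (simp add: dist_norm)
    qed
    then obtain f where "F f = f" by blast
    with resolvent_inverse(1)[OF z, of "g + cscale (w - z) f"]
    have "blinfun_apply (A - cscale_op z) f = g + cscale (w - z) f" by (simp add: F_def)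
    then have "g = blinfun_apply (A - cscale_op w) f"
      by (simp add: blinfun.diff_left cscale.diff_left algebra_simps)
    then show ?thesis ..
  qed
  then have "surj (blinfun_apply (A - cscale_op w))" unfolding surj_def by blast
  from inverse_op_if_bounded_below[OF _ below this] \<open>N > 0\<close>
  show w: "w \<notin> op_spectrum A" by (auto simp: op_spectrum_def)
  show "norm (resolvent A w) \<le> 2 * (norm (resolvent A z) + 1)"
    using norm_resolvent_apply_le[OF w _ below] \<open>N > 0\<close>
    by (intro norm_blinfun_bound) (auto simp: N_def field_simps)
qed

section \<open>Topology of the resolvent set and regularity of the resolvent\<close>

lemma open_resolvent_set: "open (- op_spectrum (A :: 'a::metric_space cop))"
  unfolding open_dist
proof
  fix z assume "z \<in> - op_spectrum A"
  then have z: "z \<notin> op_spectrum A" by simp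
  define e where "e = 1 / (2 * (norm (resolvent A z) + 1))"
  have p: "norm (resolvent A z) + 1 > 0" by (simp add: add_nonneg_pos)
  have "w \<in> - op_spectrum A" if "dist w z < e" for w
    using that resolvent_near(1)[OF z, of w] p by (auto simp: e_def dist_norm field_simps)
  moreover have "e > 0" using p by (simp add: e_def)
  ultimately show "\<exists>e>0. \<forall>y. dist y z < e \<longrightarrow> y \<in> - op_spectrum A" by blast
qed

lemma resolvent_cscale:
  assumes "clinear_op A" "z \<notin> op_spectrum A"
  shows "blinfun_apply (resolvent A z) (cscale c g) = cscale c (blinfun_apply (resolvent A z) g)"
proof -
  let ?h = "blinfun_apply (resolvent A z) g"
  have "blinfun_apply (A - cscale_op z) (cscale c ?h) = cscale c (blinfun_apply (A - cscale_op z) ?h)"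
    using assms(1) by (simp add: clinear_op_def blinfun.diff_left cscale.diff_right mult.commute)
  then show ?thesis
    using resolvent_inverse[OF assms(2)] by metis
qed

text \<open>Apply the resolvent at \<open>w\<close> to
  \<open>(A - z) h - (A - w) h = (w - z) h\<close> with \<open>h\<close> the resolvent at
  \<open>z\<close> applied to \<open>g\<close>. Continuity and holomorphy in the spectral parameter
  both come from this identity.\<close>

lemma resolvent_identity:
  assumes A: "clinear_op A" and z: "z \<notin> op_spectrum A" and w: "w \<notin> op_spectrum A"
  shows "blinfun_apply (resolvent A w) g - blinfun_apply (resolvent A z) g =
    cscale (w - z) (blinfun_apply (resolvent A w) (blinfun_apply (resolvent A z) g))"
proof -
  let ?h = "blinfun_apply (resolvent A z) g"
  have "cscale (w - z) ?h = blinfun_apply (A - cscale_op z) ?h - blinfun_apply (A - cscale_op w) ?h"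
    by (simp add: blinfun.diff_left cscale.diff_left)
  also have "\<dots> = g - blinfun_apply (A - cscale_op w) ?h"
    by (simp only: resolvent_inverse[OF z])
  finally have "blinfun_apply (resolvent A w) (cscale (w - z) ?h) = blinfun_apply (resolvent A w) g - ?h"
    by (simp only: resolvent_inverse[OF w] blinfun.diff_right)
  then show ?thesis by (simp add: resolvent_cscale[OF A w])
qed

text \<open>Continuity is in operator norm: the identity supplies the factor \<open>w - z\<close>,
  and \<open>resolvent_near\<close> bounds the remaining product of resolvents by
  \<open>2 * N * N\<close> near \<open>z\<close>.\<close>

lemma isCont_resolvent:
  fixes A :: "'a::metric_space cop"
  assumes A: "clinear_op A" and z: "z \<notin> op_spectrum A"
  shows "isCont (resolvent A) z"
proof -
  define N where "N = norm (resolvent A z) + 1"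
  have "N > 0" unfolding N_def by (simp add: add_nonneg_pos)
  have "((\<lambda>w. resolvent A w - resolvent A z) \<longlongrightarrow> 0) (at z)"
  proof (rule Lim_null_comparison)
    have "\<forall>\<^sub>F w in at z. dist w z < 1 / (2 * N)"
      unfolding eventually_at using \<open>N > 0\<close> by (intro exI[of _ "1 / (2 * N)"]) auto
    then show "\<forall>\<^sub>F w in at z. norm (resolvent A w - resolvent A z) \<le> cmod (w - z) * (2 * N * N)"
    proof eventually_elim
      case (elim w)
      then have near: "cmod (w - z) * (norm (resolvent A z) + 1) \<le> 1 / 2"
        using \<open>N > 0\<close> unfolding N_def[symmetric] by (simp add: dist_norm field_simps)
      note n = resolvent_near[OF z near]
      show ?case
      proof (rule norm_blinfun_bound)
        fix g
        have "norm (blinfun_apply (resolvent A w) (blinfun_apply (resolvent A z) g))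
          \<le> norm (resolvent A w) * (norm (resolvent A z) * norm g)"
          by (meson norm_blinfun mult_left_mono norm_ge_zero order_trans)
        also have "\<dots> \<le> (2 * N) * (N * norm g)"
          using n(2) \<open>N > 0\<close> by (intro mult_mono) (auto simp: N_def)
        finally show "norm (blinfun_apply (resolvent A w - resolvent A z) g) \<le> cmod (w - z) * (2 * N * N) * norm g"
          unfolding blinfun.diff_left resolvent_identity[OF A z n(1)] norm_cscale mult.assoc
          by (rule mult_left_mono) simp
      qed (use \<open>N > 0\<close> in auto)
    qed
    have "((\<lambda>w. cmod (w - z) * (2 * N * N)) \<longlongrightarrow> cmod (z - z) * (2 * N * N)) (at z)"
      by (intro tendsto_intros)
    then show "((\<lambda>w. cmod (w - z) * (2 * N * N)) \<longlongrightarrow> 0) (at z)" by simp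
  qed
  then show ?thesis unfolding isCont_def by (rule LIM_zero_cancel)
qed

lemma continuous_on_resolvent:
  fixes A :: "'a::metric_space cop"
  assumes "clinear_op A" "S \<inter> op_spectrum A = {}"
  shows "continuous_on S (resolvent A)"
proof (rule continuous_at_imp_continuous_on, rule ballI)
  fix z assume "z \<in> S"
  with assms show "isCont (resolvent A) z" by (intro isCont_resolvent) auto
qed

text \<open>By the resolvent identity the difference quotient at \<open>z\<close> is the resolvent
  at \<open>w\<close> applied to the fixed function \<open>?h\<close>, so norm continuity alone
  gives the derivative.\<close>

lemma holomorphic_resolvent:
  fixes A :: "'a::metric_space cop"
  assumes A: "clinear_op A" and S: "S \<inter> op_spectrum A = {}"
  shows "(\<lambda>z. apply_bcontfun (blinfun_apply (resolvent A z) g) x) holomorphic_on S"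
  unfolding holomorphic_on_def field_differentiable_def
proof
  fix z assume "z \<in> S"
  then have z: "z \<notin> op_spectrum A" using S by auto
  let ?f = "\<lambda>z. apply_bcontfun (blinfun_apply (resolvent A z) g) x"
  let ?h = "blinfun_apply (resolvent A z) g"
  have "((\<lambda>w. apply_bcontfun (blinfun_apply (resolvent A w) ?h) x) \<longlongrightarrow> apply_bcontfun (blinfun_apply (resolvent A z) ?h) x) (at z)"
    using isCont_resolvent[OF A z] unfolding isCont_def
    by (rule bounded_linear.tendsto[OF bounded_linear_eval_op])
  moreover have "\<forall>\<^sub>F w in at z. apply_bcontfun (blinfun_apply (resolvent A w) ?h) x = (?f w - ?f z) / (w - z)"
  proof -
    have "\<forall>\<^sub>F w in at z. w \<in> - op_spectrum A"
      using open_resolvent_set z by (intro eventually_at_in_open') auto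
    moreover have "\<forall>\<^sub>F w in at z. w \<noteq> z" by (simp add: eventually_at_filter)
    ultimately show ?thesis
    proof eventually_elim
      case (elim w)
      then have "?f w - ?f z = (w - z) * apply_bcontfun (blinfun_apply (resolvent A w) ?h) x"
        using resolvent_identity[OF A z, of w g] by (metis ComplD apply_cscale minus_bcontfun.rep_eq)
      with elim show ?case by simp
    qed
  qed
  ultimately have "((\<lambda>w. (?f w - ?f z) / (w - z)) \<longlongrightarrow> apply_bcontfun (blinfun_apply (resolvent A z) ?h) x) (at z)"
    by (rule Lim_transform_eventually)
  then have "(?f has_field_derivative apply_bcontfun (blinfun_apply (resolvent A z) ?h) x) (at z)"
    by (simp add: has_field_derivative_iff)
  then show "\<exists>d. (?f has_field_derivative d) (at z within S)"
    using has_field_derivative_at_within by blast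
qed

section \<open>Spectral projections as residues\<close>

text \<open>\<open>F\<close> integrates along the segment from the centre. For fixed
  \<open>g\<close> and \<open>x\<close> it agrees, up to a constant, with a scalar primitive
  supplied by Cauchy's theorem on the disc; the work lies in making the derivative uniform in
  \<open>g\<close> and \<open>x\<close>.\<close>

lemma operator_primitive:
  fixes \<Phi> :: "complex \<Rightarrow> 'a::metric_space cop"
  assumes cont: "continuous_on (ball a r) \<Phi>"
    and hol: "\<And>g x. (\<lambda>z. apply_bcontfun (blinfun_apply (\<Phi> z) g) x) holomorphic_on ball a r"
  obtains F where "\<And>z. z \<in> ball a r \<Longrightarrow> (F has_derivative (\<lambda>h. cscale_op h o\<^sub>L \<Phi> z)) (at z)"
proof
  define F where "F z = integral {0..1} (\<lambda>t. cscale_op (z - a) o\<^sub>L \<Phi> (linepath a z t))" for z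
  fix z assume z: "z \<in> ball a r"
  \<comment> \<open>The radius \<open>d\<close> does not depend on \<open>g\<close> or
    \<open>x\<close>, and \<open>g\<close> enters only through its norm. This turns the scalar
    derivatives into a derivative in operator norm.\<close>
  have F_diff: "cmod (apply_bcontfun (blinfun_apply (F y) g) x - apply_bcontfun (blinfun_apply (F z) g) x
      - (y - z) * apply_bcontfun (blinfun_apply (\<Phi> z) g) x) \<le> e * norm g * cmod (y - z)"
    if d: "ball z d \<subseteq> ball a r" "\<And>w. w \<in> ball z d \<Longrightarrow> norm (\<Phi> w - \<Phi> z) \<le> e" and y: "y \<in> ball z d"
    for g x y d e
  proof -
    let ?\<phi> = "\<lambda>z. apply_bcontfun (blinfun_apply (\<Phi> z) g) x"
    obtain p where p: "\<And>w. w \<in> ball a r \<Longrightarrow> (p has_field_derivative ?\<phi> w) (at w within ball a r)"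
      using holomorphic_convex_primitive'[OF convex_ball open_ball hol] by blast
    have eval: "apply_bcontfun (blinfun_apply (F w) g) x = p w - p a" if w: "w \<in> ball a r" for w
    proof -
      have a: "a \<in> ball a r" using w by (auto simp: dist_norm intro: le_less_trans[OF norm_ge_zero])
      have seg: "path_image (linepath a w) \<subseteq> ball a r"
        using a w by (simp add: closed_segment_subset)
      have "continuous_on {0..1} (\<lambda>t. cscale_op (w - a) o\<^sub>L \<Phi> (linepath a w t))"
      proof (intro bounded_bilinear.continuous_on[OF bounded_bilinear_blinfun_compose] continuous_on_const)
        show "continuous_on {0..1} (\<lambda>t. \<Phi> (linepath a w t))"
          using seg by (intro continuous_on_compose2[OF cont]) (auto simp: path_image_def intro: continuous_on_linepath)
      qed
      then have int: "(\<lambda>t. cscale_op (w - a) o\<^sub>L \<Phi> (linepath a w t)) integrable_on {0..1}"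
        by (rule integrable_continuous_real)
      have "((\<lambda>t. ?\<phi> (linepath a w t) * (w - a)) has_integral (p w - p a)) {0..1}"
        using contour_integral_primitive[OF p, of "linepath a w"] seg
        by (simp add: has_contour_integral_linepath)
      then have "p w - p a = integral {0..1} (\<lambda>t. ?\<phi> (linepath a w t) * (w - a))"
        by (rule integral_unique[symmetric])
      also have "\<dots> = apply_bcontfun (blinfun_apply (F w) g) x"
        using integral_linear[OF int bounded_linear_eval_op[of g x]]
        by (simp add: F_def o_def mult.commute)
      finally show ?thesis by simp
    qed
    \<comment> \<open>Mean value inequality for the primitive minus its linear part at
      \<open>z\<close>; the derivative of that difference is \<open>?\<phi> w - ?\<phi> z\<close>,
      which norm continuity of \<open>\<Phi>\<close> makes small.\<close>
    have "cmod ((p y - y * ?\<phi> z) - (p z - z * ?\<phi> z)) \<le> e * norm g * cmod (y - z)"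
    proof (rule field_differentiable_bound[OF convex_ball])
      fix w assume w: "w \<in> ball z d"
      then have "(p has_field_derivative ?\<phi> w) (at w)"
        using p[of w] d(1) at_within_open[OF _ open_ball, of w a r] by auto
      then have "((\<lambda>y. p y - y * ?\<phi> z) has_field_derivative ?\<phi> w - 1 * ?\<phi> z) (at w)"
        by (intro DERIV_diff DERIV_cmult_right DERIV_ident)
      then show "((\<lambda>y. p y - y * ?\<phi> z) has_field_derivative ?\<phi> w - ?\<phi> z) (at w within ball z d)"
        by (simp add: has_field_derivative_at_within)
      have "cmod (?\<phi> w - ?\<phi> z) \<le> norm (blinfun_apply (\<Phi> w - \<Phi> z) g)"
        using norm_bounded[of "blinfun_apply (\<Phi> w - \<Phi> z) g" x]
        by (simp add: blinfun.diff_left minus_bcontfun.rep_eq)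
      also have "\<dots> \<le> norm (\<Phi> w - \<Phi> z) * norm g" by (rule norm_blinfun)
      also have "\<dots> \<le> e * norm g" using d(2)[OF w] by (rule mult_right_mono) simp
      finally show "cmod (?\<phi> w - ?\<phi> z) \<le> e * norm g" .
    qed (use y in \<open>auto intro: le_less_trans[OF zero_le_dist]\<close>)
    moreover have "y \<in> ball a r" using y d(1) by auto
    ultimately show ?thesis using z by (simp add: eval algebra_simps)
  qed
  show "(F has_derivative (\<lambda>h. cscale_op h o\<^sub>L \<Phi> z)) (at z)"
    unfolding has_derivative_at_alt
  proof (intro conjI allI impI)
    show "bounded_linear (\<lambda>h. cscale_op h o\<^sub>L \<Phi> z)"
      by (intro bounded_linear_compose[OF _ bounded_linear_cscale_op]
          bounded_bilinear.bounded_linear_left[OF bounded_bilinear_blinfun_compose])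
    fix e :: real assume "e > 0"
    moreover have "isCont \<Phi> z" using cont z by (simp add: continuous_on_eq_continuous_at)
    ultimately obtain d1 where d1: "d1 > 0" "\<And>w. dist w z < d1 \<Longrightarrow> dist (\<Phi> w) (\<Phi> z) < e"
      unfolding continuous_at_eps_delta by blast
    obtain d2 where d2: "d2 > 0" "ball z d2 \<subseteq> ball a r" using z open_contains_ball by blast
    show "\<exists>d>0. \<forall>y. norm (y - z) < d \<longrightarrow> norm (F y - F z - (cscale_op (y - z) o\<^sub>L \<Phi> z)) \<le> e * norm (y - z)"
    proof (intro exI conjI allI impI)
      show "min d1 d2 > 0" using d1 d2 by simp
      fix y assume y: "norm (y - z) < min d1 d2"
      show "norm (F y - F z - (cscale_op (y - z) o\<^sub>L \<Phi> z)) \<le> e * norm (y - z)"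
      proof (rule norm_blinfun_bound)
        fix g
        show "norm (blinfun_apply (F y - F z - (cscale_op (y - z) o\<^sub>L \<Phi> z)) g) \<le> e * norm (y - z) * norm g"
        proof (rule norm_bound)
          fix x
          show "norm (apply_bcontfun (blinfun_apply (F y - F z - (cscale_op (y - z) o\<^sub>L \<Phi> z)) g) x) \<le> e * norm (y - z) * norm g"
            using F_diff[of "min d1 d2" e y g x] d1(2) d2(2) y
            by (auto simp: blinfun.diff_left minus_bcontfun.rep_eq dist_norm norm_minus_commute mult_ac less_imp_le subset_eq)
        qed
      qed (use \<open>e > 0\<close> in auto)
    qed
  qed
qed

text \<open>A valid path need not be rectifiable, so boundedness of the integrand is not available; as for
  complex-valued integrands, integrability comes from local primitives.\<close>

lemma operator_path_integrable:
  fixes \<Phi> :: "complex \<Rightarrow> 'a::metric_space cop"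
  assumes "open S" and cont: "continuous_on S \<Phi>"
    and hol: "\<And>g x. (\<lambda>z. apply_bcontfun (blinfun_apply (\<Phi> z) g) x) holomorphic_on S"
    and \<Gamma>: "valid_path \<Gamma>" "path_image \<Gamma> \<subseteq> S"
  shows "(\<lambda>t. cscale_op (vector_derivative \<Gamma> (at t)) o\<^sub>L \<Phi> (\<Gamma> t)) integrable_on {0..1}"
proof -
  obtain K where K: "finite K" "\<And>t. t \<in> {0..1} - K \<Longrightarrow> \<Gamma> differentiable (at t)"
    using \<Gamma>(1) unfolding valid_path_def piecewise_C1_differentiable_on_def C1_differentiable_on_eq by blast
  have c\<Gamma>: "continuous_on {0..1} \<Gamma>"
    using \<Gamma>(1) unfolding valid_path_def piecewise_C1_differentiable_on_def by blast
  have "(\<lambda>t. cscale_op (vector_derivative \<Gamma> (at t)) o\<^sub>L \<Phi> (\<Gamma> t)) integrable_on cbox 0 1"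
  \<comment> \<open>Short subintervals are mapped by \<open>\<Gamma>\<close> into a disc inside
    \<open>S\<close>, where a primitive exists.\<close>
  proof (rule integrable_on_little_subintervals, rule ballI)
    fix t :: real assume t: "t \<in> cbox 0 1"
    then have "\<Gamma> t \<in> S" using \<Gamma>(2) by (auto simp: path_image_def)
    then obtain r where r: "r > 0" "ball (\<Gamma> t) r \<subseteq> S"
      using \<open>open S\<close> open_contains_ball by blast
    obtain F where F: "\<And>z. z \<in> ball (\<Gamma> t) r \<Longrightarrow> (F has_derivative (\<lambda>h. cscale_op h o\<^sub>L \<Phi> z)) (at z)"
      using operator_primitive[OF continuous_on_subset[OF cont r(2)] holomorphic_on_subset[OF hol r(2)]] by blast
    obtain d where d: "d > 0" "\<And>s. s \<in> {0..1} \<Longrightarrow> dist s t < d \<Longrightarrow> dist (\<Gamma> s) (\<Gamma> t) < r"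
      using c\<Gamma> t r(1) unfolding continuous_on_iff by (metis cbox_interval)
    show "\<exists>d>0. \<forall>u v. t \<in> cbox u v \<and> cbox u v \<subseteq> ball t d \<and> cbox u v \<subseteq> cbox 0 1 \<longrightarrow>
      (\<lambda>t. cscale_op (vector_derivative \<Gamma> (at t)) o\<^sub>L \<Phi> (\<Gamma> t)) integrable_on cbox u v"
    proof (intro exI[of _ d] conjI allI impI d(1); elim conjE)
      fix u v assume uv: "t \<in> cbox u v" "cbox u v \<subseteq> ball t d" "cbox u v \<subseteq> cbox 0 1"
      have in_ball: "\<Gamma> s \<in> ball (\<Gamma> t) r" if "s \<in> {u..v}" for s
        using d(2)[of s] uv(2,3) that by (auto simp: dist_commute subset_eq)
      have "((\<lambda>t. cscale_op (vector_derivative \<Gamma> (at t)) o\<^sub>L \<Phi> (\<Gamma> t)) has_integral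
          ((F \<circ> \<Gamma>) v - (F \<circ> \<Gamma>) u)) {u..v}"
      \<comment> \<open>\<open>F \<circ> \<Gamma>\<close> is an antiderivative off the finite set
        \<open>K\<close> of corners; at the corners continuity is enough.\<close>
      proof (rule fundamental_theorem_of_calculus_strong[OF K(1)])
        show "u \<le> v" using uv(1) by simp
        fix s assume s: "s \<in> {u..v} - K"
        then have "(\<Gamma> has_vector_derivative vector_derivative \<Gamma> (at s)) (at s)"
          using K(2)[of s] uv(3) by (auto simp: vector_derivative_works)
        from diff_chain_at[OF this[unfolded has_vector_derivative_def] F[OF in_ball]] s
        show "((F \<circ> \<Gamma>) has_vector_derivative cscale_op (vector_derivative \<Gamma> (at s)) o\<^sub>L \<Phi> (\<Gamma> s)) (at s)"
          unfolding has_vector_derivative_def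
          by (simp add: o_def linear_cmul[OF bounded_linear.linear[OF bounded_linear_cscale_op]]
              bounded_bilinear.scaleR_left[OF bounded_bilinear_blinfun_compose])
      next
        have "continuous_on (ball (\<Gamma> t) r) F"
          by (rule continuous_at_imp_continuous_on) (rule ballI, rule has_derivative_continuous, rule F)
        moreover have "continuous_on {u..v} \<Gamma>"
          using uv(3) by (intro continuous_on_subset[OF c\<Gamma>]) simp
        moreover have "\<Gamma> ` {u..v} \<subseteq> ball (\<Gamma> t) r" using in_ball by blast
        ultimately show "continuous_on {u..v} (F \<circ> \<Gamma>)"
          unfolding o_def by (rule continuous_on_compose2)
      qed
      then show "(\<lambda>t. cscale_op (vector_derivative \<Gamma> (at t)) o\<^sub>L \<Phi> (\<Gamma> t)) integrable_on cbox u v"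
        by auto
    qed
  qed
  then show ?thesis by simp
qed

section \<open>Independence of the curve, and projections computed on circles\<close>

lemma separating_curve_avoids_spectrum:
  assumes "separating_curve A \<tau> \<Gamma>"
  shows "path_image \<Gamma> \<inter> op_spectrum A = {}"
  using assms inside_no_overlap[of "path_image \<Gamma>"] outside_no_overlap[of "path_image \<Gamma>"]
  unfolding separating_curve_def by blast

text \<open>As soon as one separating curve exists, the one chosen in the definition is separating
  too, and evaluation may be pulled through the operator integral. Nothing else is known about the
  chosen curve, so what follows has to hold for every separating curve.\<close>

lemma spectral_projection_eq_contour_integral:
  fixes A :: "'a::metric_space cop"
  assumes A: "clinear_op A" and ex: "separating_curve A \<tau> \<Gamma>'"
  obtains \<Gamma> where "separating_curve A \<tau> \<Gamma>"
    "\<And>g x. apply_bcontfun (blinfun_apply (spectral_projection A \<tau>) g) x =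
      1 / (2 * of_real pi * \<i>) * contour_integral \<Gamma> (\<lambda>z. apply_bcontfun (blinfun_apply (resolvent A z) g) x)"
proof
  define \<Gamma> where "\<Gamma> = (SOME \<Gamma>. separating_curve A \<tau> \<Gamma>)"
  show sep: "separating_curve A \<tau> \<Gamma>" unfolding \<Gamma>_def by (rule someI[of "separating_curve A \<tau>", OF ex])
  fix g x
  have "(\<lambda>t. cscale_op (vector_derivative \<Gamma> (at t)) o\<^sub>L resolvent A (\<Gamma> t)) integrable_on {0..1}"
    using separating_curve_avoids_spectrum[OF sep] sep unfolding separating_curve_def
    by (intro operator_path_integrable[where S = "- op_spectrum A"] open_resolvent_set
        continuous_on_resolvent holomorphic_resolvent A) auto
  from integral_linear[OF this bounded_linear_eval_op[of g x]]
  show "apply_bcontfun (blinfun_apply (spectral_projection A \<tau>) g) x =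
      1 / (2 * of_real pi * \<i>) * contour_integral \<Gamma> (\<lambda>z. apply_bcontfun (blinfun_apply (resolvent A z) g) x)"
    by (simp add: spectral_projection_def Let_def contour_integral_integral o_def mult.commute flip: \<Gamma>_def)
qed

text \<open>Residue theorem with winding number -1 at every point of \<open>\<tau>\<close>, which
  explains the sign. Inside the curve the only singularities are in \<open>\<tau>\<close>; points
  off the domain \<open>S\<close> lie outside the curve, where the winding number vanishes.\<close>

lemma contour_integral_separating_curve:
  fixes A :: "'a::metric_space cop"
  assumes A: "clinear_op A" and sep: "separating_curve A \<tau> \<Gamma>" and fin: "finite \<tau>"
  shows "contour_integral \<Gamma> (\<lambda>z. apply_bcontfun (blinfun_apply (resolvent A z) g) x) =
    - (2 * of_real pi * \<i>) * (\<Sum>p\<in>\<tau>. residue (\<lambda>z. apply_bcontfun (blinfun_apply (resolvent A z) g) x) p)"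
proof -
  let ?I = "inside (path_image \<Gamma>)" and ?O = "outside (path_image \<Gamma>)"
  have \<Gamma>: "valid_path \<Gamma>" "simple_path \<Gamma>" "pathfinish \<Gamma> = pathstart \<Gamma>" "\<tau> \<subseteq> ?I"
      "op_spectrum A - \<tau> \<subseteq> ?O" "\<And>z. z \<in> ?I \<Longrightarrow> winding_number \<Gamma> z = -1"
    using sep by (auto simp: separating_curve_def)
  have IO: "?I \<union> ?O = - path_image \<Gamma>" "?I \<inter> ?O = {}"
    by (simp_all add: inside_Un_outside inside_Int_outside)
  have J: "open ?I" "connected ?I" "frontier ?I = path_image \<Gamma>"
    using Jordan_inside_outside[OF \<Gamma>(2,3)] by auto
  \<comment> \<open>The complement of \<open>op_spectrum A - \<tau>\<close> may be disconnected; the residue theorem is applied on the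
    component that contains the curve.\<close>
  define W where "W = - op_spectrum A \<union> ?I"
  define S where "S = connected_component_set W (pathstart \<Gamma>)"
  have "open W" unfolding W_def using open_resolvent_set J(1) by blast
  have clos: "closure ?I = ?I \<union> path_image \<Gamma>"
    using J(3) closure_Un_frontier by metis
  have "closure ?I \<subseteq> S" unfolding S_def
  proof (rule connected_component_maximal)
    show "pathstart \<Gamma> \<in> closure ?I" unfolding clos using pathstart_in_path_image by blast
    show "connected (closure ?I)" using J(2) by (rule connected_imp_connected_closure)
    show "closure ?I \<subseteq> W"
      using separating_curve_avoids_spectrum[OF sep] by (auto simp: clos W_def)
  qed
  have "S \<subseteq> W" unfolding S_def by (rule connected_component_subset)
  have hol_dom: "(S - \<tau>) \<inter> op_spectrum A = {}"
    using \<open>S \<subseteq> W\<close> \<Gamma>(5) IO(2) unfolding W_def by blast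
  have "contour_integral \<Gamma> (\<lambda>z. apply_bcontfun (blinfun_apply (resolvent A z) g) x) =
    2 * pi * \<i> * (\<Sum>p\<in>\<tau>. winding_number \<Gamma> p * residue (\<lambda>z. apply_bcontfun (blinfun_apply (resolvent A z) g) x) p)"
  proof (rule Residue_theorem[where S = S])
    show "open S" unfolding S_def using \<open>open W\<close> by (rule open_connected_component)
    show "connected S" unfolding S_def by simp
    show "(\<lambda>z. apply_bcontfun (blinfun_apply (resolvent A z) g) x) holomorphic_on S - \<tau>"
      by (rule holomorphic_resolvent[OF A hol_dom])
    show "path_image \<Gamma> \<subseteq> S - \<tau>"
      using \<open>closure ?I \<subseteq> S\<close> \<Gamma>(4) IO(1) unfolding clos by blast
    show "\<forall>z. z \<notin> S \<longrightarrow> winding_number \<Gamma> z = 0"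
    proof (intro allI impI)
      fix z assume "z \<notin> S"
      then have "z \<in> ?O" using \<open>closure ?I \<subseteq> S\<close> IO(1) unfolding clos by blast
      then show "winding_number \<Gamma> z = 0"
        using \<Gamma>(1,3) by (intro winding_number_zero_in_outside) (auto simp: valid_path_imp_path)
    qed
  qed (use fin \<Gamma> in auto)
  also have "(\<Sum>p\<in>\<tau>. winding_number \<Gamma> p * residue (\<lambda>z. apply_bcontfun (blinfun_apply (resolvent A z) g) x) p)
    = - (\<Sum>p\<in>\<tau>. residue (\<lambda>z. apply_bcontfun (blinfun_apply (resolvent A z) g) x) p)"
    unfolding sum_negf[symmetric] using \<Gamma>(4,6) by (intro sum.cong) auto
  finally show ?thesis by simp
qed

text \<open>The right-hand side no longer mentions a curve: this is how the arbitrary choice in the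
  definition is eliminated.\<close>

lemma spectral_projection_eq_residues:
  fixes A :: "'a::metric_space cop"
  assumes A: "clinear_op A" and sep: "separating_curve A \<tau> \<Gamma>" and fin: "finite \<tau>"
  shows "apply_bcontfun (blinfun_apply (spectral_projection A \<tau>) g) x =
    - (\<Sum>p\<in>\<tau>. residue (\<lambda>z. apply_bcontfun (blinfun_apply (resolvent A z) g) x) p)"
proof -
  obtain \<Gamma>' where \<Gamma>': "separating_curve A \<tau> \<Gamma>'"
    "apply_bcontfun (blinfun_apply (spectral_projection A \<tau>) g) x =
      1 / (2 * of_real pi * \<i>) * contour_integral \<Gamma>' (\<lambda>z. apply_bcontfun (blinfun_apply (resolvent A z) g) x)"
    using spectral_projection_eq_contour_integral[OF A sep] by metis
  then show ?thesis
    using contour_integral_separating_curve[OF A \<Gamma>'(1) fin, of g x] by simp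
qed

text \<open>The circle is reversed because \<open>separating_curve\<close> demands clockwise
  orientation.\<close>

lemma separating_curve_circle:
  assumes "r > 0" "\<tau> \<subseteq> ball c r" "(op_spectrum A - \<tau>) \<inter> cball c r = {}"
  shows "separating_curve A \<tau> (reversepath (circlepath c r))"
proof -
  have inside: "inside (sphere c r) = ball c r"
    using inside_frontier_eq_interior[of "cball c r"] \<open>r > 0\<close> by simp
  have outside: "outside (sphere c r) = - cball c r"
    using outside_frontier_eq_complement_closure[of "cball c r"] \<open>r > 0\<close> by simp
  have "winding_number (reversepath (circlepath c r)) z = -1" if "z \<in> ball c r" for z
  proof -
    have "cmod (z - c) < r" using that by (simp add: dist_norm norm_minus_commute)
    then show ?thesis
      using winding_number_circlepath[of z c r] \<open>r > 0\<close>
      by (subst winding_number_reversepath) (auto simp: dist_norm norm_minus_commute)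
  qed
  then show ?thesis
    using assms by (auto simp: separating_curve_def simple_path_reversepath simple_path_circlepath inside outside)
qed

text \<open>The chosen curve and the circle enclose the same residues. The minus sign undoes the
  reversal of the circle.\<close>

lemma spectral_projection_circle:
  fixes A :: "'a::metric_space cop"
  assumes A: "clinear_op A" and fin: "finite \<tau>"
    and c: "r > 0" "\<tau> \<subseteq> ball c r" "(op_spectrum A - \<tau>) \<inter> cball c r = {}"
  shows "apply_bcontfun (blinfun_apply (spectral_projection A \<tau>) g) x =
    - 1 / (2 * of_real pi * \<i>) *
      contour_integral (circlepath c r) (\<lambda>z. apply_bcontfun (blinfun_apply (resolvent A z) g) x)"
  using contour_integral_separating_curve[OF A separating_curve_circle[OF c] fin, of g x]
    spectral_projection_eq_residues[OF A separating_curve_circle[OF c] fin, of g x]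
  by (simp add: contour_integral_reversepath field_simps)

text \<open>On an eigenfunction the resolvent acts as the scalar \<open>1 / (\<mu> - z)\<close>,
  whose residue at \<open>\<mu>\<close> is -1. Consequently eigenfunctions lie in the range of the
  projection, and algebraic multiplicity bounds the eigenspace.\<close>

lemma spectral_projection_eigenfunction:
  fixes A :: "'a::metric_space cop"
  assumes A: "clinear_op A" and \<mu>: "open M" "\<mu> \<in> M" "op_spectrum A \<inter> M = {\<mu>}"
    and g: "blinfun_apply A g = cscale \<mu> g"
  shows "blinfun_apply (spectral_projection A {\<mu>}) g = g"
proof (rule bcontfun_eqI)
  fix x
  obtain r where r: "r > 0" "cball \<mu> r \<subseteq> M" using \<mu>(1,2) open_contains_cball by blast
  have "resolvent A z g = cscale (1 / (\<mu> - z)) g" if "z \<in> M - {\<mu>}" for z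
  proof -
    have "\<mu> \<noteq> z" using that by auto
    have z: "z \<notin> op_spectrum A" using that \<mu>(3) by auto
    have "blinfun_apply (A - cscale_op z) (cscale (1 / (\<mu> - z)) g) = g"
      using \<open>\<mu> \<noteq> z\<close> A g by (intro bcontfun_eqI)
        (simp add: blinfun.diff_left minus_bcontfun.rep_eq clinear_op_def
          flip: diff_divide_distrib left_diff_distrib)
    then show ?thesis using resolvent_inverse(2)[OF z] by metis
  qed
  moreover have "1 / (\<mu> - z) = - 1 / (z - \<mu>)" for z
    by (metis minus_diff_eq minus_divide_divide minus_minus)
  ultimately have eq: "apply_bcontfun (resolvent A z g) x = - apply_bcontfun g x / (z - \<mu>)" if "z \<in> M - {\<mu>}" for z
    using that by simp
  have "residue (\<lambda>z. apply_bcontfun (blinfun_apply (resolvent A z) g) x) \<mu> = residue (\<lambda>z. - apply_bcontfun g x / (z - \<mu>)) \<mu>"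
  proof (rule residue_cong)
    show "\<forall>\<^sub>F z in at \<mu>. apply_bcontfun (blinfun_apply (resolvent A z) g) x = - apply_bcontfun g x / (z - \<mu>)"
      using eventually_at_in_open[OF \<mu>(1,2)] eq by (auto elim: eventually_mono)
  qed simp
  also have "residue (\<lambda>z. - apply_bcontfun g x / (z - \<mu>)) \<mu> = - apply_bcontfun g x"
    using residue_simple[of UNIV \<mu> "\<lambda>_. - apply_bcontfun g x"] by simp
  finally have "residue (\<lambda>z. apply_bcontfun (blinfun_apply (resolvent A z) g) x) \<mu> = - apply_bcontfun g x" .
  moreover have "separating_curve A {\<mu>} (reversepath (circlepath \<mu> r))"
    using r \<mu>(3) by (intro separating_curve_circle) (simp, simp, blast)
  ultimately show "apply_bcontfun (blinfun_apply (spectral_projection A {\<mu>}) g) x = apply_bcontfun g x"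
    by (simp add: spectral_projection_eq_residues[OF A])
qed

section \<open>Collectively compact convergence\<close>

lemma compact_subsequence:
  fixes C :: "'b::metric_space set" and u :: "nat \<Rightarrow> 'b"
  assumes "compact C" "\<forall>n. u n \<in> C"
  shows "\<exists>y r. strict_mono r \<and> (\<lambda>n. u (r n)) \<longlonglongrightarrow> y"
  using assms(1)[unfolded compact_def, rule_format, of u] assms(2) unfolding o_def by auto

lemma eigenvalue_in_spectrum: "op_eigenvalue A z \<Longrightarrow> z \<in> op_spectrum A"
proof (rule ccontr)
  assume "op_eigenvalue A z" and z: "z \<notin> op_spectrum A"
  then obtain h where h: "h \<noteq> 0" "blinfun_apply (A - cscale_op z) h = 0"
    by (auto simp: op_eigenvalue_def eigenfunction_def blinfun.diff_left)
  then show False using resolvent_inverse(2)[OF z, of h] by (simp add: blinfun.zero_right)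
qed

text \<open>Anselone's notion, with one compact set \<open>C\<close> receiving the unit ball under
  all the operators. Index 0 is excluded because the empirical measure of an empty sample is not a
  probability measure.\<close>

locale collectively_compact =
  fixes T :: "nat \<Rightarrow> 'a::metric_space cop" and T' :: "'a cop" and C :: "('a \<Rightarrow>\<^sub>C complex) set"
  assumes compact_C: "compact C"
    and T_in: "\<And>n g. n > 0 \<Longrightarrow> norm g \<le> 1 \<Longrightarrow> blinfun_apply (T n) g \<in> C"
    and T'_in: "\<And>g. norm g \<le> 1 \<Longrightarrow> blinfun_apply T' g \<in> C"
    and T_lim: "\<And>g. (\<lambda>n. blinfun_apply (T n) g) \<longlonglongrightarrow> blinfun_apply T' g"
    and clinear_T: "\<And>n. n > 0 \<Longrightarrow> clinear_op (T n)"
    and clinear_T': "clinear_op T'"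
begin

abbreviation U where "U n \<equiv> id_blinfun - T n"
abbreviation U' where "U' \<equiv> id_blinfun - T'"

lemma clinear_U: "n > 0 \<Longrightarrow> clinear_op (U n)" and clinear_U': "clinear_op U'"
  using clinear_T clinear_T' by (auto simp: clinear_op_def blinfun.diff_left cscale.diff_right)

lemma uniform_bound:
  "\<exists>B>0. (\<forall>n>0. \<forall>g. norm (blinfun_apply (T n) g) \<le> B * norm g) \<and>
    (\<forall>g. norm (blinfun_apply T' g) \<le> B * norm g)"
proof -
  obtain B where B: "B > 0" "\<And>h. h \<in> C \<Longrightarrow> norm h \<le> B"
    using compact_imp_bounded[OF compact_C] by (auto simp: bounded_pos)
  have scale: "norm (blinfun_apply S g) \<le> B * norm g"
    if S: "\<And>g. norm g \<le> 1 \<Longrightarrow> blinfun_apply S g \<in> C" for S :: "'a cop" and g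
  proof (cases "g = 0")
    case False
    then have "norm (blinfun_apply S (inverse (norm g) *\<^sub>R g)) \<le> B" by (intro B(2) S) simp
    with False show ?thesis by (simp add: blinfun.scaleR_right field_simps)
  qed simp
  show ?thesis using B(1) by (intro exI[of _ B]) (auto intro!: scale T_in T'_in)
qed

text \<open>From \<open>(1 - \<zeta> j) f j = e j + T f j\<close> with \<open>T f j\<close> in
  \<open>C\<close>, a subsequence of the right-hand side converges, and division by
  \<open>1 - \<zeta> j\<close> carries this over to \<open>f\<close>. The limit has norm one, hence
  is a genuine eigenfunction. The case \<open>z = 1\<close> is kept because 1 may lie on the
  frontier of the set \<open>M\<close> considered below.\<close>

lemma approximate_eigenfunctions_converge:
  assumes N: "filterlim N at_top sequentially" "\<And>j. N j > 0"
    and f: "\<And>j. norm (f j) = 1" and z: "\<zeta> \<longlonglongrightarrow> z"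
    and lim: "(\<lambda>j. blinfun_apply (U (N j) - cscale_op (\<zeta> j)) (f j)) \<longlonglongrightarrow> 0"
    and ne: "z \<noteq> 1 \<or> 1 \<notin> op_spectrum U'"
  obtains r h where "strict_mono r" "(f \<circ> r) \<longlonglongrightarrow> h" "eigenfunction U' h z"
proof -
  obtain B where B: "B > 0" "\<And>n g. n > 0 \<Longrightarrow> norm (blinfun_apply (T n) g) \<le> B * norm g"
    using uniform_bound by blast
  define e where "e = (\<lambda>j. blinfun_apply (U (N j) - cscale_op (\<zeta> j)) (f j))"
  have e: "e j = cscale (1 - \<zeta> j) (f j) - blinfun_apply (T (N j)) (f j)" for j
    by (rule bcontfun_eqI) (simp add: e_def blinfun.diff_left minus_bcontfun.rep_eq left_diff_distrib)
  have e0: "e \<longlonglongrightarrow> 0" unfolding e_def by (rule lim)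
  have sub: "\<exists>r h. strict_mono r \<and> (f \<circ> r) \<longlonglongrightarrow> h"
  proof (cases "z = 1")
    case False
    have "\<forall>j. blinfun_apply (T (N j)) (f j) \<in> C" using N(2) f by (simp add: T_in)
    from compact_subsequence[OF compact_C this]
    obtain y r where r: "strict_mono r" "(\<lambda>j. blinfun_apply (T (N (r j))) (f (r j))) \<longlonglongrightarrow> y"
      by blast
    have zr: "(\<lambda>j. \<zeta> (r j)) \<longlonglongrightarrow> z" using LIMSEQ_subseq_LIMSEQ[OF z r(1)] by (simp add: o_def)
    have "(\<lambda>j. cscale (1 / (1 - \<zeta> (r j))) (e (r j) + blinfun_apply (T (N (r j))) (f (r j)))) \<longlonglongrightarrow> cscale (1 / (1 - z)) (0 + y)"
      using LIMSEQ_subseq_LIMSEQ[OF e0 r(1)] r(2) False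
      by (intro cscale.tendsto tendsto_intros zr) (auto simp: o_def)
    moreover have "\<forall>\<^sub>F j in sequentially. cscale (1 / (1 - \<zeta> (r j))) (e (r j) + blinfun_apply (T (N (r j))) (f (r j))) = f (r j)"
    proof -
      have "\<forall>\<^sub>F j in sequentially. \<zeta> (r j) \<noteq> 1" using zr False by (rule tendsto_imp_eventually_ne)
      then show ?thesis by eventually_elim (simp add: e)
    qed
    ultimately have "(\<lambda>j. f (r j)) \<longlonglongrightarrow> cscale (1 / (1 - z)) (0 + y)"
      by (rule Lim_transform_eventually)
    with r(1) show ?thesis by (auto simp: o_def)
  next
    case True \<comment> \<open>no division by \<open>1 - z\<close>; instead \<open>T' = - (U' - 1)\<close> is invertible\<close>
    with ne have one: "1 \<notin> op_spectrum U'" by simp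
    have "\<forall>j. blinfun_apply T' (f j) \<in> C" using f by (simp add: T'_in)
    from compact_subsequence[OF compact_C this]
    obtain y r where r: "strict_mono r" "(\<lambda>j. blinfun_apply T' (f (r j))) \<longlonglongrightarrow> y"
      by blast
    have inv: "blinfun_apply (resolvent U' 1) (- blinfun_apply T' g) = g" for g
    proof -
      have "blinfun_apply (U' - cscale_op 1) g = - blinfun_apply T' g"
        by (rule bcontfun_eqI) (simp add: blinfun.diff_left minus_bcontfun.rep_eq uminus_bcontfun.rep_eq)
      then show ?thesis using resolvent_inverse(2)[OF one, of g] by simp
    qed
    have "(\<lambda>j. blinfun_apply (resolvent U' 1) (- blinfun_apply T' (f (r j)))) \<longlonglongrightarrow> blinfun_apply (resolvent U' 1) (- y)"
      using r(2) by (intro blinfun.tendsto tendsto_intros) (simp add: o_def)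
    with r(1) show ?thesis by (auto simp: inv o_def)
  qed
  then obtain r h where r: "strict_mono r" "(f \<circ> r) \<longlonglongrightarrow> h" by blast
  have zr: "(\<lambda>j. \<zeta> (r j)) \<longlonglongrightarrow> z" using LIMSEQ_subseq_LIMSEQ[OF z r(1)] by (simp add: o_def)
  have fr: "(\<lambda>j. f (r j)) \<longlonglongrightarrow> h" using r(2) by (simp add: o_def)
  have Nr: "filterlim (\<lambda>j. N (r j)) at_top sequentially"
    using filterlim_compose[OF N(1) filterlim_subseq[OF r(1)]] .
  \<comment> \<open>Argument and operator vary together; the uniform bound controls the change of
    argument, and pointwise convergence is then used at the fixed function \<open>h\<close>
    only.\<close>
  have "(\<lambda>j. blinfun_apply (T (N (r j))) (f (r j) - h)) \<longlonglongrightarrow> 0"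
  proof (rule Lim_null_comparison)
    show "\<forall>\<^sub>F j in sequentially. norm (blinfun_apply (T (N (r j))) (f (r j) - h)) \<le> B * norm (f (r j) - h)"
      by (intro always_eventually allI B(2) N(2))
    show "(\<lambda>j. B * norm (f (r j) - h)) \<longlonglongrightarrow> 0"
      using fr by (auto intro!: tendsto_mult_right_zero tendsto_norm_zero simp: LIM_zero_iff)
  qed
  then have "(\<lambda>j. blinfun_apply (T (N (r j))) (f (r j) - h) + blinfun_apply (T (N (r j))) h) \<longlonglongrightarrow> 0 + blinfun_apply T' h"
    by (intro tendsto_add filterlim_compose[OF T_lim Nr])
  then have "(\<lambda>j. blinfun_apply (T (N (r j))) (f (r j))) \<longlonglongrightarrow> blinfun_apply T' h"
    by (simp add: blinfun.diff_right)
  moreover have "(\<lambda>j. cscale (1 - \<zeta> (r j)) (f (r j)) - e (r j)) \<longlonglongrightarrow> cscale (1 - z) h - 0"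
    using LIMSEQ_subseq_LIMSEQ[OF e0 r(1)] by (intro cscale.tendsto tendsto_intros zr fr) (simp add: o_def)
  ultimately have "blinfun_apply T' h = cscale (1 - z) h"
    using LIMSEQ_unique by (fastforce simp: e)
  moreover have "norm h = 1"
    using tendsto_norm[OF fr] f by (simp add: LIMSEQ_const_iff)
  ultimately have "eigenfunction U' h z"
    by (auto simp: eigenfunction_def blinfun.diff_left cscale.diff_left)
  with r show ?thesis by (rule that)
qed

text \<open>If no constant worked, failures at \<open>1 / (j + 1)\<close> would give normalised
  approximate eigenfunctions with parameters in \<open>Z\<close>; by compactness of \<open>Z\<close>
  these accumulate at an eigenfunction of \<open>U'\<close> with eigenvalue in
  \<open>Z\<close>.\<close>

lemma uniformly_bounded_below:
  assumes Z: "compact Z" and ne: "\<And>z. z \<in> Z \<Longrightarrow> \<not> op_eigenvalue U' z" and one: "1 \<in> Z \<Longrightarrow> 1 \<notin> op_spectrum U'"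
  shows "\<exists>c>0. \<forall>\<^sub>F n in sequentially. \<forall>z\<in>Z. \<forall>f. c * norm f \<le> norm (blinfun_apply (U n - cscale_op z) f)"
proof (rule ccontr)
  assume "\<not> ?thesis"
  then have no: "\<not> (\<forall>\<^sub>F n in sequentially. \<forall>z\<in>Z. \<forall>f. c * norm f \<le> norm (blinfun_apply (U n - cscale_op z) f))" if "c > 0" for c
    using that by blast
  \<comment> \<open>Requiring \<open>n \<ge> Suc j\<close> makes the indices positive and forces
    them to infinity.\<close>
  have "\<exists>n z f. n \<ge> Suc j \<and> z \<in> Z \<and> norm f = 1 \<and> norm (blinfun_apply (U n - cscale_op z) f) \<le> inverse (real (Suc j))" for j
  proof -
    have "\<exists>n\<ge>Suc j. \<exists>z\<in>Z. \<exists>f. \<not> inverse (real (Suc j)) * norm f \<le> norm (blinfun_apply (U n - cscale_op z) f)"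
      using no[of "inverse (real (Suc j))"] unfolding eventually_sequentially by auto
    then obtain n z f where n: "n \<ge> Suc j" "z \<in> Z" and
      less: "norm (blinfun_apply (U n - cscale_op z) f) < inverse (real (Suc j)) * norm f"
      by (auto simp only: not_le)
    then have "f \<noteq> 0" by auto
    with less have "norm (blinfun_apply (U n - cscale_op z) (inverse (norm f) *\<^sub>R f)) \<le> inverse (real (Suc j))"
      unfolding blinfun.scaleR_right by (simp add: field_simps)
    with n \<open>f \<noteq> 0\<close> show ?thesis by (intro exI[of _ n] exI[of _ z] exI[of _ "inverse (norm f) *\<^sub>R f"]) simp
  qed
  then obtain N \<zeta> f where seq: "\<And>j. N j \<ge> Suc j" "\<And>j. \<zeta> j \<in> Z" "\<And>j. norm (f j) = 1"
    "\<And>j. norm (blinfun_apply (U (N j) - cscale_op (\<zeta> j)) (f j)) \<le> inverse (real (Suc j))"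
    by metis
  obtain z s where s: "z \<in> Z" "strict_mono s" "(\<zeta> \<circ> s) \<longlonglongrightarrow> z"
    using Z[unfolded compact_def, rule_format, of \<zeta>] seq(2) by auto
  have "j \<le> N j" for j using seq(1)[of j] by simp
  then have N_lim: "filterlim N at_top sequentially"
    by (intro filterlim_at_top_mono[OF filterlim_ident] always_eventually allI)
  have "(\<lambda>j. blinfun_apply (U (N j) - cscale_op (\<zeta> j)) (f j)) \<longlonglongrightarrow> 0"
    by (rule Lim_null_comparison[OF _ LIMSEQ_inverse_real_of_nat]) (use seq(4) in auto)
  from LIMSEQ_subseq_LIMSEQ[OF this s(2)]
  have e: "(\<lambda>j. blinfun_apply (U (N (s j)) - cscale_op ((\<zeta> \<circ> s) j)) ((f \<circ> s) j)) \<longlonglongrightarrow> 0"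
    by (simp add: o_def)
  have pos: "N (s j) > 0" for j using seq(1)[of "s j"] by simp
  have "\<exists>h. eigenfunction U' h z"
    by (rule approximate_eigenfunctions_converge[OF
          filterlim_compose[OF N_lim filterlim_subseq[OF s(2)]] pos _ s(3) e])
      (use seq(3) s(1) one in auto)
  with ne[OF s(1)] show False by (auto simp: op_eigenvalue_def)
qed

text \<open>Equibounded operators that converge pointwise converge uniformly on a finite net, hence
  on a compact set. With \<open>d = e / (4 * B)\<close> passing to the net costs
  \<open>e / 4\<close> for each operator, and the net itself \<open>e / 2\<close>.\<close>

lemma uniform_on_compact:
  assumes K: "compact K" and "e > 0"
  shows "\<forall>\<^sub>F n in sequentially. \<forall>h\<in>K. norm (blinfun_apply (T n) h - blinfun_apply T' h) \<le> e"
proof -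
  obtain B where B: "B > 0" "\<And>n g. n > 0 \<Longrightarrow> norm (blinfun_apply (T n) g) \<le> B * norm g"
      "\<And>g. norm (blinfun_apply T' g) \<le> B * norm g"
    using uniform_bound by blast
  define d where "d = e / (4 * B)"
  have "d > 0" using \<open>e > 0\<close> B(1) by (simp add: d_def)
  then obtain F where F: "finite F" "K \<subseteq> (\<Union>x\<in>F. ball x d)"
    using K unfolding compact_eq_totally_bounded by blast
  have "\<forall>\<^sub>F n in sequentially. \<forall>x\<in>F. norm (blinfun_apply (T n) x - blinfun_apply T' x) < e / 2"
    using F(1) \<open>e > 0\<close>
    by (intro eventually_ball_finite ballI T_lim[unfolded tendsto_iff dist_norm, rule_format]) simp_all
  then show ?thesis using eventually_gt_at_top[of 0]
  proof eventually_elim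
    case (elim n)
    show ?case
    proof
      fix h assume "h \<in> K"
      then obtain x where x: "x \<in> F" "norm (h - x) < d"
        using F(2) by (auto simp: dist_norm norm_minus_commute)
      have "blinfun_apply (T n) h - blinfun_apply T' h =
        blinfun_apply (T n) (h - x) + (blinfun_apply (T n) x - blinfun_apply T' x) - blinfun_apply T' (h - x)"
        by (simp add: blinfun.diff_right)
      also have "norm \<dots> \<le> norm (blinfun_apply (T n) (h - x)) + norm (blinfun_apply (T n) x - blinfun_apply T' x)
          + norm (blinfun_apply T' (h - x))"
        by (intro order_trans[OF norm_triangle_ineq4] add_right_mono norm_triangle_ineq)
      also have "\<dots> \<le> B * d + e / 2 + B * d"
        using elim x B(1) by (intro add_mono order_trans[OF B(2)] order_trans[OF B(3)] mult_left_mono) (auto intro: less_imp_le)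
      also have "\<dots> = e" using B(1) by (simp add: d_def)
      finally show "norm (blinfun_apply (T n) h - blinfun_apply T' h) \<le> e" .
    qed
  qed
qed

text \<open>With \<open>h\<close> the limit resolvent applied to \<open>g\<close>,
  \<open>U n - z\<close> maps the difference of the two resolvents to \<open>T n h - T' h\<close>.
  As \<open>z\<close> runs through \<open>Z\<close>, \<open>h\<close> runs through a compact set, so
  this is uniformly small, and the uniform lower bound inverts \<open>U n - z\<close>.\<close>

lemma resolvent_uniform:
  assumes Z: "compact Z" and avoid': "Z \<inter> op_spectrum U' = {}"
    and avoid: "\<forall>\<^sub>F n in sequentially. Z \<inter> op_spectrum (U n) = {}" and "e > 0"
  shows "\<forall>\<^sub>F n in sequentially. \<forall>z\<in>Z. norm (blinfun_apply (resolvent (U n) z) g - blinfun_apply (resolvent U' z) g) \<le> e"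
proof -
  have "\<not> op_eigenvalue U' z" if "z \<in> Z" for z
    using avoid' that eigenvalue_in_spectrum by blast
  then obtain c where c: "c > 0"
    "\<forall>\<^sub>F n in sequentially. \<forall>z\<in>Z. \<forall>f. c * norm f \<le> norm (blinfun_apply (U n - cscale_op z) f)"
    using uniformly_bounded_below[OF Z] avoid' by blast
  define K where "K = (\<lambda>z. blinfun_apply (resolvent U' z) g) ` Z"
  have "compact K" unfolding K_def
    by (intro compact_continuous_image Z bounded_linear.continuous_on[OF blinfun.bounded_linear_left]
        continuous_on_resolvent clinear_U' avoid')
  then have "\<forall>\<^sub>F n in sequentially. \<forall>h\<in>K. norm (blinfun_apply (T n) h - blinfun_apply T' h) \<le> c * e"
    using c(1) \<open>e > 0\<close> by (intro uniform_on_compact) auto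
  with c(2) avoid show ?thesis
  proof eventually_elim
    case (elim n)
    show ?case
    proof
      fix z assume "z \<in> Z"
      then have z: "z \<notin> op_spectrum (U n)" "z \<notin> op_spectrum U'" using elim(2) avoid' by auto
      let ?h = "blinfun_apply (resolvent U' z) g"
      have "blinfun_apply (U n - cscale_op z) (blinfun_apply (resolvent (U n) z) g - ?h) =
        g - blinfun_apply (U n - cscale_op z) ?h"
        by (simp only: blinfun.diff_right resolvent_inverse[OF z(1)])
      also have "\<dots> = blinfun_apply (U' - cscale_op z) ?h - blinfun_apply (U n - cscale_op z) ?h"
        by (simp only: resolvent_inverse[OF z(2)])
      also have "\<dots> = blinfun_apply (T n) ?h - blinfun_apply T' ?h"
        by (simp add: blinfun.diff_left)
      also have "norm \<dots> \<le> c * e" using elim(3) \<open>z \<in> Z\<close> by (auto simp: K_def)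
      finally have "c * norm (blinfun_apply (resolvent (U n) z) g - ?h) \<le> c * e"
        using elim(1) \<open>z \<in> Z\<close> by (meson order_trans)
      with c(1) show "norm (blinfun_apply (resolvent (U n) z) g - ?h) \<le> e" by simp
    qed
  qed
qed

section \<open>Perturbation of an isolated spectral point\<close>

context
  fixes M :: "complex set" and \<mu> :: complex
  assumes M: "open M" "\<mu> \<in> M" "op_spectrum U' \<inter> M = {\<mu>}" "op_spectrum U' \<inter> frontier M = {}" "1 \<notin> M"
    and fredholm: "\<And>n z. n > 0 \<Longrightarrow> z \<in> op_spectrum (U n) \<Longrightarrow> z \<noteq> 1 \<Longrightarrow> op_eigenvalue (U n) z"
    and finite_spectrum: "\<And>n. n > 0 \<Longrightarrow> finite (op_spectrum (U n) \<inter> M)"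
begin

text \<open>A spectral point of \<open>U n\<close> in \<open>M\<close> away from
  \<open>\<mu>\<close> would be an eigenvalue lying in \<open>Z\<close>, against the uniform lower
  bound there. Compactness of \<open>Z\<close> needs the closure of \<open>M\<close>, which is where
  the assumption on the frontier enters.\<close>

lemma spectrum_near:
  assumes "r > 0"
  shows "\<forall>\<^sub>F n in sequentially. op_spectrum (U n) \<inter> M \<subseteq> ball \<mu> r"
proof -
  obtain B where B: "B > 0" "\<And>n g. n > 0 \<Longrightarrow> norm (blinfun_apply (T n) g) \<le> B * norm g"
    using uniform_bound by blast
  \<comment> \<open>\<open>M\<close> may be unbounded; the disc of radius \<open>1 + B\<close>
    contains all eigenvalues concerned, since \<open>T n\<close> has norm at most
    \<open>B\<close>.\<close>
  define Z where "Z = (closure M - ball \<mu> r) \<inter> cball 0 (1 + B)"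
  have "closure M = M \<union> frontier M" by (rule closure_Un_frontier)
  moreover have "x = \<mu>" if "x \<in> op_spectrum U'" "x \<in> M" for x using M(3) that by blast
  ultimately have Z_avoid: "Z \<inter> op_spectrum U' = {}" using M(4) \<open>r > 0\<close> by (auto simp: Z_def)
  have "compact Z" unfolding Z_def by (intro closed_Int_compact closed_Diff) auto
  then obtain c where c: "c > 0"
    "\<forall>\<^sub>F n in sequentially. \<forall>z\<in>Z. \<forall>f. c * norm f \<le> norm (blinfun_apply (U n - cscale_op z) f)"
    using uniformly_bounded_below[of Z] Z_avoid eigenvalue_in_spectrum by blast
  from c(2) eventually_gt_at_top[of 0] show ?thesis
  proof eventually_elim
    case (elim n)
    show ?case
    proof
      fix z assume z: "z \<in> op_spectrum (U n) \<inter> M"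
      then obtain h where h: "h \<noteq> 0" "blinfun_apply (U n) h = cscale z h"
        using fredholm[OF elim(2), of z] M(5) by (auto simp: op_eigenvalue_def eigenfunction_def)
      have "cmod z * norm h \<le> norm h + norm (blinfun_apply (T n) h)"
        using norm_triangle_ineq4[of h "blinfun_apply (T n) h"] h(2) by (simp add: blinfun.diff_left flip: norm_cscale)
      also have "\<dots> \<le> (1 + B) * norm h" using B(2)[OF elim(2), of h] by (simp add: algebra_simps)
      finally have "cmod z \<le> 1 + B" using h(1) by simp
      moreover have "z \<notin> Z"
      proof
        assume "z \<in> Z"
        then have "c * norm h \<le> norm (blinfun_apply (U n - cscale_op z) h)" using elim(1) by blast
        also have "\<dots> = 0" using h(2) by (subst blinfun.diff_left) simp
        finally show False using c(1) h(1) by (simp add: mult_le_0_iff)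
      qed
      ultimately show "z \<in> ball \<mu> r" using z closure_subset[of M] by (auto simp: Z_def)
    qed
  qed
qed

text \<open>Eventually the circle of radius \<open>r\<close> isolates the part of the spectrum in
  \<open>M\<close> for \<open>U n\<close> as well as for \<open>U'\<close>. Both projections then
  become integrals over one and the same circle, where the resolvents converge uniformly.\<close>

lemma spectral_projections_converge:
  shows "\<forall>\<^sub>F n in sequentially. \<exists>\<Gamma>. separating_curve (U n) (op_spectrum (U n) \<inter> M) \<Gamma>"
    and "(\<lambda>n. blinfun_apply (spectral_projection (U n) (op_spectrum (U n) \<inter> M)) g)
      \<longlonglongrightarrow> blinfun_apply (spectral_projection U' {\<mu>}) g"
proof -
  obtain r where r: "r > 0" "cball \<mu> r \<subseteq> M" using M(1,2) open_contains_cball by blast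
  note near = spectrum_near[OF r(1)]
  from near show "\<forall>\<^sub>F n in sequentially. \<exists>\<Gamma>. separating_curve (U n) (op_spectrum (U n) \<inter> M) \<Gamma>"
  proof eventually_elim
    case (elim n)
    then show ?case using r by (intro exI[of _ "reversepath (circlepath \<mu> r)"] separating_curve_circle) auto
  qed
  let ?S = "sphere \<mu> r"
  have only: "(op_spectrum U' - {\<mu>}) \<inter> cball \<mu> r = {}" using r(2) M(3) by blast
  have S': "?S \<inter> op_spectrum U' = {}"
  proof -
    have "?S \<subseteq> cball \<mu> r - {\<mu>}" using r(1) by auto
    then show ?thesis using only by blast
  qed
  have S: "\<forall>\<^sub>F n in sequentially. ?S \<inter> op_spectrum (U n) = {}"
    using near
  proof eventually_elim
    case (elim n)
    then show ?case using r(2) by force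
  qed
  show "(\<lambda>n. blinfun_apply (spectral_projection (U n) (op_spectrum (U n) \<inter> M)) g)
      \<longlonglongrightarrow> blinfun_apply (spectral_projection U' {\<mu>}) g"
  proof (rule tendstoI)
    fix e :: real assume "e > 0"
    \<comment> \<open>The circle has length \<open>2 * pi * r\<close> and the prefactor modulus
      \<open>1 / (2 * pi)\<close>, so an error \<open>e'\<close> in the resolvent becomes
      \<open>e' * r = e / 2\<close>.\<close>
    define e' where "e' = e / (2 * r)"
    have "e' > 0" using \<open>e > 0\<close> r(1) by (simp add: e'_def)
    from near eventually_gt_at_top[of 0] S resolvent_uniform[OF compact_sphere S' S this, of g]
    show "\<forall>\<^sub>F n in sequentially. dist (blinfun_apply (spectral_projection (U n) (op_spectrum (U n) \<inter> M)) g)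
      (blinfun_apply (spectral_projection U' {\<mu>}) g) < e"
    proof eventually_elim
      case (elim n)
      have "norm (blinfun_apply (spectral_projection (U n) (op_spectrum (U n) \<inter> M)) g
          - blinfun_apply (spectral_projection U' {\<mu>}) g) \<le> e' * r"
      proof (rule norm_bound)
        fix x
        let ?\<phi> = "\<lambda>z. apply_bcontfun (blinfun_apply (resolvent (U n) z) g) x"
        let ?\<psi> = "\<lambda>z. apply_bcontfun (blinfun_apply (resolvent U' z) g) x"
        have int: "?\<phi> contour_integrable_on circlepath \<mu> r" "?\<psi> contour_integrable_on circlepath \<mu> r"
          using r(1) elim(3) S'
          by (auto intro!: contour_integrable_continuous_circlepath holomorphic_on_imp_continuous_on
              holomorphic_resolvent clinear_U[OF elim(2)] clinear_U')
        then have "((\<lambda>z. ?\<phi> z - ?\<psi> z) has_contour_integral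
            contour_integral (circlepath \<mu> r) ?\<phi> - contour_integral (circlepath \<mu> r) ?\<psi>) (circlepath \<mu> r)"
          by (intro has_contour_integral_diff has_contour_integral_integral)
        then have bound: "norm (contour_integral (circlepath \<mu> r) ?\<phi> - contour_integral (circlepath \<mu> r) ?\<psi>) \<le> e' * (2 * pi * r)"
        proof (rule has_contour_integral_bound_circlepath)
          fix z assume "cmod (z - \<mu>) = r"
          then have "z \<in> ?S" by (simp add: dist_norm norm_minus_commute)
          then show "cmod (?\<phi> z - ?\<psi> z) \<le> e'"
            using elim(4) norm_bounded[of "blinfun_apply (resolvent (U n) z) g - blinfun_apply (resolvent U' z) g" x]
            by (auto simp: minus_bcontfun.rep_eq intro: order_trans)
        qed (use r(1) \<open>e' > 0\<close> in auto)
        have "apply_bcontfun (blinfun_apply (spectral_projection (U n) (op_spectrum (U n) \<inter> M)) g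
            - blinfun_apply (spectral_projection U' {\<mu>}) g) x =
            - 1 / (2 * of_real pi * \<i>) * (contour_integral (circlepath \<mu> r) ?\<phi> - contour_integral (circlepath \<mu> r) ?\<psi>)"
        proof -
          have "apply_bcontfun (blinfun_apply (spectral_projection (U n) (op_spectrum (U n) \<inter> M)) g) x =
              - 1 / (2 * of_real pi * \<i>) * contour_integral (circlepath \<mu> r) ?\<phi>"
            using elim r(2) by (intro spectral_projection_circle clinear_U finite_spectrum r(1)) auto
          moreover have "apply_bcontfun (blinfun_apply (spectral_projection U' {\<mu>}) g) x =
              - 1 / (2 * of_real pi * \<i>) * contour_integral (circlepath \<mu> r) ?\<psi>"
            using r(1) only by (intro spectral_projection_circle clinear_U') auto
          ultimately show ?thesis
            unfolding minus_bcontfun.rep_eq by (simp only: right_diff_distrib)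
        qed
        then have "norm (apply_bcontfun (blinfun_apply (spectral_projection (U n) (op_spectrum (U n) \<inter> M)) g
            - blinfun_apply (spectral_projection U' {\<mu>}) g) x) =
            norm (contour_integral (circlepath \<mu> r) ?\<phi> - contour_integral (circlepath \<mu> r) ?\<psi>) / (2 * pi)"
          by (simp only: norm_mult) (simp add: norm_divide norm_mult)
        also have "\<dots> \<le> e' * (2 * pi * r) / (2 * pi)" by (rule divide_right_mono[OF bound]) simp
        also have "\<dots> = e' * r" by simp
        finally show "norm (apply_bcontfun (blinfun_apply (spectral_projection (U n) (op_spectrum (U n) \<inter> M)) g
            - blinfun_apply (spectral_projection U' {\<mu>}) g) x) \<le> e' * r" .
      qed
      also have "\<dots> < e" using r(1) \<open>e > 0\<close> by (simp add: e'_def)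
      finally show ?case by (simp add: dist_norm)
    qed
  qed
qed

end

end

section \<open>The integral operators\<close>

text \<open>The Arzela-Ascoli theorem, by total boundedness: round the values of \<open>f\<close> on
  a finite net of points to a finite net of values. Finitely many rounded patterns occur, and
  functions sharing a pattern are within \<open>4 * e' = e\<close>.\<close>

lemma compact_closure_equicontinuous:
  fixes S :: "('a::metric_space \<Rightarrow>\<^sub>C complex) set"
  assumes cpt: "compact (UNIV :: 'a set)" and bd: "\<And>f. f \<in> S \<Longrightarrow> norm f \<le> B"
    and eq: "\<And>e. e > 0 \<Longrightarrow> \<exists>d>0. \<forall>f\<in>S. \<forall>x y. dist x y < d \<longrightarrow>
      dist (apply_bcontfun f x) (apply_bcontfun f y) \<le> e"
  shows "compact (closure S)"
proof -
  have tb: "\<exists>K. finite K \<and> S \<subseteq> (\<Union>f\<in>K. cball f e)" if "e > 0" for e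
  proof -
    define e' where "e' = e / 4"
    have "e' > 0" using \<open>e > 0\<close> by (simp add: e'_def)
    then obtain d where d: "d > 0"
      "\<And>f x y. f \<in> S \<Longrightarrow> dist x y < d \<Longrightarrow> dist (apply_bcontfun f x) (apply_bcontfun f y) \<le> e'"
      using eq[OF \<open>e' > 0\<close>] by auto
    obtain F :: "'a set" where F: "finite F" "UNIV \<subseteq> (\<Union>c\<in>F. ball c d)"
      using cpt[unfolded compact_eq_totally_bounded, THEN conjunct2, rule_format, OF d(1)] by auto
    obtain G :: "complex set" where G: "finite G" "cball 0 B \<subseteq> (\<Union>w\<in>G. ball w e')"
      using compact_cball[of "0 :: complex" B, unfolded compact_eq_totally_bounded, THEN conjunct2,
          rule_format, OF \<open>e' > 0\<close>] by auto
    define near where "near f \<rho> \<longleftrightarrow> f \<in> S \<and> (\<forall>c\<in>F. dist (\<rho> c) (apply_bcontfun f c) < e')" for f \<rho>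
    \<comment> \<open>One member of \<open>S\<close> is picked per pattern; patterns that no member
      realises give arbitrary functions, which do no harm in a finite cover.\<close>
    define rep where "rep \<rho> = (SOME f. near f \<rho>)" for \<rho>
    have ex_near: "\<exists>\<rho>\<in>F \<rightarrow>\<^sub>E G. near f \<rho>" if "f \<in> S" for f
    proof -
      have "\<exists>w\<in>G. dist w (apply_bcontfun f c) < e'" for c
      proof -
        have "apply_bcontfun f c \<in> cball 0 B" using bd[OF that] norm_bounded[of f c] by (simp add: dist_norm)
        then show ?thesis using G(2) by (auto simp: subset_eq)
      qed
      then obtain w where "\<And>c. w c \<in> G" "\<And>c. dist (w c) (apply_bcontfun f c) < e'" by metis
      then show ?thesis using that by (intro bexI[of _ "restrict w F"]) (auto simp: near_def)
    qed
    have near_rep: "f \<in> cball (rep \<rho>) e" if "near f \<rho>" for f \<rho>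
    proof -
      have r: "near (rep \<rho>) \<rho>" unfolding rep_def using that by (rule someI[of "\<lambda>f. near f \<rho>"])
      have "dist (rep \<rho>) f \<le> e"
      proof (rule dist_bound)
        fix x
        obtain c where c: "c \<in> F" "dist c x < d" using subsetD[OF F(2) UNIV_I[of x]] by auto
        have "dist (apply_bcontfun (rep \<rho>) x) (apply_bcontfun (rep \<rho>) c) \<le> e'"
          using d(2)[of "rep \<rho>" x c] r c by (simp add: near_def dist_commute)
        moreover have "dist (apply_bcontfun f c) (apply_bcontfun f x) \<le> e'"
          using d(2)[of f c x] that c by (simp add: near_def)
        moreover have "dist (\<rho> c) (apply_bcontfun (rep \<rho>) c) < e'" "dist (\<rho> c) (apply_bcontfun f c) < e'"
          using r that c by (auto simp: near_def)
        ultimately have "dist (apply_bcontfun (rep \<rho>) x) (apply_bcontfun f x) \<le> e' + e' + e' + e'"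
          by metric
        then show "dist (apply_bcontfun (rep \<rho>) x) (apply_bcontfun f x) \<le> e" by (simp add: e'_def)
      qed
      then show ?thesis by simp
    qed
    have "S \<subseteq> (\<Union>f\<in>rep ` (F \<rightarrow>\<^sub>E G). cball f e)"
    proof
      fix f assume "f \<in> S"
      from ex_near[OF this] obtain \<rho> where "\<rho> \<in> F \<rightarrow>\<^sub>E G" "near f \<rho>" ..
      with near_rep[OF this(2)] show "f \<in> (\<Union>f\<in>rep ` (F \<rightarrow>\<^sub>E G). cball f e)" by auto
    qed
    moreover have "finite (rep ` (F \<rightarrow>\<^sub>E G))" by (intro finite_imageI finite_PiE F(1) G(1))
    ultimately show ?thesis by blast
  qed
  have "\<exists>K. finite K \<and> closure S \<subseteq> (\<Union>f\<in>K. ball f e)" if "e > 0" for e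
  proof -
    obtain K where K: "finite K" "S \<subseteq> (\<Union>f\<in>K. cball f (e / 2))" using tb[of "e / 2"] \<open>e > 0\<close> by auto
    then have "closure S \<subseteq> (\<Union>f\<in>K. cball f (e / 2))" by (intro closure_minimal closed_UN) auto
    also have "\<dots> \<subseteq> (\<Union>f\<in>K. ball f e)" using \<open>e > 0\<close> by force
    finally show ?thesis using K(1) by blast
  qed
  then show ?thesis unfolding compact_eq_totally_bounded by (simp add: complete_eq_closed)
qed

text \<open>Rationalise: \<open>sqrt b - sqrt a\<close> is
  \<open>(b - a) / (sqrt a + sqrt b)\<close>, of modulus at most
  \<open>\<bar>a - b\<bar> / sqrt l\<close>, and the common denominator
  \<open>sqrt a * sqrt b\<close> is at least \<open>l\<close>.\<close>

lemma inverse_sqrt_lipschitz: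
  fixes a b l :: real
  assumes "l > 0" "a \<ge> l" "b \<ge> l"
  shows "\<bar>1 / sqrt a - 1 / sqrt b\<bar> \<le> \<bar>a - b\<bar> / (l * sqrt l)"
proof -
  have p: "a > 0" "b > 0" using assms by auto
  have "\<bar>a - b\<bar> = \<bar>sqrt b - sqrt a\<bar> * (sqrt a + sqrt b)"
  proof -
    have "(sqrt b - sqrt a) * (sqrt a + sqrt b) = b - a"
      using p by (simp add: algebra_simps)
    then have "\<bar>b - a\<bar> = \<bar>sqrt b - sqrt a\<bar> * \<bar>sqrt a + sqrt b\<bar>" by (metis abs_mult)
    then show ?thesis using p by (simp add: abs_minus_commute)
  qed
  moreover have "sqrt a + sqrt b \<ge> sqrt l"
    using real_sqrt_le_mono[OF assms(2)] p by (simp add: add_increasing2)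
  ultimately have num: "\<bar>sqrt b - sqrt a\<bar> * sqrt l \<le> \<bar>a - b\<bar>"
    by (simp add: mult_left_mono)
  have den: "l \<le> sqrt a * sqrt b"
    using mult_mono[OF real_sqrt_le_mono[OF assms(2)] real_sqrt_le_mono[OF assms(3)]] assms(1) p by simp
  have "1 / sqrt a - 1 / sqrt b = (sqrt b - sqrt a) / (sqrt a * sqrt b)"
    using p by (simp add: field_simps)
  then have "\<bar>1 / sqrt a - 1 / sqrt b\<bar> = \<bar>sqrt b - sqrt a\<bar> / (sqrt a * sqrt b)"
    using p by (simp add: abs_mult)
  also have "\<dots> \<le> \<bar>sqrt b - sqrt a\<bar> / l"
    using den assms(1) by (intro divide_left_mono) (auto intro: mult_pos_pos p)
  also have "\<dots> \<le> \<bar>a - b\<bar> / (l * sqrt l)"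
    using num assms(1) by (simp add: field_simps)
  finally show ?thesis .
qed

text \<open>The class of measures over which the estimates are uniform; it contains the sampling
  distribution and all empirical measures of nonempty samples.\<close>

definition borel_prob :: "'a::topological_space measure \<Rightarrow> bool" where
  "borel_prob Q \<longleftrightarrow> prob_space Q \<and> sets Q = sets borel"

lemma borel_prob_empirical: "n > 0 \<Longrightarrow> borel_prob (empirical x n)"
  by (simp add: borel_prob_def prob_space_empirical) (simp add: empirical_def)

lemma compact_bcontfun:
  fixes f :: "'a::metric_space \<Rightarrow> 'b::real_normed_vector"
  assumes cpt: "compact (UNIV :: 'a set)" and f: "continuous_on UNIV f"
  shows "f \<in> bcontfun"
proof -
  obtain B where "\<And>x. norm (f x) \<le> B"
    using compact_imp_bounded[OF compact_continuous_image[OF f cpt]] by (auto simp: bounded_iff)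
  with f show ?thesis by (rule bcontfun_normI)
qed

lemma compact_integrable:
  fixes f :: "'a::metric_space \<Rightarrow> 'b::{banach, second_countable_topology}"
  assumes cpt: "compact (UNIV :: 'a set)" and Q: "borel_prob Q" and f: "continuous_on UNIV f"
  shows "integrable Q f"
proof -
  interpret prob_space Q using Q by (simp add: borel_prob_def)
  obtain B where "\<And>x. norm (f x) \<le> B"
    using compact_imp_bounded[OF compact_continuous_image[OF f cpt]] by (auto simp: bounded_iff)
  moreover have "f \<in> borel_measurable Q"
    using borel_measurable_continuous_onI[OF f] Q by (simp add: borel_prob_def cong: measurable_cong_sets)
  ultimately show ?thesis by (intro integrable_const_bound[where B = B]) auto
qed

lemma compact_norm_integral_le:
  fixes f :: "'a::metric_space \<Rightarrow> 'b::{banach, second_countable_topology}"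
  assumes cpt: "compact (UNIV :: 'a set)" and Q: "borel_prob Q" and f: "continuous_on UNIV f" and e: "\<And>x. norm (f x) \<le> e"
  shows "norm (\<integral>x. f x \<partial>Q) \<le> e"
proof -
  interpret prob_space Q using Q by (simp add: borel_prob_def)
  have "norm (\<integral>x. f x \<partial>Q) \<le> (\<integral>x. norm (f x) \<partial>Q)" by (rule integral_norm_bound)
  also have "\<dots> \<le> (\<integral>x. e \<partial>Q)"
    by (intro integral_mono integrable_norm compact_integrable cpt Q f e) simp
  finally show ?thesis by (simp add: prob_space)
qed

lemma compact_norm_integral_diff_le:
  fixes f g :: "'a::metric_space \<Rightarrow> 'b::{banach, second_countable_topology}"
  assumes cpt: "compact (UNIV :: 'a set)" and Q: "borel_prob Q" and f: "continuous_on UNIV f" and g: "continuous_on UNIV g"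
    and e: "\<And>x. norm (f x - g x) \<le> e"
  shows "norm ((\<integral>x. f x \<partial>Q) - (\<integral>x. g x \<partial>Q)) \<le> e"
  using compact_norm_integral_le[OF cpt Q continuous_on_diff[OF f g] e]
  by (simp add: compact_integrable[OF cpt Q] f g)

locale similarity =
  fixes k :: "'a::metric_space \<Rightarrow> 'a \<Rightarrow> real" and l :: real
  assumes cpt: "compact (UNIV :: 'a set)"
    and k_cont: "continuous_on UNIV (\<lambda>(x, y). k x y)"
    and l_pos: "l > 0" and k_gt: "\<And>x y. k x y > l"
begin

lemmas norm_integral_le = compact_norm_integral_le[OF cpt]
  and norm_integral_diff_le = compact_norm_integral_diff_le[OF cpt]

lemma deg_ge: "borel_prob Q \<Longrightarrow> deg k Q x \<ge> l"
  and nker_continuous: "borel_prob Q \<Longrightarrow> continuous_on UNIV (\<lambda>(x, y). nker k Q x y)"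
  using nker_bound_continuous[OF cpt _ _ k_cont l_pos k_gt] by (simp_all add: borel_prob_def)

lemma T_apply:
  "borel_prob Q \<Longrightarrow> apply_bcontfun (blinfun_apply (T_op k Q) g) x =
    (\<integral>y. complex_of_real (nker k Q x y) * apply_bcontfun g y \<partial>Q)"
  using T_op_apply[OF cpt _ _ k_cont l_pos k_gt] by (simp add: borel_prob_def)

lemma integrand_continuous:
  assumes "borel_prob Q"
  shows "continuous_on UNIV (\<lambda>(x, y). complex_of_real (nker k Q x y) * apply_bcontfun g y)"
    and "continuous_on UNIV (\<lambda>y. complex_of_real (nker k Q x y) * apply_bcontfun g y)"
proof -
  have "continuous_on UNIV (\<lambda>z :: 'a \<times> 'a. apply_bcontfun g (snd z))"
    by (rule continuous_on_compose2[OF continuous_on_apply_bcontfun[of UNIV] continuous_on_snd[OF continuous_on_id]]) simp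
  then show c: "continuous_on UNIV (\<lambda>(x, y). complex_of_real (nker k Q x y) * apply_bcontfun g y)"
    using nker_continuous[OF assms] unfolding case_prod_beta by (intro continuous_on_mult continuous_on_of_real)
  show "continuous_on UNIV (\<lambda>y. complex_of_real (nker k Q x y) * apply_bcontfun g y)"
    by (rule continuous_on_slices(1)[OF c])
qed

lemma clinear_T:
  assumes "borel_prob Q"
  shows "clinear_op (T_op k Q)"
  unfolding clinear_op_def
proof (intro allI bcontfun_eqI)
  fix c g x
  have "(\<lambda>y. complex_of_real (nker k Q x y) * (c * apply_bcontfun g y)) =
    (\<lambda>y. c * (complex_of_real (nker k Q x y) * apply_bcontfun g y))" by (simp add: mult_ac)
  then show "apply_bcontfun (blinfun_apply (T_op k Q) (cscale c g)) x =
    apply_bcontfun (cscale c (blinfun_apply (T_op k Q) g)) x"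
    by (simp add: T_apply[OF assms])
qed

section \<open>Kernel estimates uniform in the measure\<close>

lemma k_bound: "\<exists>B>0. \<forall>x y. \<bar>k x y\<bar> \<le> B"
proof -
  have "compact ((\<lambda>(x, y). k x y) ` (UNIV \<times> UNIV))"
    using k_cont cpt by (intro compact_continuous_image compact_Times) auto
  then show ?thesis by (force dest!: compact_imp_bounded simp: bounded_pos)
qed

lemma k_equicontinuous:
  assumes "e > 0"
  shows "\<exists>d>0. \<forall>x x' y. dist x x' < d \<longrightarrow> \<bar>k x y - k x' y\<bar> \<le> e"
proof -
  have "uniformly_continuous_on (UNIV \<times> UNIV) (\<lambda>(x, y). k x y)"
    using k_cont cpt by (intro compact_uniformly_continuous compact_Times) auto
  then obtain d where d: "d > 0" "\<And>z z' :: 'a \<times> 'a. dist z' z < d \<Longrightarrow>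
      dist (case z' of (x, y) \<Rightarrow> k x y) (case z of (x, y) \<Rightarrow> k x y) < e"
    using assms unfolding uniformly_continuous_on_def by (metis UNIV_I UNIV_Times_UNIV)
  have "\<bar>k x y - k x' y\<bar> \<le> e" if "dist x x' < d" for x x' y
    using d(2)[of "(x, y)" "(x', y)"] that by (simp add: dist_Pair_Pair dist_real_def)
  with d(1) show ?thesis by blast
qed

lemma nker_eq: "nker k Q x y = k x y * (1 / sqrt (deg k Q x) * (1 / sqrt (deg k Q y)))"
  by (simp add: nker_def real_sqrt_mult)

lemma inverse_sqrt_deg_bounds:
  assumes "borel_prob Q"
  shows "0 \<le> 1 / sqrt (deg k Q x)" "1 / sqrt (deg k Q x) \<le> 1 / sqrt l"
  using deg_ge[OF assms, of x] l_pos by (auto intro!: divide_left_mono)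

lemma k_section_continuous: "continuous_on UNIV (k x)"
  by (rule continuous_on_slices(1)[OF k_cont])

text \<open>One estimate for two purposes: equal measures with different points give equicontinuity,
  equal points with different measures give convergence. The three factors of the kernel are changed
  one at a time; \<open>R * R = 1 / l\<close> bounds the unchanged pair, and the Lipschitz constant
  times \<open>R\<close> is \<open>1 / (l * l)\<close>.\<close>

lemma nker_difference:
  assumes Q: "borel_prob Q" and Q': "borel_prob Q'" and B: "\<And>x y. \<bar>k x y\<bar> \<le> B"
    and e: "\<bar>k x y - k x' y\<bar> \<le> e" "\<bar>deg k Q x - deg k Q' x'\<bar> \<le> e" "\<bar>deg k Q y - deg k Q' y\<bar> \<le> e"
  shows "\<bar>nker k Q x y - nker k Q' x' y\<bar> \<le> e * (1 / l + 2 * B / (l * l))"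
proof -
  define r where "r Q x = 1 / sqrt (deg k Q x)" for Q :: "'a measure" and x
  define R where "R = 1 / sqrt l"
  have nk: "nker k Q x y = k x y * (r Q x * r Q y)" for Q x y by (simp add: nker_eq r_def)
  have RR: "R * R = 1 / l" "R > 0" "R * (1 / (l * sqrt l)) = 1 / (l * l)"
    using l_pos by (auto simp: R_def field_simps)
  have "e \<ge> 0" "B \<ge> 0" using e(1) B[of x y] by linarith+
  have r: "0 \<le> r Q x" "r Q x \<le> R" "0 \<le> r Q' x" "r Q' x \<le> R" for x
    using inverse_sqrt_deg_bounds[OF Q, of x] inverse_sqrt_deg_bounds[OF Q', of x] by (auto simp: r_def R_def)
  have lip: "\<bar>r Q a - r Q' b\<bar> \<le> e / (l * sqrt l)" if "\<bar>deg k Q a - deg k Q' b\<bar> \<le> e" for a b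
    unfolding r_def using that l_pos
    by (intro order_trans[OF inverse_sqrt_lipschitz[OF l_pos deg_ge[OF Q] deg_ge[OF Q']]] divide_right_mono) auto
  have "nker k Q x y - nker k Q' x' y = (k x y - k x' y) * (r Q x * r Q y)
      + k x' y * ((r Q x - r Q' x') * r Q y) + k x' y * (r Q' x' * (r Q y - r Q' y))"
    unfolding nk by (simp add: algebra_simps)
  also have "\<bar>\<dots>\<bar> \<le> \<bar>k x y - k x' y\<bar> * (r Q x * r Q y)
      + \<bar>k x' y\<bar> * (\<bar>r Q x - r Q' x'\<bar> * r Q y) + \<bar>k x' y\<bar> * (r Q' x' * \<bar>r Q y - r Q' y\<bar>)"
    using r by (intro order_trans[OF abs_triangle_ineq] add_mono) (auto simp: abs_mult)
  also have "\<dots> \<le> e * (R * R) + B * (e / (l * sqrt l) * R) + B * (R * (e / (l * sqrt l)))"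
    using r e B lip[OF e(2)] lip[OF e(3)] RR(2) l_pos \<open>e \<ge> 0\<close> \<open>B \<ge> 0\<close>
    by (intro add_mono mult_mono) (auto intro!: mult_nonneg_nonneg divide_nonneg_nonneg)
  also have "\<dots> = e * (R * R) + 2 * B * e * (R * (1 / (l * sqrt l)))" by simp
  also have "\<dots> = e * (1 / l + 2 * B / (l * l))" unfolding RR by (simp add: algebra_simps)
  finally show ?thesis .
qed

text \<open>The degree inherits the modulus of continuity of \<open>k\<close>, because
  \<open>Q\<close> has total mass one; hence \<open>d\<close> can be chosen before
  \<open>Q\<close>.\<close>

lemma nker_equicontinuous:
  assumes "e > 0"
  shows "\<exists>d>0. \<forall>Q x x' y. borel_prob Q \<longrightarrow> dist x x' < d \<longrightarrow> \<bar>nker k Q x y - nker k Q x' y\<bar> \<le> e"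
proof -
  obtain B where B: "B > 0" "\<And>x y. \<bar>k x y\<bar> \<le> B" using k_bound by blast
  define c where "c = 1 / l + 2 * B / (l * l)"
  have "c > 0" using B(1) l_pos by (simp add: c_def add_pos_pos)
  then obtain d where d: "d > 0" "\<And>x x' y. dist x x' < d \<Longrightarrow> \<bar>k x y - k x' y\<bar> \<le> e / c"
    using k_equicontinuous[of "e / c"] assms by auto
  have "\<bar>nker k Q x y - nker k Q x' y\<bar> \<le> e" if "borel_prob Q" "dist x x' < d" for Q x x' y
  proof -
    have "\<bar>deg k Q x - deg k Q x'\<bar> \<le> e / c"
      using norm_integral_diff_le[OF that(1) k_section_continuous k_section_continuous, of x x' "e / c"] d(2)[OF that(2)]
      by (simp add: deg_def)
    moreover have "\<bar>deg k Q y - deg k Q y\<bar> \<le> e / c" using assms \<open>c > 0\<close> by simp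
    ultimately have "\<bar>nker k Q x y - nker k Q x' y\<bar> \<le> e / c * c"
      unfolding c_def by (intro nker_difference that(1) B(2) d(2)[OF that(2), unfolded c_def])
    with \<open>c > 0\<close> show ?thesis by simp
  qed
  with d(1) show ?thesis by blast
qed

lemma nker_bounded:
  assumes "borel_prob Q" and B: "\<And>x y. \<bar>k x y\<bar> \<le> B"
  shows "\<bar>nker k Q x y\<bar> \<le> B / l"
proof -
  have "B \<ge> 0" using B[of x y] by linarith
  have "\<bar>nker k Q x y\<bar> = \<bar>k x y\<bar> * (1 / sqrt (deg k Q x) * (1 / sqrt (deg k Q y)))"
    using inverse_sqrt_deg_bounds[OF assms(1)] by (simp add: nker_eq abs_mult)
  also have "\<dots> \<le> B * (1 / sqrt l * (1 / sqrt l))"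
    using inverse_sqrt_deg_bounds[OF assms(1)] B l_pos \<open>B \<ge> 0\<close>
    by (intro mult_mono) (auto intro!: mult_nonneg_nonneg)
  also have "\<dots> = B / l" using l_pos by simp
  finally show ?thesis .
qed

text \<open>The union is over all Borel probability measures, which gives a single compact set
  independent of the sample, of its size and of the distribution.\<close>

definition range_closure :: "('a \<Rightarrow>\<^sub>C complex) set" where
  "range_closure = closure {blinfun_apply (T_op k Q) g | Q g. borel_prob Q \<and> norm g \<le> 1}"

lemma T_in_range_closure:
  "borel_prob Q \<Longrightarrow> norm g \<le> 1 \<Longrightarrow> blinfun_apply (T_op k Q) g \<in> range_closure"
  unfolding range_closure_def by (rule subsetD[OF closure_subset]) blast

lemma norm_mult_bcontfun_le:
  assumes "\<bar>a\<bar> \<le> e"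
  shows "norm (complex_of_real a * apply_bcontfun g y) \<le> e * norm g"
  using mult_mono[OF assms norm_bounded[of g y]] assms abs_ge_zero[of a] by (simp add: norm_mult)

lemma compact_range_closure: "compact range_closure"
proof -
  obtain B where B: "B > 0" "\<And>x y. \<bar>k x y\<bar> \<le> B" using k_bound by blast
  show ?thesis unfolding range_closure_def
  proof (rule compact_closure_equicontinuous[OF cpt, of _ "B / l"])
    fix f assume "f \<in> {blinfun_apply (T_op k Q) g | Q g. borel_prob Q \<and> norm g \<le> 1}"
    then obtain Q g where f: "f = blinfun_apply (T_op k Q) g" "borel_prob Q" "norm g \<le> 1" by blast
    show "norm f \<le> B / l"
    proof (rule norm_bound)
      fix x
      have "norm (complex_of_real (nker k Q x y) * apply_bcontfun g y) \<le> B / l" for y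
        using f(3) B(1) l_pos
        by (intro order_trans[OF norm_mult_bcontfun_le[OF nker_bounded[OF f(2) B(2)]]] mult_left_le) auto
      then show "norm (apply_bcontfun f x) \<le> B / l"
        unfolding f(1) T_apply[OF f(2)] by (intro norm_integral_le[OF f(2)] integrand_continuous(2)[OF f(2)])
    qed
  next
    fix e :: real assume "e > 0"
    then obtain d where d: "d > 0"
      "\<And>Q x x' y. borel_prob Q \<Longrightarrow> dist x x' < d \<Longrightarrow> \<bar>nker k Q x y - nker k Q x' y\<bar> \<le> e"
      using nker_equicontinuous by blast
    have "dist (apply_bcontfun (blinfun_apply (T_op k Q) g) x) (apply_bcontfun (blinfun_apply (T_op k Q) g) x') \<le> e"
      if Q: "borel_prob Q" "norm g \<le> 1" and x: "dist x x' < d" for Q g x x'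
      unfolding T_apply[OF Q(1)] dist_norm
    proof (rule norm_integral_diff_le[OF Q(1) integrand_continuous(2)[OF Q(1)] integrand_continuous(2)[OF Q(1)]])
      fix y
      have "norm (complex_of_real (nker k Q x y - nker k Q x' y) * apply_bcontfun g y) \<le> e"
        using Q(2) \<open>e > 0\<close>
        by (intro order_trans[OF norm_mult_bcontfun_le[OF d(2)[OF Q(1) x]]] mult_left_le) auto
      then show "norm (complex_of_real (nker k Q x y) * apply_bcontfun g y -
        complex_of_real (nker k Q x' y) * apply_bcontfun g y) \<le> e" by (simp add: left_diff_distrib)
    qed
    with d(1) show "\<exists>d>0. \<forall>f\<in>{blinfun_apply (T_op k Q) g | Q g. borel_prob Q \<and> norm g \<le> 1}. \<forall>x y. dist x y < d \<longrightarrow>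
      dist (apply_bcontfun f x) (apply_bcontfun f y) \<le> e" by blast
  qed
qed

text \<open>Weak convergence is applied to finitely many sections \<open>F c\<close> only; every
  other section is within \<open>e'\<close> of one of them in sup norm, and integration against a
  probability measure preserves this. The three errors are \<open>e / 3\<close> each.\<close>

lemma uniform_weak_convergence:
  fixes F :: "'a \<Rightarrow> 'a \<Rightarrow> complex"
  assumes P: "borel_prob P"
    and weak: "\<And>g :: 'a \<Rightarrow> complex. continuous_on UNIV g \<Longrightarrow> (\<lambda>n. \<integral>y. g y \<partial>empirical x n) \<longlonglongrightarrow> (\<integral>y. g y \<partial>P)"
    and F: "continuous_on UNIV (\<lambda>(x, y). F x y)" and "e > 0"
  shows "\<forall>\<^sub>F n in sequentially. \<forall>z. norm ((\<integral>y. F z y \<partial>empirical x n) - (\<integral>y. F z y \<partial>P)) \<le> e"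
proof -
  define e' where "e' = e / 3"
  have "e' > 0" using \<open>e > 0\<close> by (simp add: e'_def)
  have "uniformly_continuous_on (UNIV \<times> UNIV) (\<lambda>(x, y). F x y)"
    using F cpt by (intro compact_uniformly_continuous compact_Times) auto
  then obtain d where d: "d > 0" "\<And>z z' :: 'a \<times> 'a. dist z' z < d \<Longrightarrow>
      dist (case z' of (x, y) \<Rightarrow> F x y) (case z of (x, y) \<Rightarrow> F x y) < e'"
    using \<open>e' > 0\<close> unfolding uniformly_continuous_on_def by (metis UNIV_I UNIV_Times_UNIV)
  have Fd: "norm (F z y - F z' y) \<le> e'" if "dist z z' < d" for z z' y
    using d(2)[of "(z, y)" "(z', y)"] that by (simp add: dist_Pair_Pair dist_norm)
  note Fc = continuous_on_slices(1)[OF F]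
  obtain K :: "'a set" where K: "finite K" "UNIV \<subseteq> (\<Union>c\<in>K. ball c d)"
    using cpt[unfolded compact_eq_totally_bounded, THEN conjunct2, rule_format, OF d(1)] by auto
  have "\<forall>\<^sub>F n in sequentially. \<forall>c\<in>K. norm ((\<integral>y. F c y \<partial>empirical x n) - (\<integral>y. F c y \<partial>P)) < e'"
    using K(1) \<open>e' > 0\<close>
    by (intro eventually_ball_finite ballI weak[OF Fc, unfolded tendsto_iff dist_norm, rule_format])
  then show ?thesis using eventually_gt_at_top[of 0]
  proof eventually_elim
    case (elim n)
    show ?case
    proof
      fix z
      obtain c where c: "c \<in> K" "dist z c < d"
        using subsetD[OF K(2) UNIV_I[of z]] by (auto simp: dist_commute)
      have "norm ((\<integral>y. F z y \<partial>empirical x n) - (\<integral>y. F c y \<partial>empirical x n)) \<le> e'"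
        by (intro norm_integral_diff_le borel_prob_empirical elim(2) Fc Fd c(2))
      moreover have "norm ((\<integral>y. F c y \<partial>empirical x n) - (\<integral>y. F c y \<partial>P)) < e'" using elim(1) c(1) by blast
      moreover have "norm ((\<integral>y. F z y \<partial>P) - (\<integral>y. F c y \<partial>P)) \<le> e'"
        by (intro norm_integral_diff_le P Fc Fd c(2))
      ultimately have "norm ((\<integral>y. F z y \<partial>empirical x n) - (\<integral>y. F z y \<partial>P)) \<le> e' + e' + e'"
        unfolding dist_norm[symmetric] by metric
      then show "norm ((\<integral>y. F z y \<partial>empirical x n) - (\<integral>y. F z y \<partial>P)) \<le> e" by (simp add: e'_def)
    qed
  qed
qed

text \<open>Two changes are separated: first the kernel, from the empirical degrees to the true
  ones, under the empirical integral; then the measure, with the continuous limit kernel held fixed.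
  Each costs \<open>e / 4\<close>, the first because \<open>\<delta> * c = e / 4\<close>.\<close>

lemma T_empirical_tendsto:
  assumes P: "borel_prob P"
    and weak: "\<And>g :: 'a \<Rightarrow> complex. continuous_on UNIV g \<Longrightarrow> (\<lambda>n. \<integral>y. g y \<partial>empirical x n) \<longlonglongrightarrow> (\<integral>y. g y \<partial>P)"
  shows "(\<lambda>n. blinfun_apply (T_op k (empirical x n)) g) \<longlonglongrightarrow> blinfun_apply (T_op k P) g"
proof (rule tendstoI)
  fix e :: real assume "e > 0"
  obtain B where B: "B > 0" "\<And>x y. \<bar>k x y\<bar> \<le> B" using k_bound by blast
  define c where "c = (1 / l + 2 * B / (l * l)) * (norm g + 1)"
  define \<delta> where "\<delta> = e / (4 * c)"
  have "c > 0" using B(1) l_pos unfolding c_def by (intro mult_pos_pos add_pos_pos add_nonneg_pos) auto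
  then have "\<delta> > 0" using \<open>e > 0\<close> by (simp add: \<delta>_def)
  have kc: "continuous_on UNIV (\<lambda>(x, y). complex_of_real (k x y))"
    using k_cont unfolding case_prod_beta by (rule continuous_on_of_real)
  have deg: "\<forall>\<^sub>F n in sequentially. \<forall>z. norm ((\<integral>y. complex_of_real (k z y) \<partial>empirical x n) - (\<integral>y. complex_of_real (k z y) \<partial>P)) \<le> \<delta>"
    by (rule uniform_weak_convergence[OF P weak kc \<open>\<delta> > 0\<close>])
  have ker: "\<forall>\<^sub>F n in sequentially. \<forall>z. norm ((\<integral>y. complex_of_real (nker k P z y) * apply_bcontfun g y \<partial>empirical x n)
      - (\<integral>y. complex_of_real (nker k P z y) * apply_bcontfun g y \<partial>P)) \<le> e / 4"
    by (rule uniform_weak_convergence[OF P weak integrand_continuous(1)[OF P]]) (use \<open>e > 0\<close> in auto)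
  from deg ker eventually_gt_at_top[of 0]
  show "\<forall>\<^sub>F n in sequentially. dist (blinfun_apply (T_op k (empirical x n)) g) (blinfun_apply (T_op k P) g) < e"
  proof eventually_elim
    case (elim n)
    let ?Q = "empirical x n"
    have Q: "borel_prob ?Q" using elim(3) by (rule borel_prob_empirical)
    have deg': "\<bar>deg k ?Q z - deg k P z\<bar> \<le> \<delta>" for z
      using elim(1)[rule_format, of z] unfolding integral_complex_of_real deg_def
      by (metis norm_of_real of_real_diff)
    have "dist (blinfun_apply (T_op k ?Q) g) (blinfun_apply (T_op k P) g) \<le> e / 2"
    proof (rule dist_bound)
      fix z
      have "norm (apply_bcontfun (blinfun_apply (T_op k ?Q) g) z -
          (\<integral>y. complex_of_real (nker k P z y) * apply_bcontfun g y \<partial>?Q)) \<le> e / 4"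
        unfolding T_apply[OF Q]
      proof (rule norm_integral_diff_le[OF Q integrand_continuous(2)[OF Q] integrand_continuous(2)[OF P]])
        fix y
        have "norm (complex_of_real (nker k ?Q z y - nker k P z y) * apply_bcontfun g y) \<le>
            \<delta> * (1 / l + 2 * B / (l * l)) * norm g"
          using deg' \<open>\<delta> > 0\<close> by (intro norm_mult_bcontfun_le nker_difference Q P B(2)) auto
        also have "\<dots> \<le> \<delta> * c"
          using \<open>\<delta> > 0\<close> B(1) l_pos unfolding c_def mult.assoc by (intro mult_left_mono) auto
        also have "\<dots> = e / 4" using \<open>c > 0\<close> by (simp add: \<delta>_def)
        finally show "norm (complex_of_real (nker k ?Q z y) * apply_bcontfun g y -
            complex_of_real (nker k P z y) * apply_bcontfun g y) \<le> e / 4"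
          by (simp add: left_diff_distrib)
      qed
      moreover have "norm ((\<integral>y. complex_of_real (nker k P z y) * apply_bcontfun g y \<partial>?Q)
          - apply_bcontfun (blinfun_apply (T_op k P) g) z) \<le> e / 4"
        unfolding T_apply[OF P] using elim(2) by blast
      ultimately show "dist (apply_bcontfun (blinfun_apply (T_op k ?Q) g) z) (apply_bcontfun (blinfun_apply (T_op k P) g) z) \<le> e / 2"
        unfolding dist_norm[symmetric] by metric
    qed
    then show ?case using \<open>e > 0\<close> by simp
  qed
qed

text \<open>The constant sequence makes the results on sequences available for a single
  operator.\<close>

lemma collectively_compact_const:
  assumes "borel_prob Q"
  shows "collectively_compact (\<lambda>_. T_op k Q) (T_op k Q) range_closure"
  using assms by unfold_locales (auto intro: compact_range_closure T_in_range_closure clinear_T)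

lemma collectively_compact_empirical:
  assumes P: "borel_prob P"
    and weak: "\<And>g :: 'a \<Rightarrow> complex. continuous_on UNIV g \<Longrightarrow> (\<lambda>n. \<integral>y. g y \<partial>empirical x n) \<longlonglongrightarrow> (\<integral>y. g y \<partial>P)"
  shows "collectively_compact (\<lambda>n. T_op k (empirical x n)) (T_op k P) range_closure"
  using P by unfold_locales
    (auto intro: compact_range_closure T_in_range_closure clinear_T borel_prob_empirical T_empirical_tendsto weak)

end

section \<open>Empirical operators and Laplacian matrices\<close>

context similarity
begin

lemma T_empirical_apply:
  assumes "n > 0"
  shows "apply_bcontfun (blinfun_apply (T_op k (empirical x n)) g) y =
    (\<Sum>j<n. complex_of_real (nker k (empirical x n) y (x j)) * apply_bcontfun g (x j)) / of_nat n"
  using integral_empirical[OF borel_measurable_continuous_onI[OF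
        integrand_continuous(2)[OF borel_prob_empirical[OF assms], of x y g]], of x n]
  by (simp add: T_apply[OF borel_prob_empirical[OF assms]] scaleR_conv_of_real divide_inverse mult.commute)

lemma deg_empirical: "deg k (empirical x n) y = (\<Sum>j<n. k y (x j)) / real n"
  using integral_empirical[OF borel_measurable_continuous_onI[OF k_section_continuous], of x n y]
  by (simp add: deg_def divide_inverse mult.commute)

lemma lap_mat_carrier: "lap_mat k x n \<in> carrier_mat n n"
  unfolding lap_mat_def sim_mat_def by (intro minus_carrier_mat) simp

lemma nlap_mat_carrier: "nlap_mat k x n \<in> carrier_mat n n"
  unfolding nlap_mat_def deg_mat_inv_sqrt_def
  by (intro mult_carrier_mat[of _ n n] mat_diag_dim lap_mat_carrier)

lemma nlap_cmat_carrier: "nlap_cmat k x n \<in> carrier_mat n n"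
  unfolding nlap_cmat_def using nlap_mat_carrier by simp

text \<open>The matrix normalises by sums and the kernel by averages; as \<open>deg\<close> is the
  sum divided by \<open>n\<close>, the factor \<open>1 / n\<close> in front of \<open>nker\<close>
  is exactly what makes the entries agree.\<close>

lemma nlap_cmat_index:
  assumes "i < n" "j < n"
  shows "nlap_cmat k x n $$ (i, j) =
    (if i = j then 1 else 0) - complex_of_real (nker k (empirical x n) (x i) (x j)) / of_nat n"
proof -
  define S where "S i = (\<Sum>j<n. k (x i) (x j))" for i
  have S: "S i > 0" for i
    unfolding S_def using assms(1) k_gt l_pos by (intro sum_pos) (auto intro: less_trans)
  have "nlap_mat k x n $$ (i, j) = 1 / sqrt (S i) * lap_mat k x n $$ (i, j) * (1 / sqrt (S j))"
    unfolding nlap_mat_def deg_mat_inv_sqrt_def S_def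
    by (subst mat_diag_mult_right[of _ n n], intro mult_carrier_mat[of _ n n] mat_diag_dim lap_mat_carrier, subst mat_diag_mult_left[OF lap_mat_carrier], simp add: assms)
  moreover have "lap_mat k x n $$ (i, j) = (if i = j then S i else 0) - k (x i) (x j)"
    using assms by (simp add: lap_mat_def deg_mat_def sim_mat_def mat_diag_def S_def)
  moreover have "nker k (empirical x n) (x i) (x j) / real n = k (x i) (x j) / (sqrt (S i) * sqrt (S j))"
    using assms(1) by (simp add: nker_def deg_empirical S_def real_sqrt_mult real_sqrt_divide)
  ultimately have "nlap_mat k x n $$ (i, j) =
      (if i = j then 1 else 0) - nker k (empirical x n) (x i) (x j) / real n"
    using S[of j] by (cases "i = j") (simp_all add: diff_divide_distrib)
  then have "complex_of_real (nlap_mat k x n $$ (i, j)) =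
      (if i = j then 1 else 0) - complex_of_real (nker k (empirical x n) (x i) (x j)) / of_nat n"
    by simp
  then show ?thesis using assms carrier_matD[OF nlap_mat_carrier[of x n]] by (simp add: nlap_cmat_def)
qed

lemma nlap_cmat_mult_vec:
  assumes "v \<in> carrier_vec n" "i < n"
  shows "(nlap_cmat k x n *\<^sub>v v) $ i =
    v $ i - (\<Sum>j<n. complex_of_real (nker k (empirical x n) (x i) (x j)) * v $ j) / of_nat n"
proof -
  have "(nlap_cmat k x n *\<^sub>v v) $ i = (\<Sum>j<n. nlap_cmat k x n $$ (i, j) * v $ j)"
    using assms nlap_cmat_carrier[of x n]
    by (auto simp: scalar_prod_def atLeast0LessThan intro!: sum.cong)
  also have "\<dots> = (\<Sum>j<n. (if i = j then v $ j else 0)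
      - complex_of_real (nker k (empirical x n) (x i) (x j)) * v $ j / of_nat n)"
    using assms(2) by (intro sum.cong) (auto simp: nlap_cmat_index left_diff_distrib)
  also have "\<dots> = v $ i - (\<Sum>j<n. complex_of_real (nker k (empirical x n) (x i) (x j)) * v $ j) / of_nat n"
    using assms(2) by (simp add: sum_subtractf sum_divide_distrib)
  finally show ?thesis .
qed

text \<open>The Nystrom extension without its scalar factor: the common image under
  \<open>T_n\<close> of all functions with sample values \<open>v\<close>. For an eigenvector with
  eigenvalue \<open>z\<close> it is \<open>1 - z\<close> times \<open>v\<close> on the
  sample.\<close>

definition extension :: "(nat \<Rightarrow> 'a) \<Rightarrow> nat \<Rightarrow> complex vec \<Rightarrow> ('a \<Rightarrow>\<^sub>C complex)" where
  "extension x n v = Bcontfun (\<lambda>y. (\<Sum>j<n. complex_of_real (nker k (empirical x n) y (x j)) * v $ j) / of_nat n)"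

lemma apply_extension:
  assumes "n > 0"
  shows "apply_bcontfun (extension x n v) y =
    (\<Sum>j<n. complex_of_real (nker k (empirical x n) y (x j)) * v $ j) / of_nat n"
proof -
  have "continuous_on UNIV (\<lambda>y. (\<Sum>j<n. complex_of_real (nker k (empirical x n) y (x j)) * v $ j) / of_nat n)"
    using assms
    by (intro continuous_intros continuous_on_slices(2)[OF nker_continuous[OF borel_prob_empirical]]) auto
  then show ?thesis
    unfolding extension_def by (subst Bcontfun_inverse[OF compact_bcontfun[OF cpt]]) auto
qed

lemma T_empirical_eq_extension:
  fixes v :: "complex vec"
  assumes "n > 0" "\<And>j. j < n \<Longrightarrow> v $ j = apply_bcontfun g (x j)"
  shows "blinfun_apply (T_op k (empirical x n)) g = extension x n v"
  by (rule bcontfun_eqI) (simp add: T_empirical_apply apply_extension assms)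

lemma nlap_cmat_mult_vec_extension:
  assumes "n > 0" "v \<in> carrier_vec n" "i < n"
  shows "(nlap_cmat k x n *\<^sub>v v) $ i = v $ i - apply_bcontfun (extension x n v) (x i)"
  using assms by (simp add: nlap_cmat_mult_vec apply_extension)

text \<open>Extension and restriction to the sample are inverse up to the factor
  \<open>1 - z\<close>. If an eigenfunction vanished on the sample, its image under
  \<open>T_n\<close> would vanish, hence so would \<open>1 - z\<close> times the function
  itself.\<close>

lemma eigenvalue_iff_op_eigenvalue:
  assumes n: "n > 0" and z: "z \<noteq> 1"
  shows "eigenvalue (nlap_cmat k x n) z \<longleftrightarrow> op_eigenvalue (U_op k (empirical x n)) z"
proof
  note dim = carrier_matD(1)[OF nlap_cmat_carrier]
  assume "eigenvalue (nlap_cmat k x n) z"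
  then obtain v where v: "v \<in> carrier_vec n" "v \<noteq> 0\<^sub>v n" "nlap_cmat k x n *\<^sub>v v = z \<cdot>\<^sub>v v"
    by (auto simp: eigenvalue_def eigenvector_def dim)
  let ?h = "extension x n v"
  have h: "apply_bcontfun ?h (x i) = (1 - z) * v $ i" if "i < n" for i
    using nlap_cmat_mult_vec_extension[OF n v(1) that, of x] that v(1) by (simp add: v(3) left_diff_distrib)
  have "blinfun_apply (T_op k (empirical x n)) ?h = extension x n ((1 - z) \<cdot>\<^sub>v v)"
    using v(1) by (intro T_empirical_eq_extension n) (simp add: h)
  also have "\<dots> = cscale (1 - z) ?h"
    using v(1) by (intro bcontfun_eqI) (simp add: apply_extension[OF n] sum_distrib_left mult_ac)
  finally have "blinfun_apply (U_op k (empirical x n)) ?h = cscale z ?h"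
    by (simp add: U_op_def blinfun.diff_left cscale.diff_left)
  moreover have "?h \<noteq> 0"
  proof
    assume "?h = 0"
    with h z have "v $ i = 0" if "i < n" for i using that by force
    with v(1,2) show False by (metis carrier_vecD eq_vecI index_zero_vec)
  qed
  ultimately show "op_eigenvalue (U_op k (empirical x n)) z"
    by (auto simp: op_eigenvalue_def eigenfunction_def)
next
  note dim = carrier_matD(1)[OF nlap_cmat_carrier]
  assume "op_eigenvalue (U_op k (empirical x n)) z"
  then obtain h where h: "h \<noteq> 0" "h - blinfun_apply (T_op k (empirical x n)) h = cscale z h"
    by (auto simp: op_eigenvalue_def eigenfunction_def U_op_def blinfun.diff_left)
  define v where "v = vec n (\<lambda>i. apply_bcontfun h (x i))"
  have v: "v \<in> carrier_vec n" "\<And>i. i < n \<Longrightarrow> v $ i = apply_bcontfun h (x i)" by (auto simp: v_def)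
  have ext: "blinfun_apply (T_op k (empirical x n)) h = extension x n v"
    by (rule T_empirical_eq_extension) (simp_all add: n v)
  have "nlap_cmat k x n *\<^sub>v v = z \<cdot>\<^sub>v v"
  proof (rule eq_vecI)
    fix i assume "i < dim_vec (z \<cdot>\<^sub>v v)"
    then have i: "i < n" using v(1) by simp
    have "apply_bcontfun h (x i) - apply_bcontfun (extension x n v) (x i) = z * apply_bcontfun h (x i)"
      using arg_cong[OF h(2), of "\<lambda>f. apply_bcontfun f (x i)"] by (simp add: ext minus_bcontfun.rep_eq)
    then show "(nlap_cmat k x n *\<^sub>v v) $ i = (z \<cdot>\<^sub>v v) $ i"
      using i v(1) by (simp add: nlap_cmat_mult_vec_extension[OF n v(1) i] v(2))
  qed (simp add: v_def dim)
  moreover have "v \<noteq> 0\<^sub>v n"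
  proof
    assume "v = 0\<^sub>v n"
    then have "extension x n v = 0" by (intro bcontfun_eqI) (simp add: apply_extension[OF n])
    then have "cscale (1 - z) h = 0" using h(2) ext by (simp add: cscale.diff_left)
    then have "norm (cscale (1 - z) h) = 0" by simp
    with z h(1) show False by (simp add: norm_cscale)
  qed
  ultimately show "eigenvalue (nlap_cmat k x n) z"
    using v(1) by (auto simp: eigenvalue_def eigenvector_def dim)
qed

text \<open>If \<open>z\<close> is no eigenvalue, injectivity gives a lower bound through
  compactness, and the invertible matrix gives surjectivity: the equation for \<open>f\<close> is
  solved first at the sample points and then everywhere.\<close>

lemma spectrum_U_empirical:
  assumes n: "n > 0" and z: "z \<noteq> 1" "z \<in> op_spectrum (U_op k (empirical x n))"
  shows "eigenvalue (nlap_cmat k x n) z"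
proof (rule ccontr)
  assume no: "\<not> eigenvalue (nlap_cmat k x n) z"
  let ?T = "T_op k (empirical x n)" and ?A = "char_matrix (nlap_cmat k x n) z"
  interpret Tn: collectively_compact "\<lambda>_. ?T" ?T range_closure
    by (rule collectively_compact_const[OF borel_prob_empirical[OF n]])
  have "\<not> op_eigenvalue (id_blinfun - ?T) z"
    using no eigenvalue_iff_op_eigenvalue[OF n z(1)] by (simp add: U_op_def)
  then obtain c where c: "c > 0" "\<And>f. c * norm f \<le> norm (blinfun_apply (id_blinfun - ?T - cscale_op z) f)"
    using Tn.uniformly_bounded_below[of "{z}"] z(1) by auto
  have A: "?A \<in> carrier_mat n n" using nlap_cmat_carrier by simp
  have "det ?A \<noteq> 0" using no eigenvalue_det[OF nlap_cmat_carrier] by blast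
  then obtain B where B: "B \<in> carrier_mat n n" "?A * B = 1\<^sub>m n"
    using det_non_zero_imp_unit[OF A] by (auto simp: Units_def ring_mat_def)
  have "\<exists>f. g = blinfun_apply (id_blinfun - ?T - cscale_op z) f" for g
  proof -
    define u where "u = vec n (\<lambda>i. apply_bcontfun g (x i))"
    define w where "w = B *\<^sub>v u"
    have w: "w \<in> carrier_vec n" using B(1) by (simp add: w_def u_def)
    have "?A *\<^sub>v w = u"
      unfolding w_def using A B by (subst assoc_mult_mat_vec[symmetric]) (auto simp: u_def)
    moreover have "?A *\<^sub>v w = nlap_cmat k x n *\<^sub>v w - z \<cdot>\<^sub>v w"
      using w nlap_cmat_carrier[of x n] unfolding char_matrix_def
      by (subst add_mult_distrib_mat_vec[of _ n n]) (auto intro!: eq_vecI)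
    ultimately have "w $ i - apply_bcontfun (extension x n w) (x i) - z * w $ i = apply_bcontfun g (x i)" if "i < n" for i
      using that w nlap_cmat_mult_vec_extension[OF n w that, of x] nlap_cmat_carrier[of x n]
      by (auto simp: u_def dest!: arg_cong[of _ _ "\<lambda>v :: complex vec. v $ i"])
    then have sol: "(1 - z) * w $ i = apply_bcontfun g (x i) + apply_bcontfun (extension x n w) (x i)" if "i < n" for i
      using that by (simp add: algebra_simps)
    \<comment> \<open>The equation reads \<open>(1 - z) f = g + T_n f\<close>, and
      \<open>T_n f\<close> is known once the sample values of \<open>f\<close> are. The matrix
      equation ensures that these are indeed \<open>w\<close>, which closes the circle.\<close>
    define f where "f = cscale (1 / (1 - z)) (g + extension x n w)"
    have "w $ i = apply_bcontfun f (x i)" if "i < n" for i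
      using sol[OF that] z(1) by (simp add: f_def plus_bcontfun.rep_eq flip: sol[OF that])
    then have Tf: "blinfun_apply ?T f = extension x n w" by (rule T_empirical_eq_extension[OF n])
    have "cscale (1 - z) f = g + extension x n w"
      using z(1) by (intro bcontfun_eqI) (simp add: f_def)
    then have "g = f - extension x n w - cscale z f"
      by (simp add: cscale.diff_left algebra_simps)
    then show ?thesis by (intro exI[of _ f]) (simp add: blinfun.diff_left Tf)
  qed
  then have "surj (blinfun_apply (id_blinfun - ?T - cscale_op z))" unfolding surj_def by blast
  from inverse_op_if_bounded_below[OF c this] z(2) show False
    by (simp add: op_spectrum_def U_op_def)
qed

end

section \<open>Almost sure weak convergence of the empirical measures\<close>

text \<open>The law of large numbers for one fixed set: relative frequencies are averages of
  independent variables with values in \<open>[0, 1]\<close>.\<close>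

lemma AE_frequency_tendsto:
  fixes X :: "nat \<Rightarrow> 'w \<Rightarrow> 'a::topological_space"
  assumes \<Omega>: "prob_space \<Omega>" and ind: "prob_space.indep_vars \<Omega> (\<lambda>_. borel) X UNIV"
    and X: "\<And>i. distr \<Omega> borel (X i) = P" and B: "B \<in> sets borel"
  shows "AE \<omega> in \<Omega>. (\<lambda>n. (\<Sum>i<n. indicat_real B (X i \<omega>)) / real n) \<longlonglongrightarrow> measure P B"
proof -
  interpret prob_space \<Omega> by fact
  define Y where "Y i \<omega> = indicat_real B (X i \<omega>)" for i \<omega>
  have X_rv: "random_variable borel (X i)" for i
    using ind unfolding indep_vars_def by auto
  have ind_B: "indicat_real B \<in> borel_measurable borel" using B by simp
  have Y_rv: "random_variable borel (Y i)" for i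
    unfolding Y_def[abs_def] using measurable_compose[OF X_rv ind_B] .
  have Y_ind: "indep_vars (\<lambda>_. borel) Y UNIV"
    unfolding Y_def[abs_def] using indep_vars_compose2[OF ind, of "\<lambda>_. indicat_real B"] ind_B by simp
  have Y_distr: "distr \<Omega> borel (Y i) = distr P borel (indicat_real B)" for i
    using distr_distr[OF ind_B X_rv, of i] by (simp add: X Y_def[abs_def] o_def)
  have mean: "expectation (Y 0) = measure P B"
  proof -
    have "expectation (Y 0) = (\<integral>x. indicat_real B x \<partial>distr \<Omega> borel (X 0))"
      unfolding Y_def using integral_distr[OF X_rv ind_B] by simp
    also have "\<dots> = measure P B"
    proof -
      have "sets P = sets borel" "space P = UNIV" using X[of 0] by auto
      with B show ?thesis unfolding X by simp
    qed
    finally show ?thesis .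
  qed
  have "AE \<omega> in \<Omega>. \<forall>\<^sub>F n in sequentially. \<bar>(\<Sum>i<n. Y i \<omega>) / real n - measure P B\<bar> < e" if "e > 0" for e
  proof -
    define A where "A n = {\<omega> \<in> space \<Omega>. \<bar>(\<Sum>i<n. Y i \<omega>) / real n - measure P B\<bar> \<ge> e}" for n
    have A_ev: "A n \<in> events" for n
      unfolding A_def using Y_rv by measurable
    \<comment> \<open>Written as a geometric sequence so that summability is immediate;
      \<open>n = 0\<close> is left out because Hoeffding's inequality is applied to a nonempty
      family.\<close>
    have bound: "prob (A n) \<le> 2 * exp (-2 * e\<^sup>2) ^ n" if "n \<ge> 1" for n
    proof -
      interpret Hoeffding_ineq_iid \<Omega> "{..<n}" Y "Y 0" 0 1 "expectation (Y 0)"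
        by unfold_locales
          (auto intro!: indep_vars_subset[OF Y_ind] Y_rv AE_I2 simp: Y_distr, auto simp: Y_def)
      have "prob (A n) \<le> 2 * exp (-2 * real n * e\<^sup>2)"
        using Hoeffding_ineq_abs_ge'[of e] that \<open>e > 0\<close> by (auto simp: A_def mean lessThan_empty_iff)
      also have "exp (-2 * real n * e\<^sup>2) = exp (-2 * e\<^sup>2) ^ n"
        by (simp add: exp_of_nat_mult[symmetric] mult_ac)
      finally show ?thesis .
    qed
    have "summable (\<lambda>n. prob (A n))"
    proof (rule summable_comparison_test')
      show "summable (\<lambda>n. 2 * exp (-2 * e\<^sup>2) ^ n)"
        using \<open>e > 0\<close> by (intro summable_mult summable_geometric) simp
      show "norm (prob (A n)) \<le> 2 * exp (-2 * e\<^sup>2) ^ n" if "n \<ge> 1" for n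
        using bound[OF that] by simp
    qed
    then have "AE \<omega> in \<Omega>. \<forall>\<^sub>F n in sequentially. \<omega> \<in> space \<Omega> - A n"
      by (intro borel_cantelli_AE1 A_ev) (auto simp: emeasure_eq_measure)
    then show ?thesis
      by eventually_elim (auto simp: A_def not_le elim: eventually_mono)
  qed
  \<comment> \<open>The null set depends on \<open>e\<close>, so only the countably many values
    \<open>1 / (q + 1)\<close> are intersected.\<close>
  then have "AE \<omega> in \<Omega>. \<forall>q. \<forall>\<^sub>F n in sequentially.
      \<bar>(\<Sum>i<n. Y i \<omega>) / real n - measure P B\<bar> < inverse (real (Suc q))"
    unfolding AE_all_countable by simp
  then show ?thesis
  proof eventually_elim
    case (elim \<omega>)
    show ?case
    proof (rule tendstoI)
      fix e :: real assume "e > 0"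
      then obtain q where q: "inverse (real (Suc q)) < e" using reals_Archimedean by blast
      from elim[rule_format, of q]
      show "\<forall>\<^sub>F n in sequentially. dist ((\<Sum>i<n. indicat_real B (X i \<omega>)) / real n) (measure P B) < e"
        by eventually_elim (use q in \<open>auto simp: Y_def dist_real_def\<close>)
    qed
  qed
qed

text \<open>The finitely many covering balls are made disjoint. The cells form an infinite sequence,
  but those from index \<open>N\<close> on are empty, since the first \<open>N\<close> balls already
  cover.\<close>

lemma small_borel_partition:
  fixes e :: real
  assumes cpt: "compact (UNIV :: 'a::metric_space set)" and "e > 0"
  shows "\<exists>(N :: nat) (c :: nat \<Rightarrow> 'a) B. (\<forall>j. B j \<in> sets borel) \<and> disjoint_family B \<and>
    (\<forall>x. \<exists>j<N. x \<in> B j) \<and> (\<forall>j. \<forall>x\<in>B j. dist (c j) x < e)"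
proof -
  obtain F :: "'a set" where F: "finite F" "UNIV \<subseteq> (\<Union>c\<in>F. ball c e)"
    using cpt[unfolded compact_eq_totally_bounded, THEN conjunct2, rule_format, OF \<open>e > 0\<close>] by auto
  obtain N and c :: "nat \<Rightarrow> 'a" where c: "F = c ` {i. i < N}"
    using F(1) unfolding finite_conv_nat_seg_image by blast
  define B where "B = disjointed (\<lambda>j. ball (c j) e)"
  have "\<exists>j<N. x \<in> B j" for x
  proof -
    obtain i where "i < N" "x \<in> ball (c i) e" using subsetD[OF F(2) UNIV_I[of x]] c by auto
    then have "x \<in> (\<Union>i\<in>{0..<N}. ball (c i) e)" by auto
    then have "x \<in> (\<Union>i\<in>{0..<N}. B i)" unfolding B_def finite_UN_disjointed_eq .
    then show ?thesis by auto
  qed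
  moreover have "\<forall>j. \<forall>x\<in>B j. dist (c j) x < e" by (auto simp: B_def disjointed_def)
  moreover have "\<forall>j. B j \<in> sets borel" by (auto simp: B_def disjointed_def)
  moreover have "disjoint_family B" unfolding B_def by (rule disjoint_family_disjointed)
  ultimately show ?thesis by blast
qed

text \<open>Applied with the same cells and values to the empirical measure and to the limit; only
  the weights \<open>measure Q (B j)\<close> differ.\<close>

lemma step_function_approximation:
  fixes g :: "'a::metric_space \<Rightarrow> 'b::{banach, second_countable_topology}" and N :: nat
  assumes cpt: "compact (UNIV :: 'a set)" and Q: "borel_prob Q" and g: "continuous_on UNIV g"
    and B: "\<And>j. B j \<in> sets borel" "disjoint_family B" "\<And>x. \<exists>j<N. x \<in> B j"
    and e: "\<And>j x. x \<in> B j \<Longrightarrow> norm (g x - g (c j)) \<le> e"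
  shows "norm ((\<integral>x. g x \<partial>Q) - (\<Sum>j<N. measure Q (B j) *\<^sub>R g (c j))) \<le> e"
proof -
  interpret prob_space Q using Q by (simp add: borel_prob_def)
  have sets: "B j \<in> sets Q" for j using B(1) Q by (simp add: borel_prob_def)
  have int: "integrable Q (\<lambda>x. \<Sum>j<N. indicat_real (B j) x *\<^sub>R g (c j))"
    by (intro Bochner_Integration.integrable_sum integrable_scaleR_left) (simp add: sets emeasure_eq_measure)
  have "(\<integral>x. (\<Sum>j<N. indicat_real (B j) x *\<^sub>R g (c j)) \<partial>Q) = (\<Sum>j<N. measure Q (B j) *\<^sub>R g (c j))"
    using sets sets_eq_imp_space_eq[of Q borel] Q
    by (subst Bochner_Integration.integral_sum)
      (auto simp: borel_prob_def emeasure_eq_measure intro!: integrable_scaleR_left)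
  then have "(\<integral>x. g x \<partial>Q) - (\<Sum>j<N. measure Q (B j) *\<^sub>R g (c j)) =
      (\<integral>x. g x - (\<Sum>j<N. indicat_real (B j) x *\<^sub>R g (c j)) \<partial>Q)"
    using compact_integrable[OF cpt Q g] int by simp
  also have "norm \<dots> \<le> (\<integral>x. norm (g x - (\<Sum>j<N. indicat_real (B j) x *\<^sub>R g (c j))) \<partial>Q)"
    by (rule integral_norm_bound)
  also have "\<dots> \<le> (\<integral>x. e \<partial>Q)"
  proof (rule integral_mono)
    show "integrable Q (\<lambda>x. norm (g x - (\<Sum>j<N. indicat_real (B j) x *\<^sub>R g (c j))))"
      using compact_integrable[OF cpt Q g] int by simp
    fix x
    obtain i where i: "i < N" "x \<in> B i" using B(3) by blast
    have "indicat_real (B j) x *\<^sub>R g (c j) = (if i = j then g (c j) else 0)" for j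
      using i(2) B(2) by (auto simp: disjoint_family_on_def indicator_def)
    then have "(\<Sum>j<N. indicat_real (B j) x *\<^sub>R g (c j)) = g (c i)" using i(1) by simp
    then show "norm (g x - (\<Sum>j<N. indicat_real (B j) x *\<^sub>R g (c j))) \<le> e" using e[OF i(2)] by simp
  qed simp
  finally show ?thesis by (simp add: prob_space)
qed

text \<open>The null set must be fixed before \<open>g\<close>, and there are uncountably many
  \<open>g\<close>. Countably many cells, one partition for each mesh \<open>1 / (m + 1)\<close>,
  determine the event; the mesh is then chosen from the uniform continuity of
  \<open>g\<close>.\<close>

lemma AE_empirical_weak_convergence:
  fixes X :: "nat \<Rightarrow> 'w \<Rightarrow> 'a::metric_space"
  assumes cpt: "compact (UNIV :: 'a set)" and P: "borel_prob P"
    and \<Omega>: "prob_space \<Omega>" and ind: "prob_space.indep_vars \<Omega> (\<lambda>_. borel) X UNIV"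
    and X: "\<And>i. distr \<Omega> borel (X i) = P"
  shows "AE \<omega> in \<Omega>. \<forall>g :: 'a \<Rightarrow> complex. continuous_on UNIV g \<longrightarrow>
    (\<lambda>n. \<integral>y. g y \<partial>empirical (\<lambda>i. X i \<omega>) n) \<longlonglongrightarrow> (\<integral>y. g y \<partial>P)"
proof -
  have "\<forall>m. \<exists>(N :: nat) (c :: nat \<Rightarrow> 'a) B. (\<forall>j. B j \<in> sets borel) \<and> disjoint_family B \<and>
    (\<forall>x. \<exists>j<N. x \<in> B j) \<and> (\<forall>j. \<forall>x\<in>B j. dist (c j) x < inverse (real (Suc m)))"
    using small_borel_partition[OF cpt] by simp
  then obtain N :: "nat \<Rightarrow> nat" and c :: "nat \<Rightarrow> nat \<Rightarrow> 'a" and B where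
    B: "\<And>m j. B m j \<in> sets borel" "\<And>m. disjoint_family (B m)" "\<And>m x. \<exists>j<N m. x \<in> B m j"
      "\<And>m j x. x \<in> B m j \<Longrightarrow> dist (c m j) x < inverse (real (Suc m))"
    by metis
  have "AE \<omega> in \<Omega>. \<forall>m j. (\<lambda>n. (\<Sum>i<n. indicat_real (B m j) (X i \<omega>)) / real n) \<longlonglongrightarrow> measure P (B m j)"
    unfolding AE_all_countable using AE_frequency_tendsto[OF \<Omega> ind X B(1)] by simp
  then show ?thesis
  proof eventually_elim
    case (elim \<omega>)
    let ?Q = "\<lambda>n. empirical (\<lambda>i. X i \<omega>) n"
    have freq: "(\<lambda>n. measure (?Q n) (B m j)) \<longlonglongrightarrow> measure P (B m j)" for m j
    proof -
      have "measure (?Q n) (B m j) = (\<Sum>i<n. indicat_real (B m j) (X i \<omega>)) / real n" for n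
        using integral_empirical[of "indicat_real (B m j)" "\<lambda>i. X i \<omega>" n] B(1)[of m j]
        by (simp add: divide_inverse mult.commute) (simp add: empirical_def)
      then show ?thesis using elim by simp
    qed
    show ?case
    proof (intro allI impI tendstoI)
      fix g :: "'a \<Rightarrow> complex" and e :: real assume g: "continuous_on UNIV g" and "e > 0"
      define e' where "e' = e / 4"
      have "e' > 0" using \<open>e > 0\<close> by (simp add: e'_def)
      obtain d where d: "d > 0" "\<And>x y. dist y x < d \<Longrightarrow> dist (g y) (g x) < e'"
        using compact_uniformly_continuous[OF g cpt] \<open>e' > 0\<close> unfolding uniformly_continuous_on_def by (metis UNIV_I)
      obtain m where m: "inverse (real (Suc m)) < d" using reals_Archimedean[OF d(1)] by blast
      have gB: "norm (g x - g (c m j)) \<le> e'" if "x \<in> B m j" for j x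
        using d(2)[of x "c m j"] B(4)[OF that] m by (simp add: dist_norm dist_commute less_imp_le)
      note approx = step_function_approximation[OF cpt _ g B(1-3), where e = e' and c = "c m", OF _ gB]
      have "(\<lambda>n. \<Sum>j<N m. measure (?Q n) (B m j) *\<^sub>R g (c m j)) \<longlonglongrightarrow> (\<Sum>j<N m. measure P (B m j) *\<^sub>R g (c m j))"
        by (intro tendsto_sum tendsto_scaleR freq tendsto_const)
      then have "\<forall>\<^sub>F n in sequentially. dist (\<Sum>j<N m. measure (?Q n) (B m j) *\<^sub>R g (c m j))
          (\<Sum>j<N m. measure P (B m j) *\<^sub>R g (c m j)) < e'"
        using \<open>e' > 0\<close> by (rule tendstoD)
      then show "\<forall>\<^sub>F n in sequentially. dist (\<integral>y. g y \<partial>?Q n) (\<integral>y. g y \<partial>P) < e"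
        using eventually_gt_at_top[of 0]
      proof eventually_elim
        case (elim n)
        have "dist (\<integral>y. g y \<partial>?Q n) (\<Sum>j<N m. measure (?Q n) (B m j) *\<^sub>R g (c m j)) \<le> e'"
          unfolding dist_norm by (rule approx[OF borel_prob_empirical[OF elim(2)]])
        moreover have "dist (\<integral>y. g y \<partial>P) (\<Sum>j<N m. measure P (B m j) *\<^sub>R g (c m j)) \<le> e'"
          unfolding dist_norm by (rule approx[OF P])
        ultimately have "dist (\<integral>y. g y \<partial>?Q n) (\<integral>y. g y \<partial>P) \<le> e' + e' + e'"
          using elim(1) by metric
        also have "\<dots> < e" using \<open>e > 0\<close> by (simp add: e'_def)
        finally show ?case .
      qed
    qed
  qed
qed

section \<open>Convergence of eigenfunctions\<close>

lemma norm_complexify: "norm (complexify f) = norm f"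
proof (rule antisym)
  show "norm (complexify f) \<le> norm f"
    by (rule norm_bound) (use norm_bounded[of f] in simp)
  show "norm f \<le> norm (complexify f)"
  proof (rule norm_bound)
    fix x show "norm (apply_bcontfun f x) \<le> norm (complexify f)"
      using norm_bounded[of "complexify f" x] by simp
  qed
qed

lemma complexify_add: "complexify (f + g) = complexify f + complexify g"
  and complexify_diff: "complexify (f - g) = complexify f - complexify g"
  by (auto intro!: bcontfun_eqI simp: plus_bcontfun.rep_eq minus_bcontfun.rep_eq)

text \<open>Dimension one also certifies that a finite basis exists, because the default value for
  the dimension is 0. A one-element basis makes both vectors multiples of it.\<close>

lemma dim_one_imp_proportional:
  assumes dim: "cfun.dim S = 1" and f: "f \<in> S" "f \<noteq> 0" and g: "g \<in> S"
  shows "\<exists>c. g = cscale c f"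
proof -
  have ex: "\<exists>b. cfun.independent b \<and> cfun.span b = cfun.span S"
    using dim unfolding cfun.dim_def by (auto split: if_splits)
  define b where "b = (SOME b. cfun.independent b \<and> cfun.span b = cfun.span S)"
  have "cfun.span b = cfun.span S" unfolding b_def using someI_ex[OF ex] by blast
  moreover have "card b = 1" using dim ex unfolding cfun.dim_def b_def by simp
  ultimately obtain v where v: "cfun.span {v} = cfun.span S" by (auto simp: card_1_singleton_iff)
  have "f \<in> range (\<lambda>k. cscale k v)" "g \<in> range (\<lambda>k. cscale k v)"
    using f(1) g v cfun.span_superset[of S] by (auto simp flip: cfun.span_singleton)
  then obtain p q where pq: "f = cscale p v" "g = cscale q v" by auto
  with f(2) have "p \<noteq> 0" by auto
  then have "g = cscale (q / p) f" unfolding pq by (intro bcontfun_eqI) simp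
  then show ?thesis ..
qed

lemma simple_eigenfunctions_proportional:
  assumes A: "clinear_op A" and \<mu>: "open M" "\<mu> \<in> M" "op_spectrum A \<inter> M = {\<mu>}"
    and simple: "simple_eigenvalue A \<mu>"
    and f: "eigenfunction A f \<mu>" and g: "eigenfunction A g \<mu>"
  shows "\<exists>c. g = cscale c f"
proof (rule dim_one_imp_proportional)
  show "cfun.dim (range (blinfun_apply (spectral_projection A {\<mu>}))) = 1"
    using simple by (simp add: simple_eigenvalue_def algebraic_multiplicity_def)
  show "f \<in> range (blinfun_apply (spectral_projection A {\<mu>}))" "g \<in> range (blinfun_apply (spectral_projection A {\<mu>}))"
    using spectral_projection_eigenfunction[OF A \<mu>] f g unfolding eigenfunction_def by (metis rangeI)+
  show "f \<noteq> 0" using f by (simp add: eigenfunction_def)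
qed

text \<open>The minimum over both signs postpones the choice of sign. Along a subsequence staying
  away from both \<open>f\<close> and \<open>- f\<close>, the eigenfunctions would accumulate at
  some \<open>c f\<close>; norms force \<open>cmod c = 1\<close>, and since the \<open>fs n\<close>
  are real-valued, \<open>c\<close> is real.\<close>

lemma (in collectively_compact) simple_eigenfunctions_converge:
  fixes f :: "'a \<Rightarrow>\<^sub>C real" and fs :: "nat \<Rightarrow> ('a \<Rightarrow>\<^sub>C real)"
  assumes "\<mu> \<noteq> 1" and norm_f: "norm f = 1"
    and simple: "\<And>h. eigenfunction U' h \<mu> \<Longrightarrow> \<exists>c. h = cscale c (complexify f)"
    and lims: "\<mu>s \<longlonglongrightarrow> \<mu>"
    and fs: "\<forall>\<^sub>F n in sequentially. eigenfunction (U n) (complexify (fs n)) (\<mu>s n) \<and> norm (fs n) = 1"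
  shows "(\<lambda>n. min (norm (fs n - f)) (norm (fs n + f))) \<longlonglongrightarrow> 0"
proof (rule ccontr)
  define m where "m n = min (norm (fs n - f)) (norm (fs n + f))" for n
  assume "\<not> (\<lambda>n. min (norm (fs n - f)) (norm (fs n + f))) \<longlonglongrightarrow> 0"
  then obtain e where e: "e > 0" "\<not> (\<forall>\<^sub>F n in sequentially. m n < e)"
    by (auto simp: tendsto_iff m_def dist_real_def)
  obtain n0 where n0: "\<And>n. n \<ge> n0 \<Longrightarrow> eigenfunction (U n) (complexify (fs n)) (\<mu>s n) \<and> norm (fs n) = 1"
    using fs unfolding eventually_sequentially by blast
  have "\<exists>n \<ge> max (Suc j) n0. m n \<ge> e" for j
    using e(2) unfolding eventually_sequentially by (meson not_le)
  then obtain N where N: "\<And>j. N j \<ge> max (Suc j) n0" "\<And>j. m (N j) \<ge> e" by metis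
  have "j \<le> N j" for j using N(1)[of j] by simp
  then have N_lim: "filterlim N at_top sequentially"
    by (intro filterlim_at_top_mono[OF filterlim_ident] always_eventually allI)
  have eig: "eigenfunction (U (N j)) (complexify (fs (N j))) (\<mu>s (N j))" "norm (fs (N j)) = 1" for j
    using n0[of "N j"] N(1)[of j] by auto
  have pos: "N j > 0" for j using N(1)[of j] by simp
  have "blinfun_apply (U (N j) - cscale_op (\<mu>s (N j))) (complexify (fs (N j))) = 0" for j
    using eig(1)[of j] by (subst blinfun.diff_left) (simp add: eigenfunction_def)
  then have zero: "(\<lambda>j. blinfun_apply (U (N j) - cscale_op (\<mu>s (N j))) (complexify (fs (N j)))) \<longlonglongrightarrow> 0"
    by simp
  obtain r h where r: "strict_mono r" "((\<lambda>j. complexify (fs (N j))) \<circ> r) \<longlonglongrightarrow> h" "eigenfunction U' h \<mu>"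
    by (rule approximate_eigenfunctions_converge[OF N_lim pos _ filterlim_compose[OF lims N_lim] zero])
      (simp_all add: norm_complexify eig(2) \<open>\<mu> \<noteq> 1\<close>)
  have lim: "(\<lambda>j. complexify (fs (N (r j)))) \<longlonglongrightarrow> h" using r(2) by (simp add: o_def)
  obtain c where c: "h = cscale c (complexify f)" using simple[OF r(3)] by blast
  have "norm h = 1" using tendsto_norm[OF lim] by (simp add: norm_complexify eig(2) LIMSEQ_const_iff)
  then have "cmod c = 1" by (simp add: c norm_cscale norm_complexify norm_f)
  have "f \<noteq> 0" using norm_f by auto
  \<comment> \<open>At a point where \<open>f\<close> does not vanish, the limit of real values
    reveals the imaginary part of \<open>c\<close>.\<close>
  then obtain x where x: "apply_bcontfun f x \<noteq> 0" by (metis bcontfun_eqI zero_bcontfun.rep_eq)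
  have "(\<lambda>j. Im (apply_bcontfun (complexify (fs (N (r j)))) x)) \<longlonglongrightarrow> Im (apply_bcontfun h x)"
    by (intro tendsto_Im bounded_linear.tendsto[OF bounded_linear_eval] lim)
  then have "Im c = 0" using x by (simp add: c LIMSEQ_const_iff)
  with \<open>cmod c = 1\<close> have "c = 1 \<or> c = -1"
    by (auto simp: cmod_def complex_eq_iff power2_eq_1_iff)
  then have small: "m (N (r j)) \<le> norm (complexify (fs (N (r j))) - h)" for j
  proof
    assume "c = 1"
    then have "h = complexify f" using c by simp
    then have "norm (complexify (fs (N (r j))) - h) = norm (fs (N (r j)) - f)"
      by (simp flip: complexify_diff add: norm_complexify)
    then show ?thesis by (simp add: m_def)
  next
    assume "c = -1"
    then have "h = - complexify f" using c by (simp add: cscale.minus_left)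
    then have "norm (complexify (fs (N (r j))) - h) = norm (fs (N (r j)) + f)"
      by (simp flip: complexify_add add: norm_complexify)
    then show ?thesis by (simp add: m_def)
  qed
  have "\<forall>\<^sub>F j in sequentially. norm (complexify (fs (N (r j))) - h) < e"
    using tendstoD[OF lim e(1)] by (simp add: dist_norm)
  then obtain j where "norm (complexify (fs (N (r j))) - h) < e"
    unfolding eventually_sequentially by blast
  with small[of j] N(2)[of "r j"] show False by simp
qed

text \<open>Where the two sets differ, \<open>f\<close> is within the sup distance of
  \<open>b\<close>, so the symmetric difference lies in a shrinking band around the level set. The
  limit is the mass of that level set, which therefore has to be null: on it, arbitrarily small
  perturbations decide membership.\<close>

lemma measure_superlevel_sym_diff_tendsto:
  fixes f :: "'a::metric_space \<Rightarrow>\<^sub>C real"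
  assumes P: "borel_prob P" and lim: "(\<lambda>n. norm (h n - f)) \<longlonglongrightarrow> 0"
    and b: "measure P {x. apply_bcontfun f x = b} = 0"
  shows "(\<lambda>n. measure P (sym_diff {x. apply_bcontfun f x > b} {x. apply_bcontfun (h n) x > b})) \<longlonglongrightarrow> 0"
proof (rule tendstoI)
  interpret prob_space P using P by (simp add: borel_prob_def)
  define S where "S m = {x. \<bar>apply_bcontfun f x - b\<bar> \<le> inverse (real (Suc m))}" for m
  have S_sets: "S m \<in> events" for m
  proof -
    have "closed (S m)" unfolding S_def by (intro closed_Collect_le continuous_intros) auto
    then show ?thesis using P by (simp add: borel_prob_def)
  qed
  have "(\<lambda>m. measure P (S m)) \<longlonglongrightarrow> measure P (\<Inter>m. S m)"
  proof (rule finite_Lim_measure_decseq)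
    show "decseq S"
      unfolding decseq_def S_def
      by (auto intro: order_trans[OF _ le_imp_inverse_le])
  qed (use S_sets in auto)
  also have "(\<Inter>m. S m) = {x. apply_bcontfun f x = b}"
  proof -
    have "y = 0" if "\<And>m. \<bar>y\<bar> \<le> inverse (real (Suc m))" for y :: real
      using that reals_Archimedean[of "\<bar>y\<bar>"] by (meson not_less zero_less_abs_iff)
    then show ?thesis by (fastforce simp: S_def)
  qed
  finally have S_lim: "(\<lambda>m. measure P (S m)) \<longlonglongrightarrow> 0" using b by simp
  fix e :: real assume "e > 0"
  from tendstoD[OF S_lim this] obtain m where m: "measure P (S m) < e"
    unfolding eventually_sequentially by (auto simp: dist_real_def)
  have "\<forall>\<^sub>F n in sequentially. norm (h n - f) < inverse (real (Suc m))"
    using tendstoD[OF lim, of "inverse (real (Suc m))"] by simp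
  then show "\<forall>\<^sub>F n in sequentially.
      dist (measure P (sym_diff {x. apply_bcontfun f x > b} {x. apply_bcontfun (h n) x > b})) 0 < e"
  proof eventually_elim
    case (elim n)
    have "\<bar>apply_bcontfun (h n) x - apply_bcontfun f x\<bar> < inverse (real (Suc m))" for x
      using elim norm_bounded[of "h n - f" x] by (simp add: minus_bcontfun.rep_eq)
    then have "\<bar>apply_bcontfun f x - b\<bar> \<le> inverse (real (Suc m))"
      if "(apply_bcontfun f x > b) \<noteq> (apply_bcontfun (h n) x > b)" for x
      using that by (smt (verit))
    then have "sym_diff {x. apply_bcontfun f x > b} {x. apply_bcontfun (h n) x > b} \<subseteq> S m"
      unfolding S_def by blast
    then have "measure P (sym_diff {x. apply_bcontfun f x > b} {x. apply_bcontfun (h n) x > b}) \<le> measure P (S m)"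
      by (intro finite_measure_mono S_sets)
    with m show ?case by simp
  qed
qed

section \<open>The three claims along one fixed sample\<close>

lemma isolated_part_open: "open M \<Longrightarrow> isolated_part A (op_spectrum A \<inter> M)"
  by (auto simp: isolated_part_def)

context similarity
begin

context
  fixes P :: "'a measure" and x :: "nat \<Rightarrow> 'a" and \<mu> :: complex and M :: "complex set"
  assumes P: "borel_prob P"
    and weak: "\<And>g :: 'a \<Rightarrow> complex. continuous_on UNIV g \<Longrightarrow> (\<lambda>n. \<integral>y. g y \<partial>empirical x n) \<longlonglongrightarrow> (\<integral>y. g y \<partial>P)"
    and M: "open M" "\<mu> \<in> M" "op_spectrum (U_op k P) \<inter> M = {\<mu>}" "op_spectrum (U_op k P) \<inter> frontier M = {}" "1 \<notin> M"
begin

interpretation collectively_compact "\<lambda>n. T_op k (empirical x n)" "T_op k P" range_closure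
  by (rule collectively_compact_empirical[OF P weak])

lemma fredholm_empirical:
  "n > 0 \<Longrightarrow> z \<in> op_spectrum (U_op k (empirical x n)) \<Longrightarrow> z \<noteq> 1 \<Longrightarrow> op_eigenvalue (U_op k (empirical x n)) z"
  using spectrum_U_empirical eigenvalue_iff_op_eigenvalue by blast

lemma finite_spectrum_empirical:
  assumes "n > 0"
  shows "finite (op_spectrum (U_op k (empirical x n)) \<inter> M)"
proof (rule finite_subset)
  show "op_spectrum (U_op k (empirical x n)) \<inter> M \<subseteq> spectrum (nlap_cmat k x n)"
  proof
    fix z assume z: "z \<in> op_spectrum (U_op k (empirical x n)) \<inter> M"
    then have "z \<noteq> 1" using M(5) by auto
    with z show "z \<in> spectrum (nlap_cmat k x n)"
      using spectrum_U_empirical[OF assms, of z x] by (simp add: spectrum_def)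
  qed
  show "finite (spectrum (nlap_cmat k x n))" by (rule card_finite_spectrum(1)[OF nlap_cmat_carrier])
qed

lemma eigenvalues_converge:
  assumes lams: "\<forall>\<^sub>F n in sequentially. lams n \<in> spectrum (nlap_cmat k x n) \<inter> M"
  shows "lams \<longlonglongrightarrow> \<mu>"
proof (rule tendstoI)
  fix e :: real assume "e > 0"
  have "\<forall>\<^sub>F n in sequentially. op_spectrum (U_op k (empirical x n)) \<inter> M \<subseteq> ball \<mu> e"
    unfolding U_op_def using spectrum_near[OF M[unfolded U_op_def] fredholm_empirical[unfolded U_op_def]
        finite_spectrum_empirical[unfolded U_op_def] \<open>e > 0\<close>] .
  with lams eventually_gt_at_top[of 0] show "\<forall>\<^sub>F n in sequentially. dist (lams n) \<mu> < e"
  proof eventually_elim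
    case (elim n)
    then have "eigenvalue (nlap_cmat k x n) (lams n)" "lams n \<noteq> 1" using M(5) by (auto simp: spectrum_def)
    then have "lams n \<in> op_spectrum (U_op k (empirical x n))"
      using eigenvalue_iff_op_eigenvalue[OF elim(2)] eigenvalue_in_spectrum by blast
    with elim show ?case by (auto simp: dist_commute)
  qed
qed

lemma projections_converge:
  shows "\<forall>\<^sub>F n in sequentially. \<exists>\<Gamma>. separating_curve (U_op k (empirical x n)) (op_spectrum (U_op k (empirical x n)) \<inter> M) \<Gamma>"
    and "(\<lambda>n. blinfun_apply (spectral_projection (U_op k (empirical x n)) (op_spectrum (U_op k (empirical x n)) \<inter> M)) g)
      \<longlonglongrightarrow> blinfun_apply (spectral_projection (U_op k P) {\<mu>}) g"
  unfolding U_op_def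
  using spectral_projections_converge[OF M[unfolded U_op_def] fredholm_empirical[unfolded U_op_def]
      finite_spectrum_empirical[unfolded U_op_def]] by blast+

text \<open>The sign \<open>a n\<close> selects the nearer of \<open>f\<close> and
  \<open>- f\<close>. Both conclusions then follow from sup-norm convergence of
  \<open>a n *\<^sub>R fs n\<close>, with the same signs.\<close>

lemma eigenvectors_converge:
  fixes f :: "'a \<Rightarrow>\<^sub>C real" and v :: "nat \<Rightarrow> real vec" and fs :: "nat \<Rightarrow> ('a \<Rightarrow>\<^sub>C real)"
  assumes simple: "simple_eigenvalue (U_op k P) \<mu>"
    and f: "eigenfunction (U_op k P) (complexify f) \<mu>" "norm f = 1"
    and lams: "\<forall>\<^sub>F n in sequentially. lams n \<in> spectrum (nlap_cmat k x n) \<inter> M"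
    and fs: "\<forall>\<^sub>F n in sequentially. eigenfunction (U_op k (empirical x n)) (complexify (fs n)) (lams n) \<and> norm (fs n) = 1"
    and v: "\<forall>\<^sub>F n in sequentially. \<forall>i<n. apply_bcontfun (fs n) (x i) = v n $ i"
  shows "\<exists>a :: nat \<Rightarrow> real. (\<forall>n. a n \<in> {1, -1}) \<and>
    (\<lambda>n. SUP i\<in>{..<n}. \<bar>a n * v n $ i - apply_bcontfun f (x i)\<bar>) \<longlonglongrightarrow> 0 \<and>
    (\<forall>b. measure P {x. apply_bcontfun f x = b} = 0 \<longrightarrow>
      (\<lambda>n. measure P (sym_diff {x. apply_bcontfun f x > b} {x. a n * apply_bcontfun (fs n) x > b})) \<longlonglongrightarrow> 0)"
proof -
  have "(\<lambda>n. min (norm (fs n - f)) (norm (fs n + f))) \<longlonglongrightarrow> 0"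
  proof (rule simple_eigenfunctions_converge)
    show "\<mu> \<noteq> 1" using M(2,5) by auto
    show "\<exists>c. h = cscale c (complexify f)" if "eigenfunction (id_blinfun - T_op k P) h \<mu>" for h
      using simple_eigenfunctions_proportional[OF clinear_U' M(1,2)] M(3) simple f(1) that
      by (simp add: U_op_def)
    show "lams \<longlonglongrightarrow> \<mu>" by (rule eigenvalues_converge[OF lams])
  qed (use f(2) fs in \<open>simp_all add: U_op_def\<close>)
  moreover define a where "a n = (if norm (fs n - f) \<le> norm (fs n + f) then 1 else -1 :: real)" for n
  have "norm (a n *\<^sub>R fs n - f) = min (norm (fs n - f)) (norm (fs n + f))" for n
    using norm_minus_cancel[of "fs n + f"] by (auto simp: a_def)
  ultimately have lim: "(\<lambda>n. norm (a n *\<^sub>R fs n - f)) \<longlonglongrightarrow> 0" by simp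
  have "(\<lambda>n. SUP i\<in>{..<n}. \<bar>a n * v n $ i - apply_bcontfun f (x i)\<bar>) \<longlonglongrightarrow> 0"
  proof (rule tendsto_sandwich[OF _ _ tendsto_const lim])
    show "\<forall>\<^sub>F n in sequentially. 0 \<le> (SUP i\<in>{..<n}. \<bar>a n * v n $ i - apply_bcontfun f (x i)\<bar>)"
      \<comment> \<open>For \<open>n = 0\<close> the supremum is over the empty set and carries no
        information.\<close>
      using eventually_gt_at_top[of 0]
    proof eventually_elim
      case (elim n)
      then show ?case
        by (intro cSUP_upper2[of _ _ 0] bdd_above_finite) auto
    qed
    show "\<forall>\<^sub>F n in sequentially. (SUP i\<in>{..<n}. \<bar>a n * v n $ i - apply_bcontfun f (x i)\<bar>) \<le> norm (a n *\<^sub>R fs n - f)"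
      using v eventually_gt_at_top[of 0]
    proof eventually_elim
      case (elim n)
      have "\<bar>a n * v n $ i - apply_bcontfun f (x i)\<bar> \<le> norm (a n *\<^sub>R fs n - f)" if "i < n" for i
        using norm_bounded[of "a n *\<^sub>R fs n - f" "x i"] elim(1) that
        by (simp add: minus_bcontfun.rep_eq scaleR_bcontfun.rep_eq)
      with elim(2) show ?case by (intro cSUP_least) auto
    qed
  qed
  moreover have "(\<lambda>n. measure P (sym_diff {x. apply_bcontfun f x > b} {x. a n * apply_bcontfun (fs n) x > b})) \<longlonglongrightarrow> 0"
    if "measure P {x. apply_bcontfun f x = b} = 0" for b
    using measure_superlevel_sym_diff_tendsto[OF P lim that] by (simp add: scaleR_bcontfun.rep_eq)
  ultimately show ?thesis by (intro exI[of _ a]) (auto simp: a_def)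
qed

end

end

text \<open>The frontier condition stops eigenvalues of the matrices from entering \<open>M\<close>
  across its boundary, and \<open>1 \<notin> M\<close> excludes the value at which matrix and
  operator eigenvalues cease to correspond. Normalising real eigenfunctions in sup norm leaves
  exactly a sign undetermined. Sequences are quantified inside the almost sure event, which does not
  depend on them.\<close>

theorem theorem15:
  fixes k :: "'a::metric_space \<Rightarrow> 'a \<Rightarrow> real"
    and P :: "'a measure"
    and \<Omega> :: "'w measure"
    and X :: "nat \<Rightarrow> 'w \<Rightarrow> 'a"
    and l :: real
    and lam :: complex
    and M :: "complex set"
  assumes "compact (UNIV :: 'a set)"
    and "prob_space P" and "sets P = sets borel" and "support P = UNIV"
    and "prob_space \<Omega>"
    and "prob_space.indep_vars \<Omega> (\<lambda>_. borel) X UNIV"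
    and "\<And>i. distr \<Omega> borel (X i) = P"
    and "\<And>x y. k x y = k y x"
    and "continuous_on UNIV (\<lambda>(x, y). k x y)"
    and "l > 0" and "\<And>x y. k x y > l"
    and "op_eigenvalue (U_op k P) lam" and "lam \<noteq> 1"
    and "open M" and "lam \<in> M" and "op_spectrum (U_op k P) \<inter> M = {lam}"
    and "op_spectrum (U_op k P) \<inter> frontier M = {}" and "1 \<notin> M"
  shows
    "(AE \<omega> in \<Omega>. \<forall>lams :: nat \<Rightarrow> complex.
        (\<forall>\<^sub>F n in sequentially. lams n \<in> spectrum (nlap_cmat k (\<lambda>i. X i \<omega>) n) \<inter> M) \<longrightarrow>
        lams \<longlonglongrightarrow> lam)
   \<and> (\<exists>N. AE \<omega> in \<Omega>. \<forall>n>N.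
        isolated_part (U_op k (empirical (\<lambda>i. X i \<omega>) n))
          (op_spectrum (U_op k (empirical (\<lambda>i. X i \<omega>) n)) \<inter> M))
   \<and> (AE \<omega> in \<Omega>.
        (\<forall>\<^sub>F n in sequentially. \<exists>\<Gamma>. separating_curve (U_op k (empirical (\<lambda>i. X i \<omega>) n))
           (op_spectrum (U_op k (empirical (\<lambda>i. X i \<omega>) n)) \<inter> M) \<Gamma>) \<and>
        (\<forall>g. (\<lambda>n. blinfun_apply
                (spectral_projection (U_op k (empirical (\<lambda>i. X i \<omega>) n))
                   (op_spectrum (U_op k (empirical (\<lambda>i. X i \<omega>) n)) \<inter> M)) g)
             \<longlonglongrightarrow> blinfun_apply (spectral_projection (U_op k P) {lam}) g))
   \<and> (simple_eigenvalue (U_op k P) lam \<longrightarrow>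
      (AE \<omega> in \<Omega>. \<forall>(f :: 'a \<Rightarrow>\<^sub>C real) (lams :: nat \<Rightarrow> complex)
            (v :: nat \<Rightarrow> real vec) (fs :: nat \<Rightarrow> ('a \<Rightarrow>\<^sub>C real)).
        eigenfunction (U_op k P) (complexify f) lam \<and> norm f = 1 \<and>
        (\<forall>\<^sub>F n in sequentially.
           lams n \<in> spectrum (nlap_cmat k (\<lambda>i. X i \<omega>) n) \<inter> M \<and>
           eigenvector (nlap_cmat k (\<lambda>i. X i \<omega>) n) (map_vec complex_of_real (v n)) (lams n) \<and>
           eigenfunction (U_op k (empirical (\<lambda>i. X i \<omega>) n)) (complexify (fs n)) (lams n) \<and>
           norm (fs n) = 1 \<and>
           (\<forall>i<n. apply_bcontfun (fs n) (X i \<omega>) = v n $ i)) \<longrightarrow>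
        (\<exists>a :: nat \<Rightarrow> real. (\<forall>n. a n \<in> {1, -1}) \<and>
           (\<lambda>n. SUP i\<in>{..<n}. \<bar>a n * v n $ i - apply_bcontfun f (X i \<omega>)\<bar>) \<longlonglongrightarrow> 0 \<and>
           (\<forall>b. measure P {x. apply_bcontfun f x = b} = 0 \<longrightarrow>
              (\<lambda>n. measure P (sym_diff {x. apply_bcontfun f x > b}
                                       {x. a n * apply_bcontfun (fs n) x > b}))
              \<longlonglongrightarrow> 0))))"
proof -
  interpret S: similarity k l by unfold_locales (fact assms)+
  have P: "borel_prob P" using assms(2,3) by (simp add: borel_prob_def)
  \<comment> \<open>This one event serves all the convergence claims.\<close>
  note weak = AE_empirical_weak_convergence[OF assms(1) P assms(5,6,7)]
  note M = assms(14-18)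
  show ?thesis
  proof (intro conjI impI)
    show "AE \<omega> in \<Omega>. \<forall>lams :: nat \<Rightarrow> complex.
        (\<forall>\<^sub>F n in sequentially. lams n \<in> spectrum (nlap_cmat k (\<lambda>i. X i \<omega>) n) \<inter> M) \<longrightarrow> lams \<longlonglongrightarrow> lam"
      using weak
    proof eventually_elim
      case (elim \<omega>)
      then show ?case using S.eigenvalues_converge[OF P _ M] by blast
    qed
    show "\<exists>N. AE \<omega> in \<Omega>. \<forall>n>N. isolated_part (U_op k (empirical (\<lambda>i. X i \<omega>) n))
          (op_spectrum (U_op k (empirical (\<lambda>i. X i \<omega>) n)) \<inter> M)"
      \<comment> \<open>\<open>M\<close> itself is an isolating neighbourhood for every
        \<open>n\<close>, so any \<open>N\<close> will do.\<close>
      by (intro exI AE_I2 allI impI isolated_part_open assms(14))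
    show "AE \<omega> in \<Omega>.
        (\<forall>\<^sub>F n in sequentially. \<exists>\<Gamma>. separating_curve (U_op k (empirical (\<lambda>i. X i \<omega>) n))
           (op_spectrum (U_op k (empirical (\<lambda>i. X i \<omega>) n)) \<inter> M) \<Gamma>) \<and>
        (\<forall>g. (\<lambda>n. blinfun_apply
                (spectral_projection (U_op k (empirical (\<lambda>i. X i \<omega>) n))
                   (op_spectrum (U_op k (empirical (\<lambda>i. X i \<omega>) n)) \<inter> M)) g)
             \<longlonglongrightarrow> blinfun_apply (spectral_projection (U_op k P) {lam}) g)"
      using weak
    proof eventually_elim
      case (elim \<omega>)
      then show ?case using S.projections_converge[OF P _ M] by blast
    qed
    assume simple: "simple_eigenvalue (U_op k P) lam"
    from weak
    show "AE \<omega> in \<Omega>. \<forall>(f :: 'a \<Rightarrow>\<^sub>C real) (lams :: nat \<Rightarrow> complex)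
            (v :: nat \<Rightarrow> real vec) (fs :: nat \<Rightarrow> ('a \<Rightarrow>\<^sub>C real)).
        eigenfunction (U_op k P) (complexify f) lam \<and> norm f = 1 \<and>
        (\<forall>\<^sub>F n in sequentially.
           lams n \<in> spectrum (nlap_cmat k (\<lambda>i. X i \<omega>) n) \<inter> M \<and>
           eigenvector (nlap_cmat k (\<lambda>i. X i \<omega>) n) (map_vec complex_of_real (v n)) (lams n) \<and>
           eigenfunction (U_op k (empirical (\<lambda>i. X i \<omega>) n)) (complexify (fs n)) (lams n) \<and>
           norm (fs n) = 1 \<and>
           (\<forall>i<n. apply_bcontfun (fs n) (X i \<omega>) = v n $ i)) \<longrightarrow>
        (\<exists>a :: nat \<Rightarrow> real. (\<forall>n. a n \<in> {1, -1}) \<and>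
           (\<lambda>n. SUP i\<in>{..<n}. \<bar>a n * v n $ i - apply_bcontfun f (X i \<omega>)\<bar>) \<longlonglongrightarrow> 0 \<and>
           (\<forall>b. measure P {x. apply_bcontfun f x = b} = 0 \<longrightarrow>
              (\<lambda>n. measure P (sym_diff {x. apply_bcontfun f x > b}
                                       {x. a n * apply_bcontfun (fs n) x > b}))
              \<longlonglongrightarrow> 0))"
    proof eventually_elim
      case (elim \<omega>)
      show ?case
      proof (intro allI impI; elim conjE)
        fix f :: "'a \<Rightarrow>\<^sub>C real" and lams :: "nat \<Rightarrow> complex" and v :: "nat \<Rightarrow> real vec" and fs :: "nat \<Rightarrow> ('a \<Rightarrow>\<^sub>C real)"
        assume f: "eigenfunction (U_op k P) (complexify f) lam" "norm f = 1"
          and ev: "\<forall>\<^sub>F n in sequentially.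
           lams n \<in> spectrum (nlap_cmat k (\<lambda>i. X i \<omega>) n) \<inter> M \<and>
           eigenvector (nlap_cmat k (\<lambda>i. X i \<omega>) n) (map_vec complex_of_real (v n)) (lams n) \<and>
           eigenfunction (U_op k (empirical (\<lambda>i. X i \<omega>) n)) (complexify (fs n)) (lams n) \<and>
           norm (fs n) = 1 \<and>
           (\<forall>i<n. apply_bcontfun (fs n) (X i \<omega>) = v n $ i)"
        show "\<exists>a :: nat \<Rightarrow> real. (\<forall>n. a n \<in> {1, -1}) \<and>
           (\<lambda>n. SUP i\<in>{..<n}. \<bar>a n * v n $ i - apply_bcontfun f (X i \<omega>)\<bar>) \<longlonglongrightarrow> 0 \<and>
           (\<forall>b. measure P {x. apply_bcontfun f x = b} = 0 \<longrightarrow>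
              (\<lambda>n. measure P (sym_diff {x. apply_bcontfun f x > b}
                                       {x. a n * apply_bcontfun (fs n) x > b}))
              \<longlonglongrightarrow> 0)"
          by (rule S.eigenvectors_converge[OF P _ M simple f, of "\<lambda>i. X i \<omega>" lams fs v])
            (use elim ev in \<open>auto elim: eventually_mono\<close>)
      qed
    qed
  qed
qed

end
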